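(* Let $\omega\in\mathcal{D}[a,b]$. Let $\operatorname{arccot}$ denote the branch of the inverse cotangent function which returns values between $0$ and $\pi$. Then: (3a) If the exterior transition measure of $\omega$ is absolutely continuous, and its density $g(x)$ is piecewise continuously differentiable, has a bounded derivative, and is bounded away from $0$ (that is, for some $c>0$, $g(x)>c$ for all $x\in[a,b]$), then for almost all $x\in[a,b]$ $$\omega'(x)=-1+\frac{2}{\pi}\operatorname{arccot}\left[\frac1\pi\left(\log\left(\frac{b-x}{x-a}\right)+\frac{1}{g(x)}\int_a^b\frac{g(u)-g(x)}{u-x}\,du\right)\right].$$ (3b) If the interior transition measure of $\omega$ is absolutely continuous, and its density $h(x)$ is piecewise continuously differentiable, has a bounded derivative, and is bounded away from $0$, then for almost all $x\in[a,b]$ $$\omega'(x)=1-\frac{2}{\pi}\operatorname{arccot}\left[\frac1\pi\left(\log\left(\frac{b-x}{x-a}\right)+\frac{1}{h(x)}\left(\int_a^b\frac{h(u)-h(x)}{u-x}\,du+\frac{2(x-z(\omega))}{A(\omega)}\right)\right)\right].$$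
   Context: Let $a<b$. A diagram on $[a,b]$ is a 1-Lipschitz function $\omega:[a,b]\to\mathbb{R}$ with $a+\omega(a)=b-\omega(b)$; its center is $z=z(\omega)=a+\omega(a)$. (Equivalently, $\omega$ is extended to $\mathbb{R}$ by $\omega(x)=|x-z|$ outside $[a,b]$.) $\mathcal{D}[a,b]$ is the set of diagrams on $[a,b]$. The area is $A(\omega)=\int_a^b(\omega(x)-|x-z|)\,dx$. The domain is $D_\omega=\{(x,y):a\le x\le b,\ |x-z|\le y\le\omega(x)\}$ and the dual domain is $D'_\omega=\{(x,y):a\le x\le b,\ \omega(x)\le y\le\min(\omega(a)+x-a,\ \omega(b)+b-x)\}$. Hooks. The interior hook of $(x,y)\in D_\omega$ is the set of $(x',y')\in D_\omega$ with ($x'\le x$ and $y'-y=x-x'$) or ($x'>x$ and $y'-y=x'-x$). The exterior hook of $(x,y)\in D'_\omega$ is the set of $(x',y')\in D'_\omega$ with ($x'\le x$ and $y-y'=x-x'$) or ($x'>x$ and $y-y'=x'-x$). Hook walks. The exterior (corner) walk is the random walk on $D'_\omega$ that starts at $(b-\omega(a),\omega(a)+\omega(b))$ and at each step moves to a point chosen uniformly (by arc length) from the exterior hook of the current point. The interior (uniform) walk is the random walk on $D_\omega$ that starts at a point chosen uniformly (by area) in $D_\omega$ and at each step moves to a point chosen uniformly (by arc length) from the interior hook of the current point. Each walk converges almost surely to a point on the graph of $\omega$; the distribution of the $x$-coordinate of the limit point is called the exterior, respectively interior, transition measure of $\omega$. *)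

theory Defs
  imports "HOL-Probability.Probability"
begin

section \<open>Diagrams\<close>

text \<open>
  A diagram on \<open>[a,b]\<close> is represented by a total function; its values outside \<open>[a,b]\<close> are
  irrelevant and none of the notions below depends on them.
\<close>

definition diagrams :: "real \<Rightarrow> real \<Rightarrow> (real \<Rightarrow> real) set" where
  "diagrams a b = {\<omega>. 1-lipschitz_on {a..b} \<omega> \<and> a + \<omega> a = b - \<omega> b}"

definition center :: "real \<Rightarrow> (real \<Rightarrow> real) \<Rightarrow> real" where
  "center a \<omega> = a + \<omega> a"

definition area :: "real \<Rightarrow> real \<Rightarrow> (real \<Rightarrow> real) \<Rightarrow> real" where
  "area a b \<omega> = (LINT x:{a..b}|lborel. \<omega> x - \<bar>x - center a \<omega>\<bar>)"

definition diagram_domain :: "real \<Rightarrow> real \<Rightarrow> (real \<Rightarrow> real) \<Rightarrow> (real \<times> real) set" where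
  "diagram_domain a b \<omega> =
     {(x, y). a \<le> x \<and> x \<le> b \<and> \<bar>x - center a \<omega>\<bar> \<le> y \<and> y \<le> \<omega> x}"

definition dual_domain :: "real \<Rightarrow> real \<Rightarrow> (real \<Rightarrow> real) \<Rightarrow> (real \<times> real) set" where
  "dual_domain a b \<omega> =
     {(x, y). a \<le> x \<and> x \<le> b \<and> \<omega> x \<le> y \<and> y \<le> min (\<omega> a + x - a) (\<omega> b + b - x)}"

section \<open>Hooks\<close>

definition interior_hook ::
  "real \<Rightarrow> real \<Rightarrow> (real \<Rightarrow> real) \<Rightarrow> real \<times> real \<Rightarrow> (real \<times> real) set" where
  "interior_hook a b \<omega> = (\<lambda>(x, y). {(x', y') \<in> diagram_domain a b \<omega>.
     (x' \<le> x \<and> y' - y = x - x') \<or> (x' > x \<and> y' - y = x' - x)})"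

definition exterior_hook ::
  "real \<Rightarrow> real \<Rightarrow> (real \<Rightarrow> real) \<Rightarrow> real \<times> real \<Rightarrow> (real \<times> real) set" where
  "exterior_hook a b \<omega> = (\<lambda>(x, y). {(x', y') \<in> dual_domain a b \<omega>.
     (x' \<le> x \<and> y - y' = x - x') \<or> (x' > x \<and> y - y' = x' - x)})"

section \<open>Hook walks\<close>

text \<open>
  If \<open>\<gamma>\<close> is injective and parametrized by arc length, \<open>arc_uniform \<gamma> H\<close> is the uniform distribution,
  by arc length, on the part \<open>H\<close> of the curve \<open>\<gamma>\<close>. The first case covers a hook that
  consists of the single point \<open>\<gamma> 0\<close>: there the walk stays put.
\<close>

definition arc_uniform :: "(real \<Rightarrow> real \<times> real) \<Rightarrow> (real \<times> real) set \<Rightarrow> (real \<times> real) measure" where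
  "arc_uniform \<gamma> H =
     (if emeasure lborel (\<gamma> -` H) = 0 then return borel (\<gamma> 0)
      else distr (uniform_measure lborel (\<gamma> -` H)) borel \<gamma>)"

text \<open>
  The legs of a hook have slopes \<open>1\<close> and \<open>-1\<close>, so the arc length parameter \<open>t\<close>, measured from the
  corner \<open>(x, y)\<close> of the hook, is \<open>sqrt 2\<close> times the horizontal displacement.
\<close>

definition interior_step ::
  "real \<Rightarrow> real \<Rightarrow> (real \<Rightarrow> real) \<Rightarrow> real \<times> real \<Rightarrow> (real \<times> real) measure" where
  "interior_step a b \<omega> = (\<lambda>(x, y).
     arc_uniform (\<lambda>t. (x + t / sqrt 2, y + \<bar>t\<bar> / sqrt 2)) (interior_hook a b \<omega> (x, y)))"

definition exterior_step ::
  "real \<Rightarrow> real \<Rightarrow> (real \<Rightarrow> real) \<Rightarrow> real \<times> real \<Rightarrow> (real \<times> real) measure" where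
  "exterior_step a b \<omega> = (\<lambda>(x, y).
     arc_uniform (\<lambda>t. (x + t / sqrt 2, y - \<bar>t\<bar> / sqrt 2)) (exterior_hook a b \<omega> (x, y)))"

text \<open>
  \<open>X\<close> is a Markov chain on the probability space \<open>M\<close> with initial distribution \<open>\<mu>\<close> and
  transition kernel \<open>K\<close>: given \<open>X 0, \<dots>, X n\<close>, the conditional distribution of \<open>X (Suc n)\<close>
  is \<open>K (X n)\<close>.
\<close>

definition markov_chain ::
  "'s measure \<Rightarrow> 'a::topological_space measure \<Rightarrow> ('a \<Rightarrow> 'a measure) \<Rightarrow> (nat \<Rightarrow> 's \<Rightarrow> 'a) \<Rightarrow> bool" where
  "markov_chain M \<mu> K X \<longleftrightarrow>
     prob_space M \<and>
     (\<forall>n. X n \<in> borel_measurable M) \<and>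
     distr M borel (X 0) = \<mu> \<and>
     (\<forall>n. \<forall>A \<in> sets (\<Pi>\<^sub>M i\<in>{..n}. borel). \<forall>B \<in> sets borel.
        emeasure M {s \<in> space M. (\<lambda>i\<in>{..n}. X i s) \<in> A \<and> X (Suc n) s \<in> B} =
        (\<integral>\<^sup>+ s. indicator A (\<lambda>i\<in>{..n}. X i s) * emeasure (K (X n s)) B \<partial>M))"

definition exterior_walk ::
  "real \<Rightarrow> real \<Rightarrow> (real \<Rightarrow> real) \<Rightarrow> 's measure \<Rightarrow> (nat \<Rightarrow> 's \<Rightarrow> real \<times> real) \<Rightarrow> bool" where
  "exterior_walk a b \<omega> M X \<longleftrightarrow>
     markov_chain M (return borel (b - \<omega> a, \<omega> a + \<omega> b)) (exterior_step a b \<omega>) X"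

text \<open>
  If the domain has area \<open>0\<close>, its \<open>uniform_measure\<close> is the null measure and there is no
  interior walk.
\<close>

definition interior_walk ::
  "real \<Rightarrow> real \<Rightarrow> (real \<Rightarrow> real) \<Rightarrow> 's measure \<Rightarrow> (nat \<Rightarrow> 's \<Rightarrow> real \<times> real) \<Rightarrow> bool" where
  "interior_walk a b \<omega> M X \<longleftrightarrow>
     markov_chain M (uniform_measure lborel (diagram_domain a b \<omega>)) (interior_step a b \<omega>) X"

section \<open>Transition measures\<close>

text \<open>
  The distribution of the \<open>x\<close>-coordinate of the limit point does not depend on the realization
  of the walk, so it suffices to consider walks defined on the path space \<open>nat \<Rightarrow> real \<times> real\<close>.
\<close>

definition is_exterior_transition_measure ::
  "real \<Rightarrow> real \<Rightarrow> (real \<Rightarrow> real) \<Rightarrow> real measure \<Rightarrow> bool" where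
  "is_exterior_transition_measure a b \<omega> \<mu> \<longleftrightarrow>
     (\<exists>(M :: (nat \<Rightarrow> real \<times> real) measure) X. exterior_walk a b \<omega> M X \<and>
        \<mu> = distr M borel (\<lambda>s. fst (lim (\<lambda>n. X n s))))"

definition is_interior_transition_measure ::
  "real \<Rightarrow> real \<Rightarrow> (real \<Rightarrow> real) \<Rightarrow> real measure \<Rightarrow> bool" where
  "is_interior_transition_measure a b \<omega> \<mu> \<longleftrightarrow>
     (\<exists>(M :: (nat \<Rightarrow> real \<times> real) measure) X. interior_walk a b \<omega> M X \<and>
        \<mu> = distr M borel (\<lambda>s. fst (lim (\<lambda>n. X n s))))"

text \<open>
  \<open>\<mu>\<close> is absolutely continuous and concentrated on \<open>[a,b]\<close>, with density \<open>f\<close> there.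
  Nonnegativity of \<open>f\<close> is explicit because \<open>ennreal\<close> truncates negative values.
\<close>

definition has_density_on :: "real measure \<Rightarrow> real \<Rightarrow> real \<Rightarrow> (real \<Rightarrow> real) \<Rightarrow> bool" where
  "has_density_on \<mu> a b f \<longleftrightarrow>
     (\<forall>x\<in>{a..b}. f x \<ge> 0) \<and>
     (\<lambda>x. ennreal (f x) * indicator {a..b} x) \<in> borel_measurable lborel \<and>
     \<mu> = density lborel (\<lambda>x. ennreal (f x) * indicator {a..b} x)"

text \<open>
  Piecewise continuously differentiable with bounded derivative. Jumps at the finitely many
  exceptional points are allowed, unlike in \<open>piecewise_C1_differentiable_on\<close>.
\<close>

definition piecewise_C1_bounded_deriv :: "real \<Rightarrow> real \<Rightarrow> (real \<Rightarrow> real) \<Rightarrow> bool" where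
  "piecewise_C1_bounded_deriv a b f \<longleftrightarrow>
     (\<exists>S. finite S \<and> f C1_differentiable_on ({a..b} - S) \<and> bounded (deriv f ` ({a..b} - S)))"

definition bounded_away_from_0 :: "real \<Rightarrow> real \<Rightarrow> (real \<Rightarrow> real) \<Rightarrow> bool" where
  "bounded_away_from_0 a b f \<longleftrightarrow> (\<exists>c>0. \<forall>x\<in>{a..b}. f x > c)"

section \<open>Inverse cotangent\<close>

definition arccot :: "real \<Rightarrow> real" where
  "arccot y = (THE \<theta>. 0 < \<theta> \<and> \<theta> < pi \<and> cot \<theta> = y)"

lemma arccot_eq: "arccot y = pi / 2 - arctan y"
  unfolding arccot_def
proof (rule the_equality)
  have "- (pi / 2) < arctan y" "arctan y < pi / 2"
    using arctan_lbound arctan_ubound by auto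
  moreover have "cot (pi / 2 - arctan y) = tan (arctan y)"
    by (simp add: cot_def tan_def sin_diff cos_diff)
  ultimately show "0 < pi / 2 - arctan y \<and> pi / 2 - arctan y < pi \<and> cot (pi / 2 - arctan y) = y"
    by (simp add: tan_arctan)
next
  fix \<theta> assume *: "0 < \<theta> \<and> \<theta> < pi \<and> cot \<theta> = y"
  have "tan (pi / 2 - \<theta>) = cot \<theta>"
    by (simp add: cot_def tan_def sin_diff cos_diff)
  with * have "arctan y = pi / 2 - \<theta>"
    by (intro arctan_unique) auto
  then show "\<theta> = pi / 2 - arctan y" by simp
qed

end

(*
  Put f x = (x + omega x) / 2, so that f and x - f x are both nondecreasing. Let df
  be the Stieltjes measure of f, and for Im w > 0 and the feet al <= be of a hook let

    G(al, be) = exp (- int_al^be df(u) / (w - u)) / (w - be).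

  G is harmonic for the exterior walk: each leg of the hook is carried by a generalized inverse of f
  or of x - f x to a Stieltjes integral of an exact derivative, and the two legs add up to
  (be - al) G(al, be). Along the walk one characteristic coordinate increases and the other decreases,
  and the expected length of the hook shrinks geometrically, so the walk converges to a point of the
  graph, where G(x, x) = 1 / (w - x). Hence the Cauchy transform of the exterior transition measure is
  G(a, b). The interior walk is the exterior walk of the reflected diagram with a uniform starting point,
  and its Cauchy transform is the mean of G over the domain, which is computed in characteristic
  coordinates.

  This determines exp (- int_a^b df(u) / (w - u)), whose argument at w = x + i e is the Poisson
  integral of df, at most pi times the identity. As e tends to 0 the Poisson integral recovers pi f',
  and the Plemelj formula for the density of the transition measure evaluates the argument.
*)
theory Submission
  imports Defs
begin

section \<open>Stieltjes integrals of slope between 0 and 1\<close>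

text \<open>The function \<open>f\<close> is only monotone and Lipschitz. It may be flat or have
  slope 1 on whole intervals, so the inverses of \<open>f\<close> and of \<open>x - f x\<close>
  jump, and G cannot simply be differentiated along a leg. The calculus is therefore done on
  increments: the Stieltjes measure of an interval is at most its length, so an identity whose two
  sides have increments over [s, t] agreeing up to a multiple of (t - s)^2 is exact. The two legs
  are one computation: the exponents for \<open>f\<close> and for \<open>x - f x\<close> add up to a
  logarithm, so G has a second form with \<open>x - f x\<close> in place of \<open>f\<close>. This
  symmetry is why \<open>profile\<close> asks for both monotonicities.

  The last limit would in general need a theorem on radial limits at almost every point. Here the
  density is Lipschitz near all but finitely many points, so the boundary argument is known and
  continuous there; integrating the Poisson integrals over short intervals then shows that
  \<open>f\<close> is a primitive of it divided by pi. The formulas thus hold off a finite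
  set.\<close>

definition profile :: "(real \<Rightarrow> real) \<Rightarrow> bool" where
  "profile f \<longleftrightarrow> mono f \<and> mono (\<lambda>x. x - f x)"

lemma profile_compl: "profile f \<Longrightarrow> profile (\<lambda>x. x - f x)"
  by (simp add: profile_def)

lemma profile_mono: "profile f \<Longrightarrow> x \<le> y \<Longrightarrow> f x \<le> f y"
  by (auto simp: profile_def mono_def)

lemma profile_diff: "profile f \<Longrightarrow> x \<le> y \<Longrightarrow> f y - f x \<le> y - x"
  by (force simp: profile_def mono_def)

lemma profile_lipschitz: "profile f \<Longrightarrow> \<bar>f y - f x\<bar> \<le> \<bar>y - x\<bar>"
  using profile_mono[of f x y] profile_mono[of f y x] profile_diff[of f x y] profile_diff[of f y x]
  by linarith

lemma profile_continuous: assumes "profile f" shows "continuous_on S f"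
proof -
  have "1-lipschitz_on S f"
    using profile_lipschitz[OF assms] by (intro lipschitz_onI) (auto simp: dist_real_def)
  then show ?thesis by (rule lipschitz_on_continuous_on)
qed

lemma emeasure_stieltjes_Ioc:
  assumes "profile f" "s \<le> t"
  shows "emeasure (interval_measure f) {s<..t} = ennreal (f t - f s)"
  using assms(2)
  by (rule emeasure_interval_measure_Ioc)
     (use profile_mono[OF assms(1)] profile_continuous[OF assms(1), of UNIV] in
      \<open>auto simp: continuous_on_eq_continuous_within intro: continuous_within_subset\<close>)

lemma measure_stieltjes_Ioc:
  assumes "profile f" "s \<le> t"
  shows "measure (interval_measure f) {s<..t} = f t - f s"
  using emeasure_stieltjes_Ioc[OF assms] profile_mono[OF assms] by (simp add: measure_def)

lemma stieltjes_integrable: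
  fixes \<phi> :: "real \<Rightarrow> 'b :: {banach, second_countable_topology}"
  assumes f: "profile f" and "s \<le> t" and \<phi>: "continuous_on {s..t} \<phi>"
  shows "set_integrable (interval_measure f) {s<..t} \<phi>"
proof -
  have "bounded (\<phi> ` {s..t})"
    by (intro compact_imp_bounded compact_continuous_image \<phi>) auto
  then obtain C where C: "\<And>u. u \<in> {s..t} \<Longrightarrow> norm (\<phi> u) \<le> C"
    unfolding bounded_iff by blast
  have "(\<lambda>u. indicator {s<..t} u *\<^sub>R \<phi> u) \<in> borel_measurable borel"
    by (rule borel_measurable_continuous_on_indicator) (auto intro: continuous_on_subset[OF \<phi>])
  then show ?thesis
    unfolding set_integrable_def
    using emeasure_stieltjes_Ioc[OF f \<open>s \<le> t\<close>]
    by (intro integrableI_bounded_set[where A="{s<..t}" and B=C])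
       (auto intro!: AE_I2 C split: split_indicator)
qed

lemma stieltjes_combine:
  fixes \<phi> :: "real \<Rightarrow> 'b :: {banach, second_countable_topology}"
  assumes f: "profile f" and "r \<le> s" "s \<le> t" and \<phi>: "continuous_on {r..t} \<phi>"
  shows "(LINT u:{r<..t}|interval_measure f. \<phi> u) =
    (LINT u:{r<..s}|interval_measure f. \<phi> u) + (LINT u:{s<..t}|interval_measure f. \<phi> u)"
proof -
  have "{r<..t} = {r<..s} \<union> {s<..t}" using assms by auto
  moreover have "set_integrable (interval_measure f) {r<..s} \<phi>"
    "set_integrable (interval_measure f) {s<..t} \<phi>"
    using assms by (auto intro!: stieltjes_integrable intro: continuous_on_subset[OF \<phi>])
  ultimately show ?thesis by (simp add: set_integral_Un)
qed

text \<open>Slope at most 1 trades the mass \<open>f t - f s\<close> for the length t - s, a common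
  scale for the Stieltjes integrals of all profiles.\<close>

lemma stieltjes_bound:
  fixes \<phi> :: "real \<Rightarrow> 'b :: {banach, second_countable_topology}"
  assumes f: "profile f" and "s \<le> t" and \<phi>: "continuous_on {s..t} \<phi>"
    and C: "\<And>u. u \<in> {s..t} \<Longrightarrow> norm (\<phi> u) \<le> C"
  shows "norm (LINT u:{s<..t}|interval_measure f. \<phi> u) \<le> C * (t - s)"
proof -
  let ?M = "interval_measure f"
  have C0: "0 \<le> C" using order_trans[OF norm_ge_zero C[of s]] \<open>s \<le> t\<close> by auto
  have "norm (LINT u:{s<..t}|?M. \<phi> u) \<le> (LINT u|?M. C * indicator {s<..t} u)"
    unfolding set_lebesgue_integral_def
    by (rule Bochner_Integration.integral_norm_bound_integral)
       (use stieltjes_integrable[OF f \<open>s \<le> t\<close> \<phi>] emeasure_stieltjes_Ioc[OF f \<open>s \<le> t\<close>] C in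
        \<open>auto simp: set_integrable_def split: split_indicator\<close>)
  also have "\<dots> = C * (f t - f s)"
    using measure_stieltjes_Ioc[OF f \<open>s \<le> t\<close>] by simp
  also have "\<dots> \<le> C * (t - s)"
    using profile_diff[OF f \<open>s \<le> t\<close>] C0 by (rule mult_left_mono)
  finally show ?thesis .
qed

text \<open>A quadratic modulus forces derivative zero at every point. This stands in for the chain
  rule with integrators that need not be differentiable: take for \<open>P\<close> the difference of
  the two sides of an identity and show that its first-order increments cancel.\<close>

lemma quadratic_increments_constant:
  fixes P :: "real \<Rightarrow> 'b :: real_normed_vector"
  assumes "\<alpha> \<le> \<beta>"
    and quad: "\<And>s t. \<alpha> \<le> s \<Longrightarrow> s \<le> t \<Longrightarrow> t \<le> \<beta> \<Longrightarrow> norm (P t - P s) \<le> C * (t - s)\<^sup>2"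
  shows "P \<beta> = P \<alpha>"
proof -
  \<comment> \<open>The derivative at s within the interval is approached from both sides, so the
    bound is made symmetric, with a nonnegative constant.\<close>
  have q: "norm (P t - P s) \<le> \<bar>C\<bar> * (t - s)\<^sup>2" if "s \<in> {\<alpha>..\<beta>}" "t \<in> {\<alpha>..\<beta>}" for s t
  proof -
    have "norm (P t - P s) \<le> C * (t - s)\<^sup>2"
      using quad[of s t] quad[of t s] that
      by (cases "s \<le> t") (auto simp: norm_minus_commute power2_commute)
    also have "\<dots> \<le> \<bar>C\<bar> * (t - s)\<^sup>2" by (intro mult_right_mono) auto
    finally show ?thesis .
  qed
  have "(P has_derivative (\<lambda>h. 0)) (at s within {\<alpha>..\<beta>})" if s: "s \<in> {\<alpha>..\<beta>}" for s
  proof (rule has_derivativeI_sandwich[where e=1 and H="\<lambda>t. \<bar>C\<bar> * \<bar>t - s\<bar>"])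
    show "((\<lambda>t. \<bar>C\<bar> * \<bar>t - s\<bar>) \<longlongrightarrow> 0) (at s within {\<alpha>..\<beta>})"
      by (auto intro!: tendsto_eq_intros)
    fix t assume t: "t \<in> {\<alpha>..\<beta>}" "t \<noteq> s"
    then have "norm (P t - P s) \<le> \<bar>C\<bar> * \<bar>t - s\<bar> * norm (t - s)"
      using q[OF s t(1)] by (simp add: power2_eq_square)
    then show "norm (P t - P s - 0) / norm (t - s) \<le> \<bar>C\<bar> * \<bar>t - s\<bar>"
      using t by (simp add: pos_divide_le_eq)
  qed auto
  then show ?thesis
    using has_derivative_zero_constant[of "{\<alpha>..\<beta>}" P] \<open>\<alpha> \<le> \<beta>\<close> by fastforce
qed

lemma norm_exp_minus_le: 
  fixes z :: complex
  assumes "norm z \<le> R"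
  shows "norm (exp (- z) - 1) \<le> exp R * norm z" "norm (exp (- z) - 1 + z) \<le> exp R * (norm z)\<^sup>2"
proof -
  have *: "exp (norm z) \<le> exp R" using assms by simp
  have "norm (exp (-z) - 1) \<le> exp (norm z) * norm z"
    using Taylor_exp_field[of "-z" 0] by simp
  also have "\<dots> \<le> exp R * norm z" using * by (rule mult_right_mono) simp
  finally show "norm (exp (- z) - 1) \<le> exp R * norm z" .
  have "norm (exp (-z) - 1 + z) \<le> exp (norm z) * (norm z)\<^sup>2"
    using Taylor_exp_field[of "-z" 1] by (simp add: power2_eq_square algebra_simps)
  also have "\<dots> \<le> exp R * (norm z)\<^sup>2" using * by (rule mult_right_mono) simp
  finally show "norm (exp (- z) - 1 + z) \<le> exp R * (norm z)\<^sup>2" .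
qed

text \<open>
  The fundamental theorem of calculus for \<open>exp (- \<Phi>)\<close>, where \<open>\<Phi>\<close> need not be differentiable: the
  two sides differ by increments of second order.
\<close>

lemma stieltjes_exp_integral:
  fixes \<phi> :: "real \<Rightarrow> complex"
  assumes f: "profile f" and "\<alpha> \<le> \<beta>" and \<phi>: "continuous_on {\<alpha>..\<beta>} \<phi>"
  defines "\<Phi> \<equiv> \<lambda>s. LINT u:{\<alpha><..s}|interval_measure f. \<phi> u"
  shows "continuous_on {\<alpha>..\<beta>} \<Phi>"
    and "(LINT s:{\<alpha><..\<beta>}|interval_measure f. exp (- \<Phi> s) * \<phi> s) = 1 - exp (- \<Phi> \<beta>)"
proof -
  let ?M = "interval_measure f"
  have "bounded (\<phi> ` {\<alpha>..\<beta>})"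
    by (intro compact_imp_bounded compact_continuous_image \<phi>) auto
  then obtain C where C: "\<And>u. u \<in> {\<alpha>..\<beta>} \<Longrightarrow> norm (\<phi> u) \<le> C"
    unfolding bounded_iff by blast
  have C0: "0 \<le> C" using order_trans[OF norm_ge_zero C[of \<alpha>]] \<open>\<alpha> \<le> \<beta>\<close> by auto
  have \<Phi>_add: "\<Phi> t = \<Phi> s + (LINT u:{s<..t}|?M. \<phi> u)" if "\<alpha> \<le> s" "s \<le> t" "t \<le> \<beta>" for s t
    unfolding \<Phi>_def using that
    by (intro stieltjes_combine[OF f]) (auto intro: continuous_on_subset[OF \<phi>])
  have \<phi>_bd: "norm (LINT u:{s<..t}|?M. \<phi> u) \<le> C * (t - s)" if "\<alpha> \<le> s" "s \<le> t" "t \<le> \<beta>" for s t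
    using that C by (intro stieltjes_bound[OF f]) (auto intro: continuous_on_subset[OF \<phi>])
  have \<Phi>_lip: "norm (\<Phi> t - \<Phi> s) \<le> C * (t - s)" if "\<alpha> \<le> s" "s \<le> t" "t \<le> \<beta>" for s t
    using \<phi>_bd[OF that] \<Phi>_add[OF that] by simp
  have "C-lipschitz_on {\<alpha>..\<beta>} \<Phi>"
    using \<Phi>_lip C0 by (intro lipschitz_on_leI) (auto simp: dist_norm norm_minus_commute)
  then show cont: "continuous_on {\<alpha>..\<beta>} \<Phi>" by (rule lipschitz_on_continuous_on)
  define R where "R = C * (\<beta> - \<alpha>)"
  have R: "norm (\<Phi> t - \<Phi> s) \<le> R" if "\<alpha> \<le> s" "s \<le> t" "t \<le> \<beta>" for s t
    using \<Phi>_lip[OF that] mult_left_mono[OF _ C0, of "t - s" "\<beta> - \<alpha>"] that unfolding R_def by linarith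
  have \<Phi>0: "\<Phi> \<alpha> = 0" by (simp add: \<Phi>_def set_lebesgue_integral_def)
  have e: "norm (exp (- \<Phi> s)) \<le> exp R" if "s \<in> {\<alpha>..\<beta>}" for s
    using R[of \<alpha> s] that norm_exp[of "- \<Phi> s"] by (auto simp: \<Phi>0 intro: order_trans)
  have e1: "norm (exp (- \<Phi> t) - exp (- \<Phi> s)) \<le> exp R * (exp R * (C * (t - s)))"
    and e2: "norm (exp (- \<Phi> t) - exp (- \<Phi> s) + exp (- \<Phi> s) * (\<Phi> t - \<Phi> s)) \<le>
      exp R * (exp R * (C * (t - s))\<^sup>2)"
    if st: "\<alpha> \<le> s" "s \<le> t" "t \<le> \<beta>" for s t
  proof -
    let ?z = "\<Phi> t - \<Phi> s"
    have "exp (- \<Phi> t) = exp (- \<Phi> s) * exp (- ?z)" by (simp flip: exp_add)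
    then have 1: "exp (- \<Phi> t) - exp (- \<Phi> s) = exp (- \<Phi> s) * (exp (- ?z) - 1)"
      and 2: "exp (- \<Phi> t) - exp (- \<Phi> s) + exp (- \<Phi> s) * ?z =
        exp (- \<Phi> s) * (exp (- ?z) - 1 + ?z)"
      by (simp_all add: algebra_simps)
    have "norm (exp (- ?z) - 1) \<le> exp R * (C * (t - s))"
      using norm_exp_minus_le(1)[OF R[OF st]] \<Phi>_lip[OF st]
      by (meson exp_ge_zero mult_left_mono order_trans)
    then show "norm (exp (- \<Phi> t) - exp (- \<Phi> s)) \<le> exp R * (exp R * (C * (t - s)))"
      unfolding 1 norm_mult using e[of s] st by (intro mult_mono) auto
    have "(norm ?z)\<^sup>2 \<le> (C * (t - s))\<^sup>2" using \<Phi>_lip[OF st] by (intro power_mono) auto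
    then have "norm (exp (- ?z) - 1 + ?z) \<le> exp R * (C * (t - s))\<^sup>2"
      using norm_exp_minus_le(2)[OF R[OF st]] by (meson exp_ge_zero mult_left_mono order_trans)
    then show "norm (exp (- \<Phi> t) - exp (- \<Phi> s) + exp (- \<Phi> s) * ?z) \<le>
      exp R * (exp R * (C * (t - s))\<^sup>2)"
      unfolding 2 norm_mult using e[of s] st by (intro mult_mono) auto
  qed
  \<comment> \<open>The claim is P \<beta> = P \<alpha>, because \<Phi> vanishes at
    \<alpha>.\<close>
  define P where "P s = (LINT u:{\<alpha><..s}|?M. exp (- \<Phi> u) * \<phi> u) + exp (- \<Phi> s)" for s
  have c1: "continuous_on {s..t} (\<lambda>u. exp (- \<Phi> u) * \<phi> u)" if "\<alpha> \<le> s" "t \<le> \<beta>" for s t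
    using that by (intro continuous_intros continuous_on_subset[OF \<phi>] continuous_on_subset[OF cont]) auto
  have c2: "continuous_on {s..t} (\<lambda>u. (exp (- \<Phi> u) - c) * \<phi> u)" if "\<alpha> \<le> s" "t \<le> \<beta>" for s t c
    using that by (intro continuous_intros continuous_on_subset[OF \<phi>] continuous_on_subset[OF cont]) auto
  have "norm (P t - P s) \<le> 2 * (exp R)\<^sup>2 * C\<^sup>2 * (t - s)\<^sup>2" if st: "\<alpha> \<le> s" "s \<le> t" "t \<le> \<beta>" for s t
  proof -
    have [simp]: "set_integrable ?M {s<..t} \<phi>"
      using st by (intro stieltjes_integrable[OF f]) (auto intro: continuous_on_subset[OF \<phi>])
    have [simp]: "set_integrable ?M {s<..t} (\<lambda>u. exp (- \<Phi> u) * \<phi> u)"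
      using st c1 by (intro stieltjes_integrable[OF f]) auto
    have "(LINT u:{\<alpha><..t}|?M. exp (- \<Phi> u) * \<phi> u) = (LINT u:{\<alpha><..s}|?M. exp (- \<Phi> u) * \<phi> u) +
       (LINT u:{s<..t}|?M. exp (- \<Phi> u) * \<phi> u)"
      using st c1 by (intro stieltjes_combine[OF f]) auto
    \<comment> \<open>Freezing exp (- \<Phi>) at s splits off the first-order term, which cancels
      against the Taylor expansion of the increment of exp (- \<Phi>). Both remainders are quadratic
      in t - s.\<close>
    moreover have "(LINT u:{s<..t}|?M. exp (- \<Phi> u) * \<phi> u) =
      (LINT u:{s<..t}|?M. (exp (- \<Phi> u) - exp (- \<Phi> s)) * \<phi> u) + exp (- \<Phi> s) * (\<Phi> t - \<Phi> s)"
      using \<Phi>_add[OF st] by (simp add: left_diff_distrib set_integral_diff)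
    ultimately have P: "P t - P s = (LINT u:{s<..t}|?M. (exp (- \<Phi> u) - exp (- \<Phi> s)) * \<phi> u) +
       (exp (- \<Phi> t) - exp (- \<Phi> s) + exp (- \<Phi> s) * (\<Phi> t - \<Phi> s))"
      unfolding P_def by simp
    have "norm (LINT u:{s<..t}|?M. (exp (- \<Phi> u) - exp (- \<Phi> s)) * \<phi> u) \<le>
        exp R * (exp R * (C * (t - s))) * C * (t - s)"
    proof (rule stieltjes_bound[OF f])
      fix u assume u: "u \<in> {s..t}"
      have "norm (exp (- \<Phi> u) - exp (- \<Phi> s)) \<le> exp R * (exp R * (C * (u - s)))"
        using e1[of s u] u st by auto
      also have "\<dots> \<le> exp R * (exp R * (C * (t - s)))"
        using u C0 by (intro mult_left_mono) auto
      finally show "norm ((exp (- \<Phi> u) - exp (- \<Phi> s)) * \<phi> u) \<le> exp R * (exp R * (C * (t - s))) * C"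
        unfolding norm_mult using C[of u] u st C0 by (intro mult_mono) auto
    qed (use st c2 in auto)
    from norm_triangle_mono[OF this e2[OF st]]
    have "norm (P t - P s) \<le> exp R * (exp R * (C * (t - s))) * C * (t - s) +
        exp R * (exp R * (C * (t - s))\<^sup>2)"
      unfolding P .
    also have "\<dots> = 2 * (exp R)\<^sup>2 * C\<^sup>2 * (t - s)\<^sup>2"
      by (simp add: power2_eq_square algebra_simps)
    finally show ?thesis .
  qed
  from quadratic_increments_constant[OF \<open>\<alpha> \<le> \<beta>\<close> this] have "P \<beta> = P \<alpha>" by blast
  then show "(LINT s:{\<alpha><..\<beta>}|?M. exp (- \<Phi> s) * \<phi> s) = 1 - exp (- \<Phi> \<beta>)"
    unfolding P_def \<Phi>0 by (simp add: set_lebesgue_integral_def[of _ "{}"] algebra_simps)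
qed

text \<open>The image under \<open>r\<close> of Lebesgue measure on [f \<alpha>, f \<beta>] is the
  Stieltjes measure on (\<alpha>, \<beta>], because both have the same distribution function. Where
  \<open>f\<close> is flat its right inverse is not unique; any choice serves, since only countably
  many v are affected.\<close>

lemma stieltjes_pushforward:
  fixes h :: "real \<Rightarrow> 'b :: {banach, second_countable_topology}"
  assumes f: "profile f" and "\<alpha> \<le> \<beta>"
    and r: "\<And>v. v \<in> {f \<alpha>..f \<beta>} \<Longrightarrow> r v \<in> {\<alpha>..\<beta>} \<and> f (r v) = v"
    and h: "h \<in> borel_measurable borel"
  shows "(LINT v:{f \<alpha>..f \<beta>}|lborel. h (r v)) = (LINT s:{\<alpha><..\<beta>}|interval_measure f. h s)"
proof -
  let ?p = "f \<alpha>" and ?q = "f \<beta>"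
  have pq: "?p \<le> ?q" using profile_mono[OF f \<open>\<alpha> \<le> \<beta>\<close>] .
  \<comment> \<open>The constant extension is monotone on the whole line, which supplies the
    measurability that is not assumed of \<open>r\<close>.\<close>
  define r' where "r' v = (if v < ?p then \<alpha> else if v > ?q then \<beta> else r v)" for v
  have "mono r'"
  proof (rule monoI)
    fix v v' :: real assume "v \<le> v'"
    moreover have "r v \<le> r v'" if "?p \<le> v" "v < v'" "v' \<le> ?q"
      using profile_mono[OF f, of "r v'" "r v"] r[of v] r[of v'] that by force
    ultimately show "r' v \<le> r' v'"
      using r[of v] r[of v'] \<open>\<alpha> \<le> \<beta>\<close> by (cases "v = v'") (auto simp: r'_def)
  qed
  then have [measurable]: "r' \<in> borel_measurable borel" by (rule borel_measurable_mono)
  define M1 where "M1 = distr (density lborel (indicator {?p..?q})) borel r'"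
  define M2 where "M2 = density (interval_measure f) (indicator {\<alpha><..\<beta>})"
  have M1: "emeasure M1 A = emeasure lborel ({?p..?q} \<inter> r' -` A)" if A: "A \<in> sets borel" for A
    unfolding M1_def using measurable_sets_borel[OF \<open>r' \<in> _\<close> A] A
    by (simp add: emeasure_distr emeasure_restricted)
  have M2: "emeasure M2 A = emeasure (interval_measure f) ({\<alpha><..\<beta>} \<inter> A)" if "A \<in> sets borel" for A
    unfolding M2_def using that by (simp add: emeasure_restricted)
  have fin: "emeasure M1 UNIV = ennreal (?q - ?p)" "emeasure M2 UNIV = ennreal (?q - ?p)"
    using pq emeasure_stieltjes_Ioc[OF f \<open>\<alpha> \<le> \<beta>\<close>] by (simp_all add: M1 M2)
  have "finite_borel_measure M1" "finite_borel_measure M2"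
    using fin by (auto intro!: finite_borel_measure.intro finite_borel_measure_axioms.intro finite_measureI
       simp: M1_def M2_def)
  moreover have "cdf M1 = cdf M2"
  proof
    fix x
    consider "x < \<alpha>" | "\<alpha> \<le> x" "x < \<beta>" | "\<beta> \<le> x" by linarith
    then show "cdf M1 x = cdf M2 x"
    proof cases
      case 1
      then have "{?p..?q} \<inter> r' -` {..x} = {}" using r by (force simp: r'_def)
      moreover have "{\<alpha><..\<beta>} \<inter> {..x} = {}" using 1 by auto
      ultimately show ?thesis by (simp add: cdf_def measure_def M1 M2)
    next
      case 2
      have fx: "?p \<le> f x" "f x \<le> ?q" using 2 profile_mono[OF f] by auto
      have "{\<alpha><..\<beta>} \<inter> {..x} = {\<alpha><..x}" using 2 by auto
      then have "emeasure M2 {..x} = ennreal (f x - ?p)"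
        using emeasure_stieltjes_Ioc[OF f] 2 by (simp add: M2)
      moreover have "emeasure M1 {..x} = ennreal (f x - ?p)"
      proof (rule antisym)
        have "{?p..?q} \<inter> r' -` {..x} \<subseteq> {?p..f x}"
          using r profile_mono[OF f] by (force simp: r'_def)
        then have "emeasure M1 {..x} \<le> emeasure lborel {?p..f x}"
          unfolding M1[OF atMost_borel] by (rule emeasure_mono) simp
        then show "emeasure M1 {..x} \<le> ennreal (f x - ?p)" using fx by simp
        \<comment> \<open>For v < f x the point r v cannot lie to the right of x, while r v \<le> x
          forces v \<le> f x. Only v = f x is undecided, a null set.\<close>
        have "{?p..<f x} \<subseteq> {?p..?q} \<inter> r' -` {..x}"
        proof
          fix v assume v: "v \<in> {?p..<f x}"
          then have "r v \<le> x" using r[of v] profile_mono[OF f, of x "r v"] fx by force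
          then show "v \<in> {?p..?q} \<inter> r' -` {..x}" using v fx by (auto simp: r'_def)
        qed
        then have "emeasure lborel {?p..<f x} \<le> emeasure M1 {..x}"
          unfolding M1[OF atMost_borel]
          using measurable_sets_borel[OF \<open>r' \<in> _\<close>, of "{..x}"] by (intro emeasure_mono) auto
        then show "ennreal (f x - ?p) \<le> emeasure M1 {..x}" using fx by simp
      qed
      ultimately show ?thesis by (simp add: cdf_def measure_def)
    next
      case 3
      have "{?p..?q} \<inter> r' -` {..x} = {?p..?q}" using 3 r \<open>\<alpha> \<le> \<beta>\<close> by (force simp: r'_def)
      moreover have "{\<alpha><..\<beta>} \<inter> {..x} = {\<alpha><..\<beta>}" using 3 by auto
      ultimately show ?thesis 
        using pq emeasure_stieltjes_Ioc[OF f \<open>\<alpha> \<le> \<beta>\<close>] by (simp add: cdf_def measure_def M1 M2)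
    qed
  qed
  ultimately have "M1 = M2" by (rule cdf_unique')
  have restrict: "density M (indicator A) = density M (\<lambda>x. ennreal (indicator A x))"
    for M :: "real measure" and A
    by (simp add: ennreal_indicator)
  have "(LINT v:{?p..?q}|lborel. h (r v)) = (LINT v:{?p..?q}|lborel. h (r' v))"
    by (rule set_lebesgue_integral_cong) (auto simp: r'_def)
  also have "\<dots> = (LINT s|M1. h s)"
    unfolding M1_def set_lebesgue_integral_def restrict using h
    by (subst integral_distr) (auto simp: integral_density)
  also have "\<dots> = (LINT s:{\<alpha><..\<beta>}|interval_measure f. h s)"
    unfolding \<open>M1 = M2\<close> M2_def set_lebesgue_integral_def restrict using h
    by (subst integral_density) auto
  finally show ?thesis .
qed

lemma stieltjes_const:
  fixes c :: "'b :: {banach, second_countable_topology}"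
  assumes "profile f" "s \<le> t"
  shows "(LINT u:{s<..t}|interval_measure f. c) = (f t - f s) *\<^sub>R c"
  using measure_stieltjes_Ioc[OF assms] emeasure_stieltjes_Ioc[OF assms]
  by (simp add: set_lebesgue_integral_def)

lemma profile_id: "profile (\<lambda>x. x)"
  by (simp add: profile_def mono_def)

lemma stieltjes_add_compl:
  fixes \<phi> :: "real \<Rightarrow> 'b :: {banach, second_countable_topology}"
  assumes f: "profile f" and "\<alpha> \<le> \<beta>" and lip: "K-lipschitz_on {\<alpha>..\<beta>} \<phi>"
  shows "(LINT u:{\<alpha><..\<beta>}|interval_measure f. \<phi> u) +
    (LINT u:{\<alpha><..\<beta>}|interval_measure (\<lambda>x. x - f x). \<phi> u) = (LINT u:{\<alpha><..\<beta>}|lborel. \<phi> u)"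
proof -
  have \<phi>: "continuous_on {\<alpha>..\<beta>} \<phi>" using lip by (rule lipschitz_on_continuous_on)
  define I where "I g s t = (LINT u:{s<..t}|interval_measure g. \<phi> u)" for g s t
  have K0: "0 \<le> K" using lip by (rule lipschitz_on_nonneg)
  have I: "norm (I g \<alpha> t - I g \<alpha> s - (g t - g s) *\<^sub>R \<phi> s) \<le> K * (t - s) * (t - s)"
    if g: "profile g" and st: "\<alpha> \<le> s" "s \<le> t" "t \<le> \<beta>" for g s t
  proof -
    have c: "continuous_on {s..t} \<phi>" "continuous_on {\<alpha>..t} \<phi>"
      using st by (auto intro: continuous_on_subset[OF \<phi>])
    have "I g \<alpha> t - I g \<alpha> s = I g s t"
      unfolding I_def using stieltjes_combine[OF g st(1,2) c(2)] by simp
    also have "\<dots> - (g t - g s) *\<^sub>R \<phi> s = (LINT u:{s<..t}|interval_measure g. \<phi> u - \<phi> s)"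
      unfolding I_def using stieltjes_integrable[OF g st(2)] c
      by (subst set_integral_diff) (auto simp: stieltjes_const[OF g st(2)])
    also have "norm \<dots> \<le> K * (t - s) * (t - s)"
    proof (rule stieltjes_bound[OF g st(2)])
      fix u assume u: "u \<in> {s..t}"
      then have "norm (\<phi> u - \<phi> s) \<le> K * \<bar>u - s\<bar>"
        using lipschitz_onD[OF lip, of u s] st by (auto simp: dist_norm)
      also have "\<dots> \<le> K * (t - s)" using u K0 by (intro mult_left_mono) auto
      finally show "norm (\<phi> u - \<phi> s) \<le> K * (t - s)" .
    qed (auto intro!: continuous_intros c)
    finally show ?thesis .
  qed
  let ?f' = "\<lambda>x. x - f x"
  define P where "P s = I f \<alpha> s + I ?f' \<alpha> s - I (\<lambda>x. x) \<alpha> s" for s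
  have "norm (P t - P s) \<le> 3 * K * (t - s)\<^sup>2" if st: "\<alpha> \<le> s" "s \<le> t" "t \<le> \<beta>" for s t
  proof -
    have "P t - P s = (I f \<alpha> t - I f \<alpha> s - (f t - f s) *\<^sub>R \<phi> s) +
      (I ?f' \<alpha> t - I ?f' \<alpha> s - (?f' t - ?f' s) *\<^sub>R \<phi> s) -
      (I (\<lambda>x. x) \<alpha> t - I (\<lambda>x. x) \<alpha> s - (t - s) *\<^sub>R \<phi> s)"
      by (simp add: P_def algebra_simps)
    also have "norm \<dots> \<le> K * (t - s) * (t - s) + K * (t - s) * (t - s) + K * (t - s) * (t - s)"
      by (intro norm_triangle_le_diff norm_triangle_le add_mono I st f profile_compl profile_id)
    finally show ?thesis by (simp add: power2_eq_square algebra_simps)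
  qed
  from quadratic_increments_constant[OF \<open>\<alpha> \<le> \<beta>\<close> this] have "P \<beta> = P \<alpha>" .
  then show ?thesis
    unfolding P_def I_def lborel_eq_real[symmetric] by (simp add: set_lebesgue_integral_def)
qed

section \<open>The harmonic kernel\<close>

definition cauchy_int :: "(real \<Rightarrow> real) \<Rightarrow> complex \<Rightarrow> real \<Rightarrow> real \<Rightarrow> complex" where
  "cauchy_int f w \<alpha> \<beta> = (LINT u:{\<alpha><..\<beta>}|interval_measure f. 1 / (w - of_real u))"

text \<open>The preference for the right foot in the denominator is a matter of notation:
  \<open>harmonic_kernel_compl\<close> is the equal form based on the left foot.\<close>

definition harmonic_kernel :: "(real \<Rightarrow> real) \<Rightarrow> complex \<Rightarrow> real \<Rightarrow> real \<Rightarrow> complex" where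
  "harmonic_kernel f w \<alpha> \<beta> = exp (- cauchy_int f w \<alpha> \<beta>) / (w - of_real \<beta>)"

lemma minus_of_real_nz: "Im w > 0 \<Longrightarrow> w - of_real u \<noteq> 0"
  by (auto simp: complex_eq_iff)

lemma norm_inverse_minus_of_real: 
  assumes "Im w > 0" shows "norm (1 / (w - of_real u)) \<le> 1 / Im w"
proof -
  have "Im w \<le> norm (w - of_real u)" using abs_Im_le_cmod[of "w - of_real u"] assms by simp
  then show ?thesis using assms by (simp add: norm_divide frac_le)
qed

lemma cauchy_kernel_lipschitz:
  assumes w: "Im w > 0"
  shows "((1 / Im w)\<^sup>2)-lipschitz_on S (\<lambda>u. 1 / (w - of_real u))"
proof (rule lipschitz_onI)
  fix u v :: real
  have "1 / (w - of_real u) - 1 / (w - of_real v) =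
    of_real (u - v) * (1 / (w - of_real u)) * (1 / (w - of_real v))"
    using minus_of_real_nz[OF w] by (simp add: field_simps)
  then have "dist (1 / (w - of_real u)) (1 / (w - of_real v)) =
    dist u v * norm (1 / (w - of_real u)) * norm (1 / (w - of_real v))"
    by (simp only: dist_norm norm_mult norm_of_real real_norm_def)
  also have "\<dots> \<le> dist u v * (1 / Im w) * (1 / Im w)"
    using norm_inverse_minus_of_real[OF w] w by (intro mult_mono) auto
  finally show "dist (1 / (w - of_real u)) (1 / (w - of_real v)) \<le> (1 / Im w)\<^sup>2 * dist u v"
    by (simp add: power2_eq_square mult.commute)
qed simp

lemma cauchy_kernel_continuous:
  "Im w > 0 \<Longrightarrow> continuous_on S (\<lambda>u. 1 / (w - of_real u))"
  using lipschitz_on_continuous_on[OF cauchy_kernel_lipschitz] .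

lemma cauchy_int_combine:
  assumes "profile f" "Im w > 0" "r \<le> s" "s \<le> t"
  shows "cauchy_int f w r t = cauchy_int f w r s + cauchy_int f w s t"
  unfolding cauchy_int_def using assms by (intro stieltjes_combine cauchy_kernel_continuous)

lemma norm_cauchy_int_le:
  assumes "profile f" "Im w > 0" "s \<le> t"
  shows "norm (cauchy_int f w s t) \<le> (t - s) / Im w"
  using stieltjes_bound[OF assms(1,3) cauchy_kernel_continuous[OF assms(2)]
      norm_inverse_minus_of_real[OF assms(2)]]
  by (simp add: cauchy_int_def)

text \<open>With Im w > 0 the difference w - u stays off the branch cut, so the principal logarithm
  gives a primitive along the whole interval.\<close>

lemma lborel_cauchy_kernel:
  assumes w: "Im w > 0" and "\<alpha> \<le> \<beta>"
  shows "(LINT u:{\<alpha>..\<beta>}|lborel. 1 / (w - of_real u)) = Ln (w - of_real \<alpha>) - Ln (w - of_real \<beta>)"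
proof -
  have nonpos: "w - of_real u \<notin> \<real>\<^sub>\<le>\<^sub>0" for u
    using w by (auto simp: complex_nonpos_Reals_iff)
  have "((\<lambda>u. - Ln (w - of_real u)) has_vector_derivative 1 / (w - of_real u)) (at u within {\<alpha>..\<beta>})" for u
    using nonpos[of u] minus_of_real_nz[OF w, of u]
    by (intro has_vector_derivative_real_field)
       (auto intro!: derivative_eq_intros simp: field_simps)
  from integral_FTC_Icc[OF \<open>\<alpha> \<le> \<beta>\<close> this cauchy_kernel_continuous[OF w]]
  show ?thesis by (simp add: set_lebesgue_integral_def)
qed

lemma cauchy_int_add_compl:
  assumes f: "profile f" and w: "Im w > 0" and "\<alpha> \<le> \<beta>"
  shows "cauchy_int f w \<alpha> \<beta> + cauchy_int (\<lambda>x. x - f x) w \<alpha> \<beta> =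
    Ln (w - of_real \<alpha>) - Ln (w - of_real \<beta>)"
proof -
  have "cauchy_int f w \<alpha> \<beta> + cauchy_int (\<lambda>x. x - f x) w \<alpha> \<beta> = (LINT u:{\<alpha><..\<beta>}|lborel. 1 / (w - of_real u))"
    unfolding cauchy_int_def
    by (rule stieltjes_add_compl[OF f \<open>\<alpha> \<le> \<beta>\<close> cauchy_kernel_lipschitz[OF w]])
  also have "\<dots> = (LINT u:{\<alpha>..\<beta>}|lborel. 1 / (w - of_real u))"
    unfolding set_lebesgue_integral_def
    by (rule integral_cong_AE) (use AE_lborel_singleton[of \<alpha>] in \<open>auto split: split_indicator\<close>)
  finally show ?thesis
    using lborel_cauchy_kernel[OF w \<open>\<alpha> \<le> \<beta>\<close>] by simp
qed

lemma exp_cauchy_int_compl: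
  assumes f: "profile f" and w: "Im w > 0" and "\<alpha> \<le> \<beta>"
  shows "exp (cauchy_int f w \<alpha> \<beta> + cauchy_int (\<lambda>x. x - f x) w \<alpha> \<beta>) =
    (w - of_real \<alpha>) / (w - of_real \<beta>)"
  using minus_of_real_nz[OF w] by (simp add: cauchy_int_add_compl[OF assms] exp_diff)

text \<open>Exchanging \<open>f\<close> for \<open>x - f x\<close> in the exponent produces the
  factor (w - \<alpha>) / (w - \<beta>), which moves the pole to the left foot. The defining form
  suits a leg along which the right foot moves, this one a leg along which the left foot
  moves.\<close>

lemma harmonic_kernel_compl:
  assumes f: "profile f" and w: "Im w > 0" and "\<alpha> \<le> \<beta>"
  shows "harmonic_kernel f w \<alpha> \<beta> = exp (cauchy_int (\<lambda>x. x - f x) w \<alpha> \<beta>) / (w - of_real \<alpha>)"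
proof -
  have "exp (cauchy_int (\<lambda>x. x - f x) w \<alpha> \<beta>) =
    exp (- cauchy_int f w \<alpha> \<beta>) * ((w - of_real \<alpha>) / (w - of_real \<beta>))"
    unfolding exp_cauchy_int_compl[OF assms, symmetric] by (simp flip: exp_add)
  then show ?thesis
    using minus_of_real_nz[OF w] by (simp add: harmonic_kernel_def)
qed

lemma continuous_on_cauchy_int:
  assumes "profile f" "Im w > 0"
  shows "continuous_on {\<alpha>..\<beta>} (\<lambda>s. cauchy_int f w \<alpha> s)"
  using stieltjes_exp_integral(1)[OF assms(1) _ cauchy_kernel_continuous[OF assms(2)]]
  unfolding cauchy_int_def by (cases "\<alpha> \<le> \<beta>") auto

lemma exp_cauchy_pushforward:
  assumes f: "profile f" and w: "Im w > 0" and "\<alpha> \<le> \<beta>"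
    and r: "\<And>v. v \<in> {f \<alpha>..f \<beta>} \<Longrightarrow> r v \<in> {\<alpha>..\<beta>} \<and> f (r v) = v"
  shows "(LINT v:{f \<alpha>..f \<beta>}|lborel. exp (- cauchy_int f w \<alpha> (r v)) / (w - of_real (r v))) =
    1 - exp (- cauchy_int f w \<alpha> \<beta>)"
proof -
  define h where "h s = exp (- cauchy_int f w \<alpha> s) / (w - of_real s)" for s
  \<comment> \<open>Continuity is known on the interval only, whereas the pushforward wants a Borel
    function on the line.\<close>
  define h' where "h' s = indicator {\<alpha>..\<beta>} s *\<^sub>R h s" for s
  have "continuous_on {\<alpha>..\<beta>} h"
    unfolding h_def using minus_of_real_nz[OF w]
    by (intro continuous_intros continuous_on_cauchy_int f w) auto
  then have [measurable]: "h' \<in> borel_measurable borel"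
    unfolding h'_def by (intro borel_measurable_continuous_on_indicator) auto
  have "(LINT v:{f \<alpha>..f \<beta>}|lborel. h (r v)) = (LINT v:{f \<alpha>..f \<beta>}|lborel. h' (r v))"
    using r by (intro set_lebesgue_integral_cong) (auto simp: h'_def)
  also have "\<dots> = (LINT s:{\<alpha><..\<beta>}|interval_measure f. h' s)"
    by (rule stieltjes_pushforward[OF f \<open>\<alpha> \<le> \<beta>\<close> r]) auto
  also have "\<dots> = (LINT s:{\<alpha><..\<beta>}|interval_measure f. exp (- cauchy_int f w \<alpha> s) * (1 / (w - of_real s)))"
    by (intro set_lebesgue_integral_cong) (auto simp: h'_def h_def)
  also have "\<dots> = 1 - exp (- cauchy_int f w \<alpha> \<beta>)"
    using stieltjes_exp_integral(2)[OF f \<open>\<alpha> \<le> \<beta>\<close> cauchy_kernel_continuous[OF w]]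
    unfolding cauchy_int_def by simp
  finally show ?thesis by (simp add: h_def)
qed

lemma harmonic_kernel_integral_right:
  assumes f: "profile f" and w: "Im w > 0" and "\<alpha> \<le> \<beta>"
    and r: "\<And>v. v \<in> {f \<alpha>..f \<beta>} \<Longrightarrow> r v \<in> {\<alpha>..\<beta>} \<and> f (r v) = v"
  shows "(LINT v:{f \<alpha>..f \<beta>}|lborel. harmonic_kernel f w \<alpha> (r v)) =
    1 - (w - of_real \<beta>) * harmonic_kernel f w \<alpha> \<beta>"
  using exp_cauchy_pushforward[OF assms] minus_of_real_nz[OF w] by (simp add: harmonic_kernel_def)

lemma harmonic_kernel_integral_left:
  assumes f: "profile f" and w: "Im w > 0" and "\<alpha> \<le> \<beta>"
    and r: "\<And>t. t \<in> {\<alpha> - f \<alpha>..\<beta> - f \<beta>} \<Longrightarrow> r t \<in> {\<alpha>..\<beta>} \<and> r t - f (r t) = t"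
  shows "(LINT t:{\<alpha> - f \<alpha>..\<beta> - f \<beta>}|lborel. harmonic_kernel f w (r t) \<beta>) =
    (w - of_real \<alpha>) * harmonic_kernel f w \<alpha> \<beta> - 1"
proof -
  let ?f' = "\<lambda>x. x - f x"
  note f' = profile_compl[OF f]
  let ?E = "exp (cauchy_int ?f' w \<alpha> \<beta>)"
  have "(LINT t:{?f' \<alpha>..?f' \<beta>}|lborel. harmonic_kernel f w (r t) \<beta>) =
    (LINT t:{?f' \<alpha>..?f' \<beta>}|lborel. ?E * (exp (- cauchy_int ?f' w \<alpha> (r t)) / (w - of_real (r t))))"
  proof (intro set_lebesgue_integral_cong allI impI)
    fix t assume "t \<in> {?f' \<alpha>..?f' \<beta>}"
    then have rt: "\<alpha> \<le> r t" "r t \<le> \<beta>" using r by auto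
    \<comment> \<open>Additivity writes the exponential over [r t, \<beta>] as the constant one over
      [\<alpha>, \<beta>] times the inverse of the one over [\<alpha>, r t]. What remains is the
      integrand of the other leg for the complementary profile.\<close>
    then show "harmonic_kernel f w (r t) \<beta> =
      ?E * (exp (- cauchy_int ?f' w \<alpha> (r t)) / (w - of_real (r t)))"
      unfolding harmonic_kernel_compl[OF f w rt(2)] cauchy_int_combine[OF f' w rt]
      by (simp flip: exp_add)
  qed simp
  also have "\<dots> = ?E * (LINT t:{?f' \<alpha>..?f' \<beta>}|lborel. exp (- cauchy_int ?f' w \<alpha> (r t)) / (w - of_real (r t)))"
    by (rule set_integral_mult_right)
  also have "\<dots> = ?E * (1 - exp (- cauchy_int ?f' w \<alpha> \<beta>))"
    using exp_cauchy_pushforward[OF f' w \<open>\<alpha> \<le> \<beta>\<close> r] by simp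
  also have "\<dots> = (w - of_real \<alpha>) * harmonic_kernel f w \<alpha> \<beta> - 1"
    using minus_of_real_nz[OF w] by (simp add: harmonic_kernel_compl[OF f w \<open>\<alpha> \<le> \<beta>\<close>] right_diff_distrib flip: exp_add)
  finally show ?thesis .
qed

lemma norm_harmonic_kernel_le:
  assumes f: "profile f" and w: "Im w > 0" and "\<alpha> \<le> \<beta>" "\<beta> - \<alpha> \<le> L"
  shows "norm (harmonic_kernel f w \<alpha> \<beta>) \<le> exp (L / Im w) / Im w"
proof -
  have "norm (exp (- cauchy_int f w \<alpha> \<beta>)) \<le> exp (norm (- cauchy_int f w \<alpha> \<beta>))" by (rule norm_exp)
  also have "\<dots> \<le> exp (L / Im w)"
    using norm_cauchy_int_le[OF f w \<open>\<alpha> \<le> \<beta>\<close>] divide_right_mono[OF assms(4), of "Im w"] w by simp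
  finally have "norm (exp (- cauchy_int f w \<alpha> \<beta>)) * norm (1 / (w - of_real \<beta>)) \<le> exp (L / Im w) * (1 / Im w)"
    using norm_inverse_minus_of_real[OF w] by (intro mult_mono) auto
  then show ?thesis by (simp add: harmonic_kernel_def norm_divide)
qed

lemma harmonic_kernel_tendsto:
  assumes f: "profile f" and w: "Im w > 0" and "\<And>n. \<alpha> n \<le> \<beta> n"
    and "\<alpha> \<longlonglongrightarrow> x" "\<beta> \<longlonglongrightarrow> x"
  shows "(\<lambda>n. harmonic_kernel f w (\<alpha> n) (\<beta> n)) \<longlonglongrightarrow> 1 / (w - of_real x)"
proof -
  have "(\<lambda>n. cauchy_int f w (\<alpha> n) (\<beta> n)) \<longlonglongrightarrow> 0"
  proof (rule Lim_null_comparison)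
    show "(\<lambda>n. (\<beta> n - \<alpha> n) / Im w) \<longlonglongrightarrow> 0"
      using tendsto_divide[OF tendsto_diff[OF assms(5,4)] tendsto_const[of "Im w"]] w by simp
  qed (use norm_cauchy_int_le[OF f w] assms in auto)
  then have "(\<lambda>n. exp (- cauchy_int f w (\<alpha> n) (\<beta> n)) / (w - of_real (\<beta> n))) \<longlonglongrightarrow> exp (- 0) / (w - of_real x)"
    by (intro tendsto_intros assms minus_of_real_nz w)
  then show ?thesis by (simp add: harmonic_kernel_def)
qed

section \<open>Feet of a hook\<close>

text \<open>
  With \<open>f x = (x + \<omega> x) / 2\<close>, the point \<open>(x, y)\<close> lies above the graph of \<open>\<omega>\<close> iff
  \<open>f x \<le> (x + y) / 2\<close>, that is, iff \<open>(x - y) / 2 \<le> x - f x\<close>. One of the two characteristic coordinates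
  \<open>(x - y) / 2\<close>, \<open>(x + y) / 2\<close> is constant along each leg of a hook.
\<close>

locale profile_on =
  fixes a b :: real and f :: "real \<Rightarrow> real"
  assumes ab: "a < b" and f: "profile f"
begin

text \<open>On a right leg v = (x + y) / 2 is fixed and the leg stays above the graph as long as f u
  \<le> v; the supremum is its end. Admitting u = a unconditionally keeps the set nonempty, so that
  \<open>rfoot\<close> is total, monotone and valued in [a, b]. In \<open>lfoot\<close> the point b
  has this role.\<close>

definition rfoot :: "real \<Rightarrow> real" where
  "rfoot v = Sup {u \<in> {a..b}. u = a \<or> f u \<le> v}"

definition lfoot :: "real \<Rightarrow> real" where
  "lfoot t = Inf {u \<in> {a..b}. u = b \<or> t \<le> u - f u}"

text \<open>The dual domain in characteristic coordinates: the first bound on (x + y) / 2 is the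
  graph, the last two inequalities are the upper sides of slopes -1 and 1. See
  \<open>dom_half_profile\<close>.\<close>

definition dom :: "(real \<times> real) set" where
  "dom = {(x, y). a \<le> x \<and> x \<le> b \<and> f x \<le> (x + y) / 2 \<and> (x + y) / 2 \<le> f b \<and> a - f a \<le> (x - y) / 2}"

definition lfoot_at :: "real \<times> real \<Rightarrow> real" where
  "lfoot_at p = lfoot ((fst p - snd p) / 2)"

definition rfoot_at :: "real \<times> real \<Rightarrow> real" where
  "rfoot_at p = rfoot ((fst p + snd p) / 2)"

definition leg_point :: "real \<times> real \<Rightarrow> real \<Rightarrow> real \<times> real" where
  "leg_point p u = (u, snd p - \<bar>u - fst p\<bar>)"

text \<open>Both legs have slope 1 or -1, so arc length is proportional to horizontal displacement:
  a uniform \<theta> in [0, 1] yields a uniform point of the hook.\<close>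

definition hook_point :: "real \<times> real \<Rightarrow> real \<Rightarrow> real \<times> real" where
  "hook_point p \<theta> = leg_point p (lfoot_at p + \<theta> * (rfoot_at p - lfoot_at p))"

lemma rfoot_bounds: "a \<le> rfoot v" "rfoot v \<le> b"
  unfolding rfoot_def using ab by (auto intro!: cSup_upper cSup_least bdd_aboveI[of _ b])

lemma lfoot_bounds: "a \<le> lfoot t" "lfoot t \<le> b"
proof -
  have "b \<in> {u \<in> {a..b}. u = b \<or> t \<le> u - f u}" using ab by simp
  then show "a \<le> lfoot t" "lfoot t \<le> b"
    unfolding lfoot_def by (intro cInf_greatest; fastforce) (intro cInf_lower bdd_belowI[of _ a]; use ab in auto)
qed

lemma mono_rfoot: "mono rfoot"
  unfolding rfoot_def using ab
  by (intro monoI cSup_subset_mono) (auto intro!: bdd_aboveI[of _ b] exI[of _ a])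

lemma mono_lfoot: "mono lfoot"
proof (rule monoI)
  fix t t' :: real assume "t \<le> t'"
  moreover have "b \<in> {u \<in> {a..b}. u = b \<or> t' \<le> u - f u}" using ab by simp
  ultimately show "lfoot t \<le> lfoot t'"
    unfolding lfoot_def by (intro cInf_superset_mono bdd_belowI[of _ a]) (blast, auto)
qed

lemma measurable_rfoot [measurable]: "rfoot \<in> borel_measurable borel"
  and measurable_lfoot [measurable]: "lfoot \<in> borel_measurable borel"
  by (intro borel_measurable_mono mono_rfoot mono_lfoot)+

lemma rfoot_upper: "u \<in> {a..b} \<Longrightarrow> f u \<le> v \<Longrightarrow> u \<le> rfoot v"
  unfolding rfoot_def by (auto intro!: cSup_upper bdd_aboveI[of _ b])

lemma lfoot_lower: "u \<in> {a..b} \<Longrightarrow> t \<le> u - f u \<Longrightarrow> lfoot t \<le> u"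
  unfolding lfoot_def by (auto intro!: cInf_lower bdd_belowI[of _ a])

text \<open>The supremum is attained, which gives \<open>f (rfoot v) \<le> v\<close>. The
  intermediate value theorem yields a preimage of v; it lies to the left of the foot, which gives
  the other inequality. So \<open>rfoot\<close> is a right inverse of \<open>f\<close> as required
  by \<open>stieltjes_pushforward\<close>.\<close>

lemma f_rfoot:
  assumes v: "v \<in> {f a..f b}"
  shows "f (rfoot v) = v"
proof -
  let ?S = "{u \<in> {a..b}. f u \<le> v}"
  have S: "{u \<in> {a..b}. u = a \<or> f u \<le> v} = ?S" using v by auto
  have "?S = {a..b} \<inter> {u. f u \<le> v}" by auto
  then have "closed ?S"
    by (simp only:) (intro closed_Int closed_Collect_le continuous_intros profile_continuous f closed_atLeastAtMost)
  then have "Sup ?S \<in> ?S"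
    using v ab by (intro closed_contains_Sup) (auto intro!: bdd_aboveI[of _ b] exI[of _ a])
  then have "f (rfoot v) \<le> v" unfolding rfoot_def S by blast
  moreover obtain u where "a \<le> u" "u \<le> b" "f u = v"
    using IVT'[of f a v b] v ab profile_continuous[OF f] by auto
  ultimately show ?thesis
    using profile_mono[OF f, of u "rfoot v"] rfoot_upper[of u v] by auto
qed

lemma f_lfoot:
  assumes t: "t \<in> {a - f a..b - f b}"
  shows "lfoot t - f (lfoot t) = t"
proof -
  note f' = profile_compl[OF f]
  let ?S = "{u \<in> {a..b}. t \<le> u - f u}"
  have S: "{u \<in> {a..b}. u = b \<or> t \<le> u - f u} = ?S" using t by auto
  have "?S = {a..b} \<inter> {u. t \<le> u - f u}" by auto
  then have "closed ?S"
    by (simp only:) (intro closed_Int closed_Collect_le continuous_intros profile_continuous f closed_atLeastAtMost)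
  then have "Inf ?S \<in> ?S"
    using t ab by (intro closed_contains_Inf) (auto intro!: bdd_belowI[of _ a] exI[of _ b])
  then have "t \<le> lfoot t - f (lfoot t)" unfolding lfoot_def S by blast
  moreover obtain u where "a \<le> u" "u \<le> b" "u - f u = t"
    using IVT'[of "\<lambda>x. x - f x" a t b] t ab profile_continuous[OF f'] by auto
  ultimately show ?thesis
    using profile_mono[OF f', of "lfoot t" u] lfoot_lower[of u t] by auto
qed

lemma measurable_feet [measurable]:
  "lfoot_at \<in> borel_measurable borel" "rfoot_at \<in> borel_measurable borel"
  unfolding lfoot_at_def rfoot_at_def by (simp_all add: borel_prod[symmetric])

lemma dom_measurable [measurable]: "dom \<in> sets borel"
proof -
  have "{p. a \<le> fst p \<and> fst p \<le> b \<and> f (fst p) \<le> (fst p + snd p) / 2 \<and> (fst p + snd p) / 2 \<le> f b \<and>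
    a - f a \<le> (fst p - snd p) / 2} \<in> sets borel"
    by (intro borel_closed closed_Collect_conj closed_Collect_le)
       (auto intro!: continuous_intros continuous_on_compose2[OF profile_continuous[OF f, of UNIV]])
  also have "{p. a \<le> fst p \<and> fst p \<le> b \<and> f (fst p) \<le> (fst p + snd p) / 2 \<and> (fst p + snd p) / 2 \<le> f b \<and>
    a - f a \<le> (fst p - snd p) / 2} = dom"
    by (auto simp: dom_def)
  finally show ?thesis .
qed

lemma dom_feet:
  assumes p: "p \<in> dom"
  shows "a \<le> lfoot_at p" "lfoot_at p \<le> fst p" "fst p \<le> rfoot_at p" "rfoot_at p \<le> b"
    and "lfoot_at p - f (lfoot_at p) = (fst p - snd p) / 2"
    and "f (rfoot_at p) = (fst p + snd p) / 2"
proof -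
  obtain x y where xy: "p = (x, y)" by (cases p)
  have x: "a \<le> x" "x \<le> b" "f x \<le> (x + y) / 2" "(x + y) / 2 \<le> f b" "a - f a \<le> (x - y) / 2"
    using p by (auto simp: dom_def xy)
  have "(x - y) / 2 + (x + y) / 2 = x" by (simp add: field_simps)
  then have x': "(x - y) / 2 \<le> x - f x" using x(3) by linarith
  show "a \<le> lfoot_at p" "rfoot_at p \<le> b"
    using lfoot_bounds rfoot_bounds by (auto simp: lfoot_at_def rfoot_at_def)
  show "lfoot_at p \<le> fst p" "fst p \<le> rfoot_at p"
    using lfoot_lower[OF _ x'] rfoot_upper[OF _ x(3)] x by (auto simp: lfoot_at_def rfoot_at_def xy)
  show "lfoot_at p - f (lfoot_at p) = (fst p - snd p) / 2"
    using f_lfoot[of "(x - y) / 2"] x x' profile_mono[OF profile_compl[OF f], OF x(2)]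
    by (simp add: lfoot_at_def xy)
  show "f (rfoot_at p) = (fst p + snd p) / 2"
    using f_rfoot[of "(x + y) / 2"] x profile_mono[OF f, OF x(1)]
    by (simp add: rfoot_at_def xy)
qed

lemma feet_le: "p \<in> dom \<Longrightarrow> lfoot_at p \<le> rfoot_at p"
  using dom_feet[of p] by linarith

lemma feet_leg_point:
  shows "u \<le> fst p \<Longrightarrow> lfoot_at (leg_point p u) = lfoot_at p"
    and "u \<le> fst p \<Longrightarrow> rfoot_at (leg_point p u) = rfoot (u - (fst p - snd p) / 2)"
    and "fst p \<le> u \<Longrightarrow> lfoot_at (leg_point p u) = lfoot (u - (fst p + snd p) / 2)"
    and "fst p \<le> u \<Longrightarrow> rfoot_at (leg_point p u) = rfoot_at p"
  by (auto simp: lfoot_at_def rfoot_at_def leg_point_def abs_if field_simps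
      intro!: arg_cong[of _ _ lfoot] arg_cong[of _ _ rfoot])

text \<open>Moving out along a leg fixes one characteristic coordinate and brings the other closer
  to the graph. Apart from the ends of [a, b], only the inequality against the graph can fail, and
  it fails exactly beyond the foot.\<close>

lemma leg_point_in_dom_iff:
  assumes p: "p \<in> dom"
  shows "leg_point p u \<in> dom \<longleftrightarrow> lfoot_at p \<le> u \<and> u \<le> rfoot_at p"
proof -
  obtain x y where xy: "p = (x, y)" by (cases p)
  note feet = dom_feet[OF p, unfolded xy fst_conv snd_conv]
  have x: "a \<le> x" "x \<le> b" "f x \<le> (x + y) / 2" "(x + y) / 2 \<le> f b" "a - f a \<le> (x - y) / 2"
    using p by (auto simp: dom_def xy)
  let ?\<alpha> = "lfoot_at (x, y)" and ?\<beta> = "rfoot_at (x, y)"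
  show ?thesis
  proof (cases "u \<le> x")
    case True
    have *: "(u + (y - \<bar>u - x\<bar>)) / 2 = u - (x - y) / 2" "(u - (y - \<bar>u - x\<bar>)) / 2 = (x - y) / 2"
      using True by (simp_all add: abs_if field_simps)
    have "u - (x - y) / 2 \<le> f b" using True x by (simp add: field_simps)
    then have "leg_point p u \<in> dom \<longleftrightarrow> a \<le> u \<and> (x - y) / 2 \<le> u - f u"
      using True x unfolding dom_def leg_point_def xy by (auto simp: *)
    also have "\<dots> \<longleftrightarrow> ?\<alpha> \<le> u"
      using lfoot_lower[of u "(x - y) / 2"] profile_mono[OF profile_compl[OF f], of ?\<alpha> u] True x feet
      by (auto simp: lfoot_at_def)
    finally show ?thesis using True feet xy by auto
  next
    case False
    have *: "(u + (y - \<bar>u - x\<bar>)) / 2 = (x + y) / 2" "(u - (y - \<bar>u - x\<bar>)) / 2 = u - (x + y) / 2"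
      using False by (simp_all add: abs_if field_simps)
    have "a - f a \<le> u - (x + y) / 2" using False x by (simp add: field_simps)
    then have "leg_point p u \<in> dom \<longleftrightarrow> u \<le> b \<and> f u \<le> (x + y) / 2"
      using False x unfolding dom_def leg_point_def xy by (auto simp: *)
    also have "\<dots> \<longleftrightarrow> u \<le> ?\<beta>"
      using rfoot_upper[of u "(x + y) / 2"] profile_mono[OF f, of u ?\<beta>] False x feet
      by (auto simp: rfoot_at_def)
    finally show ?thesis using False feet xy by auto
  qed
qed

lemma hook_point_in_dom:
  assumes p: "p \<in> dom" and \<theta>: "\<theta> \<in> {0..1}"
  shows "hook_point p \<theta> \<in> dom"
proof -
  let ?\<alpha> = "lfoot_at p" and ?\<beta> = "rfoot_at p"
  have "0 \<le> \<theta> * (?\<beta> - ?\<alpha>)" "\<theta> * (?\<beta> - ?\<alpha>) \<le> 1 * (?\<beta> - ?\<alpha>)"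
    using feet_le[OF p] \<theta> by (auto intro: mult_left_le_one_le mult_nonneg_nonneg)
  then show ?thesis unfolding hook_point_def leg_point_in_dom_iff[OF p] by auto
qed

text \<open>Provides the right inverse demanded by \<open>harmonic_kernel_integral_right\<close>,
  localized between the feet of one hook.\<close>

lemma rfoot_between:
  assumes p: "p \<in> dom" and v: "v \<in> {f (lfoot_at p)..f (rfoot_at p)}"
  shows "rfoot v \<in> {lfoot_at p..rfoot_at p} \<and> f (rfoot v) = v"
proof (intro conjI f_rfoot)
  note feet = dom_feet[OF p]
  have "rfoot v \<le> rfoot (f (rfoot_at p))"
    using v by (intro monoD[OF mono_rfoot]) auto
  also have "\<dots> = rfoot_at p" unfolding feet(6) by (simp add: rfoot_at_def)
  finally show "rfoot v \<in> {lfoot_at p..rfoot_at p}"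
    using rfoot_upper[of "lfoot_at p" v] v feet by auto
  show "v \<in> {f a..f b}"
    using v profile_mono[OF f feet(1)] profile_mono[OF f feet(4)] by auto
qed

lemma lfoot_between:
  assumes p: "p \<in> dom" and t: "t \<in> {lfoot_at p - f (lfoot_at p)..rfoot_at p - f (rfoot_at p)}"
  shows "lfoot t \<in> {lfoot_at p..rfoot_at p} \<and> lfoot t - f (lfoot t) = t"
proof (intro conjI f_lfoot)
  note feet = dom_feet[OF p]
  have "lfoot_at p = lfoot (lfoot_at p - f (lfoot_at p))" unfolding feet(5) by (simp add: lfoot_at_def)
  also have "\<dots> \<le> lfoot t"
    using t by (intro monoD[OF mono_lfoot]) auto
  finally show "lfoot t \<in> {lfoot_at p..rfoot_at p}"
    using lfoot_lower[of "rfoot_at p" t] t feet by auto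
  show "t \<in> {a - f a..b - f b}"
    using t profile_mono[OF profile_compl[OF f] feet(1)] profile_mono[OF profile_compl[OF f] feet(4)] by auto
qed

lemma bounded_set_integrable:
  fixes h :: "real \<Rightarrow> 'b :: {banach, second_countable_topology}"
  assumes [measurable]: "h \<in> borel_measurable borel" and "\<And>u. norm (h u) \<le> C"
  shows "set_integrable lborel {c..d} h" "set_integrable lborel {c<..d} h"
proof -
  show *: "set_integrable lborel {c..d} h"
    unfolding set_integrable_def using assms(2)
    by (intro integrableI_bounded_set[where A="{c..d}" and B=C])
       (auto split: split_indicator simp: emeasure_lborel_Icc_eq)
  show "set_integrable lborel {c<..d} h"
    by (rule set_integrable_subset[OF *]) auto
qed

text \<open>On the left leg the left foot is constant and v = u - (x - y) / 2 runs from f \<alpha>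
  to f \<beta>; on the right leg the right foot is constant and t = u - (x + y) / 2 runs from
  \<alpha> - f \<alpha> to \<beta> - f \<beta>. The integrand \<open>k\<close> is general because it
  is applied both to the harmonic kernel and to the length of the hook.\<close>

lemma hook_integral:
  fixes k :: "real \<times> real \<Rightarrow> 'b :: {banach, second_countable_topology}"
  assumes p: "p \<in> dom" and [measurable]: "k \<in> borel_measurable borel" and C: "\<And>q. norm (k q) \<le> C"
  defines "\<alpha> \<equiv> lfoot_at p" and "\<beta> \<equiv> rfoot_at p"
  shows "(\<beta> - \<alpha>) *\<^sub>R (LINT \<theta>:{0..1}|lborel. k (lfoot_at (hook_point p \<theta>), rfoot_at (hook_point p \<theta>))) =
    (LINT v:{f \<alpha>..f \<beta>}|lborel. k (\<alpha>, rfoot v)) +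
    (LINT t:{\<alpha> - f \<alpha>..\<beta> - f \<beta>}|lborel. k (lfoot t, \<beta>))"
proof (cases "\<alpha> = \<beta>")
  case True
  have "(LINT v:{c..c}|lborel. g v) = 0" for c :: real and g :: "real \<Rightarrow> 'b"
    unfolding set_lebesgue_integral_def
    by (rule integral_eq_zero_AE, rule AE_mp[OF AE_lborel_singleton[of c]]) auto
  then show ?thesis using True by simp
next
  case False
  note feet = dom_feet[OF p, folded \<alpha>_def \<beta>_def]
  obtain x y where xy: "p = (x, y)" by (cases p)
  have lt: "\<alpha> < \<beta>" using False feet_le[OF p] by (auto simp: \<alpha>_def \<beta>_def)
  define q where "q u = k (lfoot_at (leg_point p u), rfoot_at (leg_point p u))" for u
  have [measurable]: "k \<in> borel_measurable (borel \<Otimes>\<^sub>M borel)" by (simp add: borel_prod)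
  have [measurable]: "leg_point p \<in> borel \<rightarrow>\<^sub>M borel"
    unfolding leg_point_def borel_prod[symmetric] by measurable
  have [measurable]: "q \<in> borel_measurable borel"
    unfolding q_def by measurable
  have qC: "norm (q u) \<le> C" for u using C by (simp add: q_def)
  have "(LINT u:{\<alpha>..\<beta>}|lborel. q u) =
    (\<beta> - \<alpha>) *\<^sub>R (LINT \<theta>|lborel. indicator {\<alpha>..\<beta>} (\<alpha> + (\<beta> - \<alpha>) * \<theta>) *\<^sub>R q (\<alpha> + (\<beta> - \<alpha>) * \<theta>))"
    unfolding set_lebesgue_integral_def
    using lt by (subst lborel_integral_real_affine[where c="\<beta> - \<alpha>" and t=\<alpha>]) auto
  also have "(\<lambda>\<theta>. indicator {\<alpha>..\<beta>} (\<alpha> + (\<beta> - \<alpha>) * \<theta>) :: real) = indicator {0..1}"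
  proof
    fix \<theta>
    have "\<alpha> \<le> \<alpha> + (\<beta> - \<alpha>) * \<theta> \<longleftrightarrow> 0 \<le> \<theta>" using lt by (simp add: zero_le_mult_iff)
    moreover have "\<alpha> + (\<beta> - \<alpha>) * \<theta> \<le> \<beta> \<longleftrightarrow> \<theta> \<le> 1" 
      using mult_le_cancel_left_pos[of "\<beta> - \<alpha>" \<theta> 1] lt
      by (metis add.commute diff_gt_0_iff_gt le_diff_eq mult.right_neutral)
    ultimately show "indicator {\<alpha>..\<beta>} (\<alpha> + (\<beta> - \<alpha>) * \<theta>) = (indicator {0..1} \<theta> :: real)"
      by (auto simp: indicator_def)
  qed
  finally have 1: "(LINT u:{\<alpha>..\<beta>}|lborel. q u) =
    (\<beta> - \<alpha>) *\<^sub>R (LINT \<theta>:{0..1}|lborel. k (lfoot_at (hook_point p \<theta>), rfoot_at (hook_point p \<theta>)))"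
    by (simp add: set_lebesgue_integral_def q_def hook_point_def \<alpha>_def \<beta>_def mult.commute)
  have "{\<alpha>..\<beta>} = {\<alpha>..x} \<union> {x<..\<beta>}" using feet xy by auto
  then have 2: "(LINT u:{\<alpha>..\<beta>}|lborel. q u) = (LINT u:{\<alpha>..x}|lborel. q u) + (LINT u:{x<..\<beta>}|lborel. q u)"
    using bounded_set_integrable[OF \<open>q \<in> _\<close> qC] by (simp only:) (intro set_integral_Un, auto)
  have "(LINT u:{\<alpha>..x}|lborel. q u) = (LINT u:{\<alpha>..x}|lborel. k (\<alpha>, rfoot (u - (x - y) / 2)))"
    by (intro set_lebesgue_integral_cong) (auto simp: q_def feet_leg_point xy \<alpha>_def)
  also have "\<dots> = (LINT v|lborel. indicator {\<alpha>..x} ((x - y) / 2 + v) *\<^sub>R k (\<alpha>, rfoot v))"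
    unfolding set_lebesgue_integral_def
    by (subst lborel_integral_real_affine[where c=1 and t="(x - y) / 2"]) auto
  also have "(\<lambda>v. indicator {\<alpha>..x} ((x - y) / 2 + v) :: real) = indicator {f \<alpha>..f \<beta>}"
    using feet(5,6) by (auto simp: xy indicator_def field_simps fun_eq_iff)
  finally have 3: "(LINT u:{\<alpha>..x}|lborel. q u) = (LINT v:{f \<alpha>..f \<beta>}|lborel. k (\<alpha>, rfoot v))"
    by (simp add: set_lebesgue_integral_def)
  have "(LINT u:{x<..\<beta>}|lborel. q u) = (LINT u:{x<..\<beta>}|lborel. k (lfoot (u - (x + y) / 2), \<beta>))"
    by (intro set_lebesgue_integral_cong) (auto simp: q_def feet_leg_point xy \<beta>_def)
  also have "\<dots> = (LINT u:{x..\<beta>}|lborel. k (lfoot (u - (x + y) / 2), \<beta>))"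
    unfolding set_lebesgue_integral_def
    by (rule integral_cong_AE) (use AE_lborel_singleton[of x] in \<open>auto split: split_indicator\<close>)
  also have "\<dots> = (LINT v|lborel. indicator {x..\<beta>} ((x + y) / 2 + v) *\<^sub>R k (lfoot v, \<beta>))"
    unfolding set_lebesgue_integral_def
    by (subst lborel_integral_real_affine[where c=1 and t="(x + y) / 2"]) auto
  also have "(\<lambda>v. indicator {x..\<beta>} ((x + y) / 2 + v) :: real) = indicator {\<alpha> - f \<alpha>..\<beta> - f \<beta>}"
    using feet(5,6) by (auto simp: xy indicator_def field_simps fun_eq_iff)
  finally have 4: "(LINT u:{x<..\<beta>}|lborel. q u) = (LINT t:{\<alpha> - f \<alpha>..\<beta> - f \<beta>}|lborel. k (lfoot t, \<beta>))"
    by (simp add: set_lebesgue_integral_def)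
  show ?thesis using 1 2 3 4 by simp
qed

end

section \<open>Averages over a hook of functions of its feet\<close>

context profile_on
begin

definition feet :: "real \<times> real \<Rightarrow> real \<times> real" where
  "feet p = (lfoot_at p, rfoot_at p)"

text \<open>The harmonic kernel cut off outside the triangle of possible feet, which makes it
  bounded and Borel on the whole plane.\<close>

definition kern :: "complex \<Rightarrow> real \<times> real \<Rightarrow> complex" where
  "kern w q = (if a \<le> fst q \<and> fst q \<le> snd q \<and> snd q \<le> b then harmonic_kernel f w (fst q) (snd q) else 0)"

lemma measurable_feet_pair [measurable]: "feet \<in> borel \<rightarrow>\<^sub>M borel"
  unfolding feet_def borel_prod[symmetric] by (simp add: borel_prod)

text \<open>The Cauchy integral between the feet is a difference of values of one function
  \<open>\<Phi>\<close>, so joint measurability reduces to that of a function of one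
  variable.\<close>

lemma kern_measurable:
  assumes w: "Im w > 0" shows "kern w \<in> borel_measurable borel"
proof -
  define \<Phi> where "\<Phi> s = indicator {a..b} s *\<^sub>R cauchy_int f w a s" for s
  have [measurable]: "\<Phi> \<in> borel_measurable borel"
    unfolding \<Phi>_def
    by (intro borel_measurable_continuous_on_indicator continuous_on_cauchy_int f w) auto
  have "kern w = (\<lambda>q. if a \<le> fst q \<and> fst q \<le> snd q \<and> snd q \<le> b
    then exp (\<Phi> (fst q) - \<Phi> (snd q)) / (w - of_real (snd q)) else 0)"
  proof
    fix q
    show "kern w q = (if a \<le> fst q \<and> fst q \<le> snd q \<and> snd q \<le> b
      then exp (\<Phi> (fst q) - \<Phi> (snd q)) / (w - of_real (snd q)) else 0)"
      using cauchy_int_combine[OF f w, of a "fst q" "snd q"]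
      by (simp add: kern_def harmonic_kernel_def \<Phi>_def)
  qed
  also have "\<dots> \<in> borel_measurable borel" unfolding borel_prod[symmetric] by measurable
  finally show ?thesis .
qed

lemma norm_kern_le:
  assumes w: "Im w > 0" shows "norm (kern w q) \<le> exp ((b - a) / Im w) / Im w"
  using norm_harmonic_kernel_le[OF f w, of "fst q" "snd q" "b - a"] w by (auto simp: kern_def)

lemma kern_feet:
  "p \<in> dom \<Longrightarrow> kern w (feet p) = harmonic_kernel f w (lfoot_at p) (rfoot_at p)"
  using dom_feet[of p] by (auto simp: kern_def feet_def)

lemma hook_point_trivial:
  assumes "p \<in> dom" "lfoot_at p = rfoot_at p" shows "hook_point p \<theta> = p"
  using dom_feet[OF assms(1)] assms(2) by (cases p) (auto simp: hook_point_def leg_point_def)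

lemma kern_mean:
  assumes p: "p \<in> dom" and w: "Im w > 0"
  shows "(LINT \<theta>:{0..1}|lborel. kern w (feet (hook_point p \<theta>))) = kern w (feet p)"
proof (cases "lfoot_at p = rfoot_at p")
  case True
  then show ?thesis using hook_point_trivial[OF p] by (simp add: set_lebesgue_integral_def)
next
  case False
  let ?\<alpha> = "lfoot_at p" and ?\<beta> = "rfoot_at p"
  note ft = dom_feet[OF p]
  have le: "?\<alpha> \<le> ?\<beta>" using feet_le[OF p] .
  have "(?\<beta> - ?\<alpha>) *\<^sub>R (LINT \<theta>:{0..1}|lborel. kern w (feet (hook_point p \<theta>))) =
    (LINT v:{f ?\<alpha>..f ?\<beta>}|lborel. kern w (?\<alpha>, rfoot v)) +
    (LINT t:{?\<alpha> - f ?\<alpha>..?\<beta> - f ?\<beta>}|lborel. kern w (lfoot t, ?\<beta>))"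
    unfolding feet_def by (rule hook_integral[OF p kern_measurable[OF w] norm_kern_le[OF w]])
  also have "(LINT v:{f ?\<alpha>..f ?\<beta>}|lborel. kern w (?\<alpha>, rfoot v)) =
     (LINT v:{f ?\<alpha>..f ?\<beta>}|lborel. harmonic_kernel f w ?\<alpha> (rfoot v))"
  proof (intro set_lebesgue_integral_cong allI impI)
    fix v assume "v \<in> {f ?\<alpha>..f ?\<beta>}"
    from rfoot_between[OF p this] show "kern w (?\<alpha>, rfoot v) = harmonic_kernel f w ?\<alpha> (rfoot v)"
      using ft by (auto simp: kern_def)
  qed simp
  also have "\<dots> = 1 - (w - of_real ?\<beta>) * harmonic_kernel f w ?\<alpha> ?\<beta>"
    by (rule harmonic_kernel_integral_right[OF f w le rfoot_between[OF p]])
  also have "(LINT t:{?\<alpha> - f ?\<alpha>..?\<beta> - f ?\<beta>}|lborel. kern w (lfoot t, ?\<beta>)) =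
    (LINT t:{?\<alpha> - f ?\<alpha>..?\<beta> - f ?\<beta>}|lborel. harmonic_kernel f w (lfoot t) ?\<beta>)"
  proof (intro set_lebesgue_integral_cong allI impI)
    fix t assume "t \<in> {?\<alpha> - f ?\<alpha>..?\<beta> - f ?\<beta>}"
    from lfoot_between[OF p this] show "kern w (lfoot t, ?\<beta>) = harmonic_kernel f w (lfoot t) ?\<beta>"
      using ft by (auto simp: kern_def)
  qed simp
  also have "\<dots> = (w - of_real ?\<alpha>) * harmonic_kernel f w ?\<alpha> ?\<beta> - 1"
    by (rule harmonic_kernel_integral_left[OF f w le lfoot_between[OF p]])
  finally have "(?\<beta> - ?\<alpha>) *\<^sub>R (LINT \<theta>:{0..1}|lborel. kern w (feet (hook_point p \<theta>))) =
    (?\<beta> - ?\<alpha>) *\<^sub>R harmonic_kernel f w ?\<alpha> ?\<beta>"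
    by (simp add: scaleR_conv_of_real algebra_simps)
  then show ?thesis using False by (simp add: kern_feet[OF p])
qed

lemma lborel_affine_integral:
  fixes c d A B :: real assumes "c \<le> d"
  shows "(LINT v:{c..d}|lborel. A + B * (v - c)) = A * (d - c) + B * (d - c)\<^sup>2 / 2"
proof -
  have "((\<lambda>v. A * (v - c) + B * (v - c)\<^sup>2 / 2) has_vector_derivative A + B * (v - c)) (at v within {c..d})" for v
    unfolding has_real_derivative_iff_has_vector_derivative[symmetric]
    by (auto intro!: derivative_eq_intros)
  from integral_FTC_Icc[OF \<open>c \<le> d\<close> this] show ?thesis
    by (simp add: set_lebesgue_integral_def continuous_intros)
qed

text \<open>Let p' and q' be the increments of \<open>f\<close> and of \<open>x - f x\<close>
  between the feet, so that the hook has length L = p' + q'. Slope at most 1 bounds the new length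
  on the two legs by affine functions, whose integrals add up to L^2 / 2 + p' q', and p' q' \<le>
  L^2 / 4. Division by L leaves the factor 3/4.\<close>

lemma foot_length_mean:
  assumes p: "p \<in> dom"
  shows "(LINT \<theta>:{0..1}|lborel. rfoot_at (hook_point p \<theta>) - lfoot_at (hook_point p \<theta>)) \<le>
    3/4 * (rfoot_at p - lfoot_at p)"
proof (cases "lfoot_at p = rfoot_at p")
  case True
  then show ?thesis using hook_point_trivial[OF p] by (simp add: set_lebesgue_integral_def)
next
  case False
  define \<alpha> \<beta> where ab': "\<alpha> = lfoot_at p" "\<beta> = rfoot_at p"
  note ft = dom_feet[OF p, folded ab']
  have lt: "\<alpha> < \<beta>" using feet_le[OF p] False by (auto simp: ab')
  \<comment> \<open>\<open>hook_integral\<close> wants a globally bounded function, so the length is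
    truncated to [0, b - a], where it lies for actual feet.\<close>
  define len :: "real \<times> real \<Rightarrow> real" where "len q = max 0 (min (b - a) (snd q - fst q))" for q
  have [measurable]: "len \<in> borel_measurable borel"
    unfolding len_def borel_prod[symmetric] by measurable
  have len: "norm (len q) \<le> b - a" for q using ab by (auto simp: len_def)
  have len_eq: "len (s, t) = t - s" if "a \<le> s" "s \<le> t" "t \<le> b" for s t
    using that by (auto simp: len_def)
  define p' q' where pq: "p' = f \<beta> - f \<alpha>" "q' = (\<beta> - f \<beta>) - (\<alpha> - f \<alpha>)"
  have pq0: "f \<alpha> \<le> f \<beta>" "\<alpha> - f \<alpha> \<le> \<beta> - f \<beta>"
    using profile_mono[OF f] profile_mono[OF profile_compl[OF f]] lt by auto
  have "(LINT \<theta>:{0..1}|lborel. rfoot_at (hook_point p \<theta>) - lfoot_at (hook_point p \<theta>)) =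
    (LINT \<theta>:{0..1}|lborel. len (lfoot_at (hook_point p \<theta>), rfoot_at (hook_point p \<theta>)))"
    using len_eq dom_feet[OF hook_point_in_dom[OF p]] feet_le[OF hook_point_in_dom[OF p]]
    by (intro set_lebesgue_integral_cong) auto
  then have "(\<beta> - \<alpha>) * (LINT \<theta>:{0..1}|lborel. rfoot_at (hook_point p \<theta>) - lfoot_at (hook_point p \<theta>)) =
    (LINT v:{f \<alpha>..f \<beta>}|lborel. len (\<alpha>, rfoot v)) +
    (LINT t:{\<alpha> - f \<alpha>..\<beta> - f \<beta>}|lborel. len (lfoot t, \<beta>))"
    using hook_integral[OF p \<open>len \<in> _\<close> len, folded ab'] by simp
  also have "(LINT v:{f \<alpha>..f \<beta>}|lborel. len (\<alpha>, rfoot v)) \<le>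
    (LINT v:{f \<alpha>..f \<beta>}|lborel. (\<beta> - \<alpha> - p') + 1 * (v - f \<alpha>))"
  proof (rule set_integral_mono)
    show "set_integrable lborel {f \<alpha>..f \<beta>} (\<lambda>v. len (\<alpha>, rfoot v))"
      by (rule bounded_set_integrable(1)[where C="b - a"]) (measurable, rule len)
    show "set_integrable lborel {f \<alpha>..f \<beta>} (\<lambda>v. (\<beta> - \<alpha> - p') + 1 * (v - f \<alpha>))"
      by (intro borel_integrable_atLeastAtMost') (auto intro!: continuous_intros)
    fix v assume v: "v \<in> {f \<alpha>..f \<beta>}"
    note rv = rfoot_between[OF p, folded ab', OF v]
    then have "len (\<alpha>, rfoot v) = rfoot v - \<alpha>" using ft by (intro len_eq) auto
    moreover have "f \<beta> - v \<le> \<beta> - rfoot v" using profile_diff[OF f, of "rfoot v" \<beta>] rv by auto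
    ultimately show "len (\<alpha>, rfoot v) \<le> (\<beta> - \<alpha> - p') + 1 * (v - f \<alpha>)" by (simp add: pq)
  qed
  also have "(LINT t:{\<alpha> - f \<alpha>..\<beta> - f \<beta>}|lborel. len (lfoot t, \<beta>)) \<le>
    (LINT t:{\<alpha> - f \<alpha>..\<beta> - f \<beta>}|lborel. (\<beta> - \<alpha>) + (-1) * (t - (\<alpha> - f \<alpha>)))"
  proof (rule set_integral_mono)
    show "set_integrable lborel {\<alpha> - f \<alpha>..\<beta> - f \<beta>} (\<lambda>t. len (lfoot t, \<beta>))"
      by (rule bounded_set_integrable(1)[where C="b - a"]) (measurable, rule len)
    show "set_integrable lborel {\<alpha> - f \<alpha>..\<beta> - f \<beta>} (\<lambda>t. (\<beta> - \<alpha>) + (-1) * (t - (\<alpha> - f \<alpha>)))"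
      by (intro borel_integrable_atLeastAtMost') (auto intro!: continuous_intros)
    fix t assume t: "t \<in> {\<alpha> - f \<alpha>..\<beta> - f \<beta>}"
    note lt = lfoot_between[OF p, folded ab', OF t]
    then have "len (lfoot t, \<beta>) = \<beta> - lfoot t" using ft by (intro len_eq) auto
    moreover have "t - (\<alpha> - f \<alpha>) \<le> lfoot t - \<alpha>" 
      using profile_diff[OF profile_compl[OF f], of \<alpha> "lfoot t"] lt by auto
    ultimately show "len (lfoot t, \<beta>) \<le> (\<beta> - \<alpha>) + (-1) * (t - (\<alpha> - f \<alpha>))" by simp
  qed
  finally have "(\<beta> - \<alpha>) * (LINT \<theta>:{0..1}|lborel. rfoot_at (hook_point p \<theta>) - lfoot_at (hook_point p \<theta>)) \<le>
    ((\<beta> - \<alpha> - p') * p' + p'\<^sup>2 / 2) + ((\<beta> - \<alpha>) * q' - q'\<^sup>2 / 2)"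
    using lborel_affine_integral[OF pq0(1), of "\<beta> - \<alpha> - p'" 1]
      lborel_affine_integral[OF pq0(2), of "\<beta> - \<alpha>" "-1"] by (simp add: pq)
  also have "\<dots> \<le> (\<beta> - \<alpha>) * (3/4 * (\<beta> - \<alpha>))"
  proof -
    have L: "\<beta> - \<alpha> = p' + q'" by (simp add: pq)
    have "0 \<le> (p' - q')\<^sup>2" by simp
    then show ?thesis unfolding L by (simp add: power2_eq_square field_simps)
  qed
  finally show ?thesis unfolding ab'[symmetric] using lt by simp
qed

lemma hook_point_measurable [measurable]:
  "(\<lambda>(p, \<theta>). hook_point p \<theta>) \<in> borel \<Otimes>\<^sub>M borel \<rightarrow>\<^sub>M borel"
  "hook_point p \<in> borel \<rightarrow>\<^sub>M borel"
proof -
  have [measurable]: "lfoot_at \<in> borel \<Otimes>\<^sub>M borel \<rightarrow>\<^sub>M borel" "rfoot_at \<in> borel \<Otimes>\<^sub>M borel \<rightarrow>\<^sub>M borel"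
    by (simp_all add: borel_prod)
  show "(\<lambda>(p, \<theta>). hook_point p \<theta>) \<in> borel \<Otimes>\<^sub>M borel \<rightarrow>\<^sub>M borel"
    unfolding hook_point_def leg_point_def borel_prod[symmetric] by measurable
  show "hook_point p \<in> borel \<rightarrow>\<^sub>M borel"
    unfolding hook_point_def leg_point_def borel_prod[symmetric] by measurable
qed

end

section \<open>One step of the walk as the image of a uniform variable\<close>

definition unit_uniform :: "real measure" where
  "unit_uniform = density lborel (\<lambda>x. ennreal (indicator {0..1} x))"

lemma sets_unit_uniform [simp, measurable_cong]: "sets unit_uniform = sets borel"
  by (simp add: unit_uniform_def)

lemma space_unit_uniform [simp]: "space unit_uniform = UNIV"
  by (simp add: unit_uniform_def)

lemma integral_unit_uniform:
  fixes h :: "real \<Rightarrow> 'b :: {banach, second_countable_topology}"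
  shows "h \<in> borel_measurable borel \<Longrightarrow> (LINT \<theta>|unit_uniform. h \<theta>) = (LINT \<theta>:{0..1}|lborel. h \<theta>)"
  unfolding unit_uniform_def set_lebesgue_integral_def by (subst integral_density) auto

lemma emeasure_unit_uniform:
  "A \<in> sets borel \<Longrightarrow> emeasure unit_uniform A = emeasure lborel ({0..1} \<inter> A)"
  unfolding unit_uniform_def by (simp add: ennreal_indicator emeasure_restricted)

lemma prob_space_unit_uniform: "prob_space unit_uniform"
  by (rule prob_spaceI) (simp add: emeasure_unit_uniform)

lemma AE_unit_uniform: "AE \<theta> in unit_uniform. \<theta> \<in> {0..1}"
  unfolding unit_uniform_def by (subst AE_density) (auto simp: indicator_def)

text \<open>The arc parameter is an affine function of \<theta>, with factor sqrt 2 * (\<beta> -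
  \<alpha>). The curve \<open>q\<close> is left general so that the same computation serves the
  exterior hook and the reflected interior one.\<close>

lemma arc_uniform_eq_distr:
  assumes \<gamma>: "\<And>t. \<gamma> t = q (x + t / sqrt 2)" and H: "\<And>u. q u \<in> H \<longleftrightarrow> \<alpha> \<le> u \<and> u \<le> \<beta>"
    and x: "\<alpha> \<le> x" "x \<le> \<beta>" and q [measurable]: "q \<in> borel \<rightarrow>\<^sub>M borel"
  shows "arc_uniform \<gamma> H = distr unit_uniform borel (\<lambda>\<theta>. q (\<alpha> + \<theta> * (\<beta> - \<alpha>)))"
proof -
  let ?p = "sqrt 2 * (\<alpha> - x)" and ?q = "sqrt 2 * (\<beta> - x)"
  have "\<alpha> \<le> x + t / sqrt 2 \<longleftrightarrow> ?p \<le> t" "x + t / sqrt 2 \<le> \<beta> \<longleftrightarrow> t \<le> ?q" for t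
    by (simp_all add: field_simps)
  then have vim: "\<gamma> -` H = {?p..?q}" by (intro set_eqI) (simp add: \<gamma> H)
  have pq: "?q - ?p = sqrt 2 * (\<beta> - \<alpha>)" by (simp add: algebra_simps)
  show ?thesis
  proof (cases "\<alpha> = \<beta>")
    case True
    interpret U: prob_space unit_uniform by (rule prob_space_unit_uniform)
    \<comment> \<open>For a hook of one point the parameter set is null, and the
      \<open>return\<close> in \<open>arc_uniform\<close> agrees with the image of a constant
      map.\<close>
    have "x = \<alpha>" using True x by simp
    then show ?thesis using True by (simp add: arc_uniform_def vim \<gamma> U.distr_const)
  next
    case False
    then have lt: "\<alpha> < \<beta>" using x by auto
    have le: "?p \<le> ?q" using lt by simp
    have [measurable]: "\<gamma> \<in> borel \<rightarrow>\<^sub>M borel" unfolding \<gamma>[abs_def] by measurable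
    define c where "c = sqrt 2 * (\<beta> - \<alpha>)"
    have c0: "0 < c" using lt by (simp add: c_def)
    have em: "emeasure lborel {?p..?q} = ennreal c" using le by (simp add: pq c_def)
    have "distr (uniform_measure lborel {?p..?q}) borel \<gamma> = 
      distr unit_uniform borel (\<lambda>\<theta>. q (\<alpha> + \<theta> * (\<beta> - \<alpha>)))"
    proof (rule measure_eqI)
      fix B assume "B \<in> sets (distr (uniform_measure lborel {?p..?q}) borel \<gamma>)"
      then have B[measurable]: "B \<in> sets borel" by simp
      have "emeasure lborel ({?p..?q} \<inter> \<gamma> -` B) = (\<integral>\<^sup>+t. indicator ({?p..?q} \<inter> \<gamma> -` B) t \<partial>lborel)"
        using measurable_sets_borel[OF \<open>\<gamma> \<in> _\<close> B] by simp
      also have "\<dots> = (\<integral>\<^sup>+t. indicator {?p..?q} t * indicator B (\<gamma> t) \<partial>lborel)"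
        by (intro nn_integral_cong) (auto simp: indicator_def)
      also have "\<dots> = ennreal c * (\<integral>\<^sup>+\<theta>. indicator {?p..?q} (?p + c * \<theta>) * indicator B (\<gamma> (?p + c * \<theta>)) \<partial>lborel)"
        using c0 by (subst nn_integral_real_affine[where c=c and t="?p"]) auto
      also have "(\<lambda>\<theta>. indicator {?p..?q} (?p + c * \<theta>) * indicator B (\<gamma> (?p + c * \<theta>)) :: ennreal) =
        indicator ({0..1} \<inter> (\<lambda>\<theta>. q (\<alpha> + \<theta> * (\<beta> - \<alpha>))) -` B)"
      proof
        fix \<theta>
        have "?p \<le> ?p + c * \<theta> \<longleftrightarrow> 0 \<le> \<theta>" using c0 by (simp add: zero_le_mult_iff)
        moreover have "?p + c * \<theta> \<le> ?q \<longleftrightarrow> c * \<theta> \<le> c * 1" using pq unfolding c_def by linarith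
        moreover have "\<dots> \<longleftrightarrow> \<theta> \<le> 1" using c0 by simp
        moreover have "\<gamma> (?p + c * \<theta>) = q (\<alpha> + \<theta> * (\<beta> - \<alpha>))" 
          unfolding \<gamma> c_def by (rule arg_cong[of _ _ q]) (simp add: field_simps)
        ultimately show "indicator {?p..?q} (?p + c * \<theta>) * indicator B (\<gamma> (?p + c * \<theta>)) =
          (indicator ({0..1} \<inter> (\<lambda>\<theta>. q (\<alpha> + \<theta> * (\<beta> - \<alpha>))) -` B) \<theta> :: ennreal)"
          by (auto simp: indicator_def)
      qed
      also have "(\<integral>\<^sup>+\<theta>. indicator ({0..1} \<inter> (\<lambda>\<theta>. q (\<alpha> + \<theta> * (\<beta> - \<alpha>))) -` B) \<theta> \<partial>lborel) =
        emeasure lborel ({0..1} \<inter> (\<lambda>\<theta>. q (\<alpha> + \<theta> * (\<beta> - \<alpha>))) -` B)"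
        by (rule nn_integral_indicator) (use measurable_sets_borel[of "\<lambda>\<theta>. q (\<alpha> + \<theta> * (\<beta> - \<alpha>))" borel B] in simp)
      finally have "emeasure lborel ({?p..?q} \<inter> \<gamma> -` B) / ennreal c = 
        emeasure lborel ({0..1} \<inter> (\<lambda>\<theta>. q (\<alpha> + \<theta> * (\<beta> - \<alpha>))) -` B)"
        using c0 by (simp add: ennreal_mult_divide_eq mult.commute[of "ennreal c"])
      then show "emeasure (distr (uniform_measure lborel {?p..?q}) borel \<gamma>) B =
        emeasure (distr unit_uniform borel (\<lambda>\<theta>. q (\<alpha> + \<theta> * (\<beta> - \<alpha>)))) B"
        using measurable_sets_borel[of "\<lambda>\<theta>. q (\<alpha> + \<theta> * (\<beta> - \<alpha>))" borel B] 
          measurable_sets_borel[OF \<open>\<gamma> \<in> _\<close> B]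
        by (simp add: emeasure_distr emeasure_unit_uniform em)
    qed simp
    then show ?thesis
      using c0 em by (simp add: arc_uniform_def vim)
  qed
qed

section \<open>Convergence of the hook walk\<close>

text \<open>Common ground of both walks. Only the laws of consecutive pairs are prescribed, and the
  kernel only on \<open>dom\<close>, where the walk stays almost surely.\<close>

locale hook_walk = profile_on a b f + prob_space M
  for a b :: real and f :: "real \<Rightarrow> real" and M :: "'s measure" +
  fixes X :: "nat \<Rightarrow> 's \<Rightarrow> real \<times> real" and K :: "real \<times> real \<Rightarrow> (real \<times> real) measure"
  assumes X_measurable [measurable]: "\<And>n. X n \<in> borel_measurable M"
    and start: "AE s in M. X 0 s \<in> dom"
    and two_step: "\<And>n A B. A \<in> sets borel \<Longrightarrow> B \<in> sets borel \<Longrightarrow>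
      emeasure M {s \<in> space M. X n s \<in> A \<and> X (Suc n) s \<in> B} =
      (\<integral>\<^sup>+ s. indicator A (X n s) * emeasure (K (X n s)) B \<partial>M)"
    and kernel: "\<And>p. p \<in> dom \<Longrightarrow> K p = distr unit_uniform borel (hook_point p)"
begin

lemma emeasure_kernel:
  assumes "p \<in> dom" "B \<in> sets borel"
  shows "emeasure (K p) B = (\<integral>\<^sup>+\<theta>. indicator B (hook_point p \<theta>) \<partial>unit_uniform)"
proof -
  have "hook_point p \<in> unit_uniform \<rightarrow>\<^sub>M borel"
    using hook_point_measurable(2) by (simp cong: measurable_cong_sets)
  then have "(\<integral>\<^sup>+\<theta>. indicator B (hook_point p \<theta>) \<partial>unit_uniform) =
    (\<integral>\<^sup>+q. indicator B q \<partial>distr unit_uniform borel (hook_point p))"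
    using assms(2) by (subst nn_integral_distr) auto
  then show ?thesis using assms by (simp add: kernel)
qed

lemma step_AE:
  assumes D: "AE s in M. X n s \<in> dom" and A: "A \<in> sets borel" and B: "B \<in> sets borel"
    and AB: "\<And>p \<theta>. p \<in> dom \<Longrightarrow> p \<in> A \<Longrightarrow> \<theta> \<in> {0..1} \<Longrightarrow> hook_point p \<theta> \<notin> B"
  shows "AE s in M. \<not> (X n s \<in> A \<and> X (Suc n) s \<in> B)"
proof -
  have "AE s in M. indicator A (X n s) * emeasure (K (X n s)) B = 0"
    using D
  proof eventually_elim
    case (elim s)
    show ?case
    proof (cases "X n s \<in> A")
      case True
      have "(\<integral>\<^sup>+\<theta>. indicator B (hook_point (X n s) \<theta>) \<partial>unit_uniform) = (\<integral>\<^sup>+\<theta>. 0 \<partial>unit_uniform)"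
        using AE_unit_uniform
        by (intro nn_integral_cong_AE, eventually_elim) (use AB[OF elim True] in auto)
      then show ?thesis using emeasure_kernel[OF elim B] by simp
    qed simp
  qed
  then have "(\<integral>\<^sup>+ s. indicator A (X n s) * emeasure (K (X n s)) B \<partial>M) = (\<integral>\<^sup>+ s. 0 \<partial>M)"
    by (rule nn_integral_cong_AE)
  then have "emeasure M {s \<in> space M. X n s \<in> A \<and> X (Suc n) s \<in> B} = 0"
    using two_step[OF A B, of n] by simp
  moreover have "{s \<in> space M. X n s \<in> A \<and> X (Suc n) s \<in> B} =
    (X n -` A \<inter> space M) \<inter> (X (Suc n) -` B \<inter> space M)" by auto
  then have "{s \<in> space M. X n s \<in> A \<and> X (Suc n) s \<in> B} \<in> sets M"
    using measurable_sets[OF X_measurable A] measurable_sets[OF X_measurable B] by auto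
  ultimately show ?thesis
    by (intro AE_I'[of "{s \<in> space M. X n s \<in> A \<and> X (Suc n) s \<in> B}"]) auto
qed

lemma X_in_dom: "AE s in M. X n s \<in> dom"
proof (induction n)
  case 0 show ?case by (rule start)
next
  case (Suc n)
  have "AE s in M. \<not> (X n s \<in> UNIV \<and> X (Suc n) s \<in> - dom)"
    using hook_point_in_dom by (intro step_AE Suc) auto
  then show ?case by simp
qed

text \<open>
  \<open>two_step\<close> speaks about rectangles only, hence the detour through countably many rational
  thresholds.
\<close>

lemma step_mono_AE:
  fixes c :: "real \<times> real \<Rightarrow> real"
  assumes [measurable]: "c \<in> borel_measurable borel"
    and c: "\<And>p \<theta>. p \<in> dom \<Longrightarrow> \<theta> \<in> {0..1} \<Longrightarrow> c p \<le> c (hook_point p \<theta>)"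
  shows "AE s in M. \<forall>n. c (X n s) \<le> c (X (Suc n) s)"
proof -
  have "AE s in M. \<forall>q::rat. \<not> (X n s \<in> {p. of_rat q \<le> c p} \<and> X (Suc n) s \<in> {p. c p < of_rat q})" for n
    unfolding AE_all_countable
  proof
    fix q :: rat
    show "AE s in M. \<not> (X n s \<in> {p. of_rat q \<le> c p} \<and> X (Suc n) s \<in> {p. c p < of_rat q})"
      using c by (intro step_AE X_in_dom) (measurable, measurable, fastforce dest: order_trans)
  qed
  then have "AE s in M. \<forall>n. \<forall>q::rat. \<not> (X n s \<in> {p. of_rat q \<le> c p} \<and> X (Suc n) s \<in> {p. c p < of_rat q})"
    unfolding AE_all_countable[of "\<lambda>n s. \<forall>q::rat. \<not> (X n s \<in> {p. of_rat q \<le> c p} \<and> X (Suc n) s \<in> {p. c p < of_rat q})"]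
    by blast
  then show ?thesis
  proof eventually_elim
    case (elim s)
    show ?case
    proof (intro allI leI notI)
      fix n assume "c (X (Suc n) s) < c (X n s)"
      then obtain q where "c (X (Suc n) s) < of_rat q" "of_rat q < c (X n s)"
        using of_rat_dense by blast
      with elim show False by (meson less_imp_le mem_Collect_eq)
    qed
  qed
qed

text \<open>Writing the kernel with a uniform variable turns the Markov property, a statement about
  sets, into one about a product measure, where Fubini is available for vector-valued
  integrands.\<close>

lemma law_step:
  "distr M borel (X (Suc n)) =
    distr (distr M borel (X n) \<Otimes>\<^sub>M unit_uniform) borel (\<lambda>(p, \<theta>). hook_point p \<theta>)"
proof (rule measure_eqI)
  fix B assume "B \<in> sets (distr M borel (X (Suc n)))"
  then have B [measurable]: "B \<in> sets borel" by simp
  interpret U: prob_space unit_uniform by (rule prob_space_unit_uniform)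
  have [measurable]: "(\<lambda>(p, \<theta>). hook_point p \<theta>) \<in> distr M borel (X n) \<Otimes>\<^sub>M unit_uniform \<rightarrow>\<^sub>M borel"
    using hook_point_measurable(1) by (simp cong: measurable_cong_sets sets_pair_measure_cong)
  have "emeasure (distr M borel (X (Suc n))) B = emeasure M {s \<in> space M. X n s \<in> UNIV \<and> X (Suc n) s \<in> B}"
    by (simp add: emeasure_distr vimage_def Int_def conj_commute)
  also have "\<dots> = (\<integral>\<^sup>+ s. emeasure (K (X n s)) B \<partial>M)"
    using two_step[of UNIV B n] by simp
  also have "\<dots> = (\<integral>\<^sup>+ s. (\<integral>\<^sup>+\<theta>. indicator B (hook_point (X n s) \<theta>) \<partial>unit_uniform) \<partial>M)"
    using X_in_dom[of n] by (intro nn_integral_cong_AE, eventually_elim) (rule emeasure_kernel[OF _ B])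
  also have "\<dots> = (\<integral>\<^sup>+ p. (\<integral>\<^sup>+\<theta>. indicator B (hook_point p \<theta>) \<partial>unit_uniform) \<partial>distr M borel (X n))"
    using hook_point_measurable(1)
    by (subst nn_integral_distr) (auto intro!: U.borel_measurable_nn_integral simp: case_prod_beta')
  also have "\<dots> = (\<integral>\<^sup>+ z. indicator B (case z of (p, \<theta>) \<Rightarrow> hook_point p \<theta>) \<partial>(distr M borel (X n) \<Otimes>\<^sub>M unit_uniform))"
    by (subst U.nn_integral_fst[symmetric]) auto
  also have "\<dots> = (\<integral>\<^sup>+ q. indicator B q \<partial>distr (distr M borel (X n) \<Otimes>\<^sub>M unit_uniform) borel (\<lambda>(p, \<theta>). hook_point p \<theta>))"
    by (subst nn_integral_distr) auto
  also have "\<dots> = emeasure (distr (distr M borel (X n) \<Otimes>\<^sub>M unit_uniform) borel (\<lambda>(p, \<theta>). hook_point p \<theta>)) B"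
    by simp
  finally show "emeasure (distr M borel (X (Suc n))) B = \<dots>" .
qed simp

lemma integral_step:
  fixes h :: "real \<times> real \<Rightarrow> 'b :: {banach, second_countable_topology}"
  assumes [measurable]: "h \<in> borel_measurable borel" and C: "\<And>p. norm (h p) \<le> C"
  shows "(LINT s|M. h (X (Suc n) s)) = (LINT s|M. (LINT \<theta>:{0..1}|lborel. h (hook_point (X n s) \<theta>)))"
    and "integrable M (\<lambda>s. LINT \<theta>:{0..1}|lborel. h (hook_point (X n s) \<theta>))"
proof -
  interpret U: prob_space unit_uniform by (rule prob_space_unit_uniform)
  interpret D: prob_space "distr M borel (X n)" by (rule prob_space_distr) simp
  interpret P: pair_prob_space "distr M borel (X n)" unit_uniform ..
  have hp: "(\<lambda>(p, \<theta>). hook_point p \<theta>) \<in> distr M borel (X n) \<Otimes>\<^sub>M unit_uniform \<rightarrow>\<^sub>M borel"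
    using hook_point_measurable(1) by (simp cong: measurable_cong_sets sets_pair_measure_cong)
  have hm: "(\<lambda>z. h (case z of (p, \<theta>) \<Rightarrow> hook_point p \<theta>)) \<in>
      borel_measurable (distr M borel (X n) \<Otimes>\<^sub>M unit_uniform)"
    using hp by (rule measurable_compose) simp
  have int: "integrable (distr M borel (X n) \<Otimes>\<^sub>M unit_uniform) (\<lambda>(p, \<theta>). h (hook_point p \<theta>))"
    using hm by (intro P.integrable_const_bound[where B=C]) (auto simp: C case_prod_beta' split: prod.splits)
  have u: "(LINT \<theta>|unit_uniform. h (hook_point p \<theta>)) = (LINT \<theta>:{0..1}|lborel. h (hook_point p \<theta>))" for p
    by (rule integral_unit_uniform) simp
  have m: "(\<lambda>p. LINT \<theta>|unit_uniform. h (hook_point p \<theta>)) \<in> borel_measurable borel"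
    using P.integrable_fst[OF int, THEN borel_measurable_integrable] by simp
  have "(LINT s|M. h (X (Suc n) s)) = (LINT p|distr M borel (X (Suc n)). h p)"
    by (subst integral_distr) auto
  also have "\<dots> = (LINT z|(distr M borel (X n) \<Otimes>\<^sub>M unit_uniform). h (case z of (p, \<theta>) \<Rightarrow> hook_point p \<theta>))"
    unfolding law_step using hp by (subst integral_distr) auto
  also have "\<dots> = (LINT p|distr M borel (X n). (LINT \<theta>|unit_uniform. h (hook_point p \<theta>)))"
    using P.integral_fst'[OF int[unfolded case_prod_beta']] by (simp add: case_prod_beta')
  also have "\<dots> = (LINT s|M. (LINT \<theta>|unit_uniform. h (hook_point (X n s) \<theta>)))"
    using m by (subst integral_distr) auto
  finally show "(LINT s|M. h (X (Suc n) s)) = (LINT s|M. (LINT \<theta>:{0..1}|lborel. h (hook_point (X n s) \<theta>)))"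
    unfolding u .
  have "integrable (distr M borel (X n)) (\<lambda>p. LINT \<theta>|unit_uniform. h (hook_point p \<theta>))"
    by (rule P.integrable_fst[OF int])
  then show "integrable M (\<lambda>s. LINT \<theta>:{0..1}|lborel. h (hook_point (X n s) \<theta>))"
    unfolding u by (rule integrable_distr[rotated]) simp
qed

text \<open>This is \<open>kern_mean\<close> under the expectation; the mean value property is known
  on \<open>dom\<close>, which the walk does not leave.\<close>

lemma kern_martingale:
  assumes w: "Im w > 0"
  shows "(LINT s|M. kern w (feet (X n s))) = (LINT s|M. kern w (feet (X 0 s)))"
proof (induction n)
  case (Suc n)
  note [measurable] = kern_measurable[OF w]
  have "(LINT s|M. kern w (feet (X (Suc n) s))) =
    (LINT s|M. (LINT \<theta>:{0..1}|lborel. kern w (feet (hook_point (X n s) \<theta>))))"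
    by (rule integral_step(1)[of "\<lambda>p. kern w (feet p)"]) (auto intro: norm_kern_le[OF w])
  also have "\<dots> = (LINT s|M. kern w (feet (X n s)))"
  proof (rule integral_cong_AE)
    show "AE s in M. (LINT \<theta>:{0..1}|lborel. kern w (feet (hook_point (X n s) \<theta>))) = kern w (feet (X n s))"
      using X_in_dom[of n] by eventually_elim (rule kern_mean[OF _ w])
    show "(\<lambda>s. LINT \<theta>:{0..1}|lborel. kern w (feet (hook_point (X n s) \<theta>))) \<in> borel_measurable M"
      using integral_step(2)[of "\<lambda>p. kern w (feet p)" _ n, THEN borel_measurable_integrable] norm_kern_le[OF w]
      by simp
  qed simp
  finally show ?case using Suc by simp
qed simp

lemma rfoot_lfoot_bound: "norm (rfoot_at p - lfoot_at p) \<le> b - a"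
  using rfoot_bounds[of "(fst p + snd p) / 2"] lfoot_bounds[of "(fst p - snd p) / 2"]
  by (auto simp: rfoot_at_def lfoot_at_def abs_le_iff)

lemma foot_length_integrable: "integrable M (\<lambda>s. rfoot_at (X n s) - lfoot_at (X n s))"
  using rfoot_lfoot_bound by (intro integrable_const_bound[where B="b - a"]) auto

lemma foot_length_expectation:
  "(LINT s|M. rfoot_at (X n s) - lfoot_at (X n s)) \<le> (3/4) ^ n * (b - a)"
proof (induction n)
  case 0
  have "(LINT s|M. rfoot_at (X 0 s) - lfoot_at (X 0 s)) \<le> (LINT s|M. b - a)"
    using rfoot_lfoot_bound by (intro integral_mono foot_length_integrable) (auto simp: abs_le_iff)
  then show ?case by (simp add: prob_space)
next
  case (Suc n)
  have "(LINT s|M. rfoot_at (X (Suc n) s) - lfoot_at (X (Suc n) s)) =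
    (LINT s|M. (LINT \<theta>:{0..1}|lborel. rfoot_at (hook_point (X n s) \<theta>) - lfoot_at (hook_point (X n s) \<theta>)))"
    by (rule integral_step(1)[of "\<lambda>p. rfoot_at p - lfoot_at p"]) (auto intro: rfoot_lfoot_bound[unfolded real_norm_def])
  also have "\<dots> \<le> (LINT s|M. 3/4 * (rfoot_at (X n s) - lfoot_at (X n s)))"
  proof (rule integral_mono_AE)
    show "integrable M (\<lambda>s. LINT \<theta>:{0..1}|lborel. rfoot_at (hook_point (X n s) \<theta>) - lfoot_at (hook_point (X n s) \<theta>))"
      by (rule integral_step(2)[of "\<lambda>p. rfoot_at p - lfoot_at p"]) (auto intro: rfoot_lfoot_bound[unfolded real_norm_def])
    show "AE s in M. (LINT \<theta>:{0..1}|lborel. rfoot_at (hook_point (X n s) \<theta>) - lfoot_at (hook_point (X n s) \<theta>)) \<le>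
      3/4 * (rfoot_at (X n s) - lfoot_at (X n s))"
      using X_in_dom[of n] by eventually_elim (rule foot_length_mean)
  qed (intro integrable_mult_right foot_length_integrable)
  also have "\<dots> = 3/4 * (LINT s|M. rfoot_at (X n s) - lfoot_at (X n s))"
    by (rule integral_mult_right_zero)
  also have "\<dots> \<le> 3/4 * ((3/4) ^ n * (b - a))" using Suc by (intro mult_left_mono) auto
  finally show ?case by simp
qed

text \<open>Geometric decay makes the expected sum of all hook lengths finite. So almost surely the
  sum is finite and its terms tend to zero.\<close>

lemma foot_length_tendsto: "AE s in M. (\<lambda>n. rfoot_at (X n s) - lfoot_at (X n s)) \<longlonglongrightarrow> 0"
proof -
  let ?L = "\<lambda>n s. rfoot_at (X n s) - lfoot_at (X n s)"
  have nonneg: "AE s in M. \<forall>n. 0 \<le> ?L n s"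
    unfolding AE_all_countable
  proof
    fix n show "AE s in M. 0 \<le> ?L n s"
      using X_in_dom[of n] by eventually_elim (simp add: feet_le)
  qed
  have "(\<integral>\<^sup>+s. ennreal (?L n s) \<partial>M) \<le> ennreal ((3/4) ^ n * (b - a))" for n
    using foot_length_expectation[of n] nonneg
    by (subst nn_integral_eq_integral[OF foot_length_integrable]) (auto intro: ennreal_leI)
  then have "(\<integral>\<^sup>+s. (\<Sum>n. ennreal (?L n s)) \<partial>M) \<le> (\<Sum>n. ennreal ((3/4) ^ n * (b - a)))"
    by (subst nn_integral_suminf) (auto intro: suminf_le)
  also have "\<dots> = ennreal (\<Sum>n. (3/4) ^ n * (b - a))"
    using ab by (intro suminf_ennreal2 summable_mult2 summable_geometric) auto
  finally have "(\<integral>\<^sup>+s. (\<Sum>n. ennreal (?L n s)) \<partial>M) \<noteq> \<infinity>" by (auto simp: top_unique)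
  then have "AE s in M. (\<Sum>n. ennreal (?L n s)) \<noteq> \<infinity>"
    by (intro nn_integral_noteq_infinite) auto
  with nonneg show ?thesis
  proof eventually_elim
    case (elim s)
    then have "summable (\<lambda>n. ?L n s)" by (intro summable_suminf_not_top) auto
    then show ?case by (rule summable_LIMSEQ_zero)
  qed
qed

lemma X_converges:
  "AE s in M. \<exists>p. (\<lambda>n. X n s) \<longlonglongrightarrow> p \<and> (\<forall>n. X n s \<in> dom) \<and>
    (\<lambda>n. lfoot_at (X n s)) \<longlonglongrightarrow> fst p \<and> (\<lambda>n. rfoot_at (X n s)) \<longlonglongrightarrow> fst p"
proof -
  let ?t = "\<lambda>p. (fst p - snd p) / 2 :: real" and ?v = "\<lambda>p. (fst p + snd p) / 2 :: real"
  have [measurable]: "?t \<in> borel_measurable borel" "?v \<in> borel_measurable borel"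
    by (simp_all add: borel_prod[symmetric])
  have t: "AE s in M. \<forall>n. ?t (X n s) \<le> ?t (X (Suc n) s)"
    by (rule step_mono_AE) (auto simp: hook_point_def leg_point_def abs_if)
  have v: "AE s in M. \<forall>n. - ?v (X n s) \<le> - ?v (X (Suc n) s)"
    by (rule step_mono_AE[where c="\<lambda>p. - ?v p"]) (auto simp: hook_point_def leg_point_def abs_if)
  have d: "AE s in M. \<forall>n. X n s \<in> dom" unfolding AE_all_countable using X_in_dom by blast
  from t v d foot_length_tendsto show ?thesis
  proof eventually_elim
    case (elim s)
    \<comment> \<open>The coordinate equals the value of \<open>x - f x\<close> at the left foot,
      whence the upper bound; the other coordinate is bounded below through the right foot.\<close>
    have "?t (X n s) \<le> b - f b" for n
    proof -
      have "?t (X n s) = lfoot_at (X n s) - f (lfoot_at (X n s))" "lfoot_at (X n s) \<le> b"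
        using elim(3) dom_feet[of "X n s"] by auto
      then show ?thesis using profile_mono[OF profile_compl[OF f], of "lfoot_at (X n s)" b] by simp
    qed
    moreover have "incseq (\<lambda>n. ?t (X n s))" using elim(1) by (simp add: incseq_Suc_iff)
    ultimately obtain t where t: "(\<lambda>n. ?t (X n s)) \<longlonglongrightarrow> t"
      using incseq_convergent[of "\<lambda>n. ?t (X n s)" "b - f b"] by blast
    have "f a \<le> ?v (X n s)" for n
    proof -
      have "?v (X n s) = f (rfoot_at (X n s))" "a \<le> rfoot_at (X n s)"
        using elim(3) dom_feet[of "X n s"] by auto
      then show ?thesis using profile_mono[OF f, of a "rfoot_at (X n s)"] by simp
    qed
    moreover have "decseq (\<lambda>n. ?v (X n s))" using elim(2) by (simp add: decseq_Suc_iff)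
    ultimately obtain v where v: "(\<lambda>n. ?v (X n s)) \<longlonglongrightarrow> v"
      using decseq_convergent[of "\<lambda>n. ?v (X n s)" "f a"] by blast
    have "(\<lambda>n. (?t (X n s) + ?v (X n s), ?v (X n s) - ?t (X n s))) \<longlonglongrightarrow> (t + v, v - t)"
      by (intro tendsto_intros t v)
    moreover have "(?t p + ?v p, ?v p - ?t p) = p" for p :: "real \<times> real"
      by (cases p) (simp add: field_simps)
    ultimately have X: "(\<lambda>n. X n s) \<longlonglongrightarrow> (t + v, v - t)" by simp
    then have x: "(\<lambda>n. fst (X n s)) \<longlonglongrightarrow> t + v" by (auto dest: tendsto_fst)
    have le: "lfoot_at (X n s) \<le> fst (X n s)" "fst (X n s) \<le> rfoot_at (X n s)" for n
      using elim(3) dom_feet[of "X n s"] by auto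
    have "(\<lambda>n. lfoot_at (X n s)) \<longlonglongrightarrow> t + v"
    proof (rule tendsto_sandwich[OF _ _ _ x])
      show "(\<lambda>n. fst (X n s) - (rfoot_at (X n s) - lfoot_at (X n s))) \<longlonglongrightarrow> t + v"
        using tendsto_diff[OF x elim(4)] by simp
    qed (use le in \<open>auto intro!: always_eventually\<close>)
    moreover have "(\<lambda>n. rfoot_at (X n s)) \<longlonglongrightarrow> t + v"
    proof (rule tendsto_sandwich[OF _ _ x])
      show "(\<lambda>n. fst (X n s) + (rfoot_at (X n s) - lfoot_at (X n s))) \<longlonglongrightarrow> t + v"
        using tendsto_add[OF x elim(4)] by simp
    qed (use le in \<open>auto intro!: always_eventually\<close>)
    ultimately show ?case using X elim(3) by (intro exI[of _ "(t + v, v - t)"]) auto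
  qed
qed

text \<open>The bounded kernel has constant expectation along the walk. As the feet merge, its
  exponent vanishes and only the pole at the limit point is left, so dominated convergence
  applies.\<close>

theorem cauchy_transform_limit:
  assumes w: "Im w > 0"
  shows "(LINT s|M. 1 / (w - of_real (fst (lim (\<lambda>n. X n s))))) = (LINT s|M. kern w (feet (X 0 s)))"
proof -
  note [measurable] = kern_measurable[OF w]
  have [measurable]: "(\<lambda>s. fst (lim (\<lambda>n. X n s))) \<in> borel_measurable M"
  proof -
    have "(\<lambda>s. lim (\<lambda>n. X n s)) \<in> borel_measurable M" by measurable
    then have "(\<lambda>s. lim (\<lambda>n. X n s)) \<in> M \<rightarrow>\<^sub>M borel \<Otimes>\<^sub>M borel" by (simp add: borel_prod)
    then show ?thesis by measurable
  qed
  have "(\<lambda>n. LINT s|M. kern w (feet (X n s))) \<longlonglongrightarrow> (LINT s|M. 1 / (w - of_real (fst (lim (\<lambda>n. X n s)))))"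
  proof (rule integral_dominated_convergence[where w="\<lambda>s. exp ((b - a) / Im w) / Im w"])
    show "AE s in M. (\<lambda>n. kern w (feet (X n s))) \<longlonglongrightarrow> 1 / (w - of_real (fst (lim (\<lambda>n. X n s))))"
      using X_converges
    proof eventually_elim
      case (elim s)
      then obtain p where p: "(\<lambda>n. X n s) \<longlonglongrightarrow> p" "\<And>n. X n s \<in> dom"
        "(\<lambda>n. lfoot_at (X n s)) \<longlonglongrightarrow> fst p" "(\<lambda>n. rfoot_at (X n s)) \<longlonglongrightarrow> fst p" by blast
      have "(\<lambda>n. harmonic_kernel f w (lfoot_at (X n s)) (rfoot_at (X n s))) \<longlonglongrightarrow> 1 / (w - of_real (fst p))"
        by (rule harmonic_kernel_tendsto[OF f w feet_le[OF p(2)] p(3,4)])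
      then show ?case using limI[OF p(1)] by (simp add: kern_feet p(2))
    qed
    show "AE s in M. norm (kern w (feet (X n s))) \<le> exp ((b - a) / Im w) / Im w" for n
      by (intro AE_I2 norm_kern_le w)
  qed auto
  moreover have "(\<lambda>n. LINT s|M. kern w (feet (X n s))) = (\<lambda>n. LINT s|M. kern w (feet (X 0 s)))"
    by (rule ext) (rule kern_martingale[OF w])
  ultimately show ?thesis
    using LIMSEQ_unique[OF _ tendsto_const] by metis
qed

end

section \<open>Boundary values\<close>

lemma Arg_eq_arccot:
  assumes "Im z > 0" shows "Arg z = arccot (Re z / Im z)"
proof -
  have z: "z \<noteq> 0" using assms by auto
  have A: "0 < Arg z" "Arg z < pi" using Arg_lt_pi[of z] assms by auto
  have "tan (pi / 2 - Arg z) = cos (Arg z) / sin (Arg z)"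
    by (simp add: tan_def sin_diff cos_diff)
  also have "\<dots> = Re z / Im z" using z by (simp add: cos_Arg sin_Arg)
  finally have "arctan (Re z / Im z) = pi / 2 - Arg z"
    using A by (intro arctan_unique) auto
  then show ?thesis by (simp add: arccot_eq)
qed

text \<open>The Poisson kernel without the factor 1 / pi, so its mass on the line is pi and the
  integral is itself an angle.\<close>

definition poisson_int :: "(real \<Rightarrow> real) \<Rightarrow> real \<Rightarrow> real \<Rightarrow> real \<Rightarrow> real \<Rightarrow> real" where
  "poisson_int f \<alpha> \<beta> e x = (LINT u:{\<alpha><..\<beta>}|interval_measure f. e / ((x - u)\<^sup>2 + e\<^sup>2))"

lemma Im_cauchy_int:
  assumes f: "profile f" and "e > 0" "\<alpha> \<le> \<beta>"
  shows "Im (cauchy_int f (Complex x e) \<alpha> \<beta>) = - poisson_int f \<alpha> \<beta> e x"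
proof -
  have *: "Im (1 / (Complex x e - of_real u)) = - (e / ((x - u)\<^sup>2 + e\<^sup>2))" for u
    by (simp add: Im_divide power2_eq_square)
  have "set_integrable (interval_measure f) {\<alpha><..\<beta>} (\<lambda>u. 1 / (Complex x e - of_real u))"
    using assms by (intro stieltjes_integrable cauchy_kernel_continuous) auto
  then show ?thesis
    unfolding cauchy_int_def poisson_int_def set_lebesgue_integral_def set_integrable_def
    by (subst integral_Im[symmetric]) (auto simp del: times_divide_eq_right simp: *)
qed

lemma poisson_nonneg: "e > 0 \<Longrightarrow> 0 \<le> poisson_int f \<alpha> \<beta> e x"
  unfolding poisson_int_def set_lebesgue_integral_def by (intro Bochner_Integration.integral_nonneg) auto

text \<open>Together with its nonnegative counterpart for \<open>x - f x\<close> this is the angle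
  under which [\<alpha>, \<beta>] is seen from the point x + i e, which is less than pi.\<close>

lemma poisson_less_pi:
  assumes f: "profile f" and "e > 0" "\<alpha> \<le> \<beta>"
  shows "poisson_int f \<alpha> \<beta> e x < pi"
proof -
  let ?w = "Complex x e"
  have "poisson_int f \<alpha> \<beta> e x + poisson_int (\<lambda>x. x - f x) \<alpha> \<beta> e x =
    - Im (cauchy_int f ?w \<alpha> \<beta> + cauchy_int (\<lambda>x. x - f x) ?w \<alpha> \<beta>)"
    using Im_cauchy_int[OF f assms(2,3)] Im_cauchy_int[OF profile_compl[OF f] assms(2,3)] by simp
  also have "\<dots> = Im (Ln (?w - of_real \<beta>)) - Im (Ln (?w - of_real \<alpha>))"
    using \<open>e > 0\<close> by (subst cauchy_int_add_compl[OF f _ \<open>\<alpha> \<le> \<beta>\<close>]) auto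
  also have "\<dots> < pi"
    using Im_Ln_pos_lt_imp[of "?w - of_real \<beta>"] Im_Ln_pos_lt_imp[of "?w - of_real \<alpha>"] \<open>e > 0\<close> by simp
  finally show ?thesis using poisson_nonneg[OF \<open>e > 0\<close>, of "\<lambda>x. x - f x" \<alpha> \<beta> x] by linarith
qed

text \<open>The imaginary part of the exponent lies in [0, pi), so it is the principal argument. The
  exponent's imaginary part can thus be read off from the exponential without a choice of
  branch.\<close>

lemma poisson_eq_Arg:
  assumes f: "profile f" and "e > 0" "\<alpha> \<le> \<beta>"
  shows "poisson_int f \<alpha> \<beta> e x = Arg (exp (- cauchy_int f (Complex x e) \<alpha> \<beta>))"
  using poisson_nonneg[OF assms(2), of f \<alpha> \<beta> x] poisson_less_pi[OF assms, of x] Im_cauchy_int[OF assms, of x]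
  by (subst Arg_exp) auto

lemma lborel_poisson_kernel:
  assumes "e > 0" "x1 \<le> x2"
  shows "(LINT x:{x1..x2}|lborel. e / ((x - u)\<^sup>2 + e\<^sup>2)) = arctan ((x2 - u) / e) - arctan ((x1 - u) / e)"
proof -
  have pos: "(x - u)\<^sup>2 + e\<^sup>2 \<noteq> 0" for x using \<open>e > 0\<close> by (simp add: sum_power2_eq_zero_iff)
  have 1: "((\<lambda>x. arctan ((x - u) / e)) has_vector_derivative e / ((x - u)\<^sup>2 + e\<^sup>2)) (at x within {x1..x2})" for x
    unfolding has_real_derivative_iff_has_vector_derivative[symmetric]
    using pos[of x] \<open>e > 0\<close>
    by (auto intro!: derivative_eq_intros simp: power_divide field_simps power2_eq_square)
  have 2: "continuous_on {x1..x2} (\<lambda>x. e / ((x - u)\<^sup>2 + e\<^sup>2))"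
    using pos by (intro continuous_intros) auto
  show ?thesis
    using integral_FTC_Icc[OF \<open>x1 \<le> x2\<close> 1 2] by (simp add: set_lebesgue_integral_def)
qed

text \<open>Integrating first in x replaces a kernel that concentrates as e tends to 0 by a bounded
  difference of arctangents. For fixed e the kernel is at most 1 / e.\<close>

lemma poisson_fubini:
  assumes f: "profile f" and e: "e > 0" and "\<alpha> \<le> \<beta>" "x1 \<le> x2"
  shows "set_integrable lborel {x1..x2} (poisson_int f \<alpha> \<beta> e)"
    and "(LINT x:{x1..x2}|lborel. poisson_int f \<alpha> \<beta> e x) =
      (LINT u:{\<alpha><..\<beta>}|interval_measure f. arctan ((x2 - u) / e) - arctan ((x1 - u) / e))"
proof -
  interpret sigma_finite_measure "interval_measure f"
    by (rule sigma_finite_interval_measure)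
       (use profile_mono[OF f] profile_continuous[OF f, of UNIV] in
        \<open>auto simp: continuous_on_eq_continuous_within intro: continuous_within_subset\<close>)
  interpret P: pair_sigma_finite lborel "interval_measure f" ..
  define h :: "real \<Rightarrow> real \<Rightarrow> real" where
    "h x u = indicator {x1..x2} x * (indicator {\<alpha><..\<beta>} u * (e / ((x - u)\<^sup>2 + e\<^sup>2)))" for x u
  let ?R = "{x1..x2} \<times> {\<alpha><..\<beta>}"
  have le: "e / ((x - u)\<^sup>2 + e\<^sup>2) \<le> 1 / e" for x u :: real
  proof -
    have "e / ((x - u)\<^sup>2 + e\<^sup>2) \<le> e / e\<^sup>2"
      using e by (intro divide_left_mono mult_pos_pos add_nonneg_pos) auto
    then show ?thesis using e by (simp add: power2_eq_square)
  qed
  have "integrable (lborel \<Otimes>\<^sub>M interval_measure f) (case_prod h)"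
  proof (rule integrableI_bounded_set[where A="?R" and B="1 / e"])
    have "emeasure (lborel \<Otimes>\<^sub>M interval_measure f) ?R =
      emeasure lborel {x1..x2} * emeasure (interval_measure f) {\<alpha><..\<beta>}"
      by (rule emeasure_pair_measure_Times) auto
    then show "emeasure (lborel \<Otimes>\<^sub>M interval_measure f) ?R < \<infinity>"
      using emeasure_stieltjes_Ioc[OF f \<open>\<alpha> \<le> \<beta>\<close>] \<open>x1 \<le> x2\<close> by (simp add: ennreal_mult_less_top)
    show "?R \<in> sets (lborel \<Otimes>\<^sub>M interval_measure f)" by (intro pair_measureI) auto
    show "case_prod h \<in> borel_measurable (lborel \<Otimes>\<^sub>M interval_measure f)"
      unfolding h_def by measurable
    show "AE z in lborel \<Otimes>\<^sub>M interval_measure f. z \<in> ?R \<longrightarrow> norm (case_prod h z) \<le> 1 / e"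
      using le e by (auto simp: h_def intro!: AE_I2)
  qed (auto simp: h_def indicator_def)
  then have int: "integrable (lborel \<Otimes>\<^sub>M interval_measure f) (\<lambda>(x, u). h x u)" .
  have 1: "(LINT u|interval_measure f. h x u) = indicator {x1..x2} x * poisson_int f \<alpha> \<beta> e x" for x
    unfolding h_def poisson_int_def set_lebesgue_integral_def real_scaleR_def
    by (rule integral_mult_right_zero)
  have 2: "(LINT x|lborel. h x u) = indicator {\<alpha><..\<beta>} u * (arctan ((x2 - u) / e) - arctan ((x1 - u) / e))" for u
    unfolding lborel_poisson_kernel[OF e \<open>x1 \<le> x2\<close>, symmetric] set_lebesgue_integral_def h_def
    by (subst integral_mult_right_zero[symmetric]) (simp add: mult_ac)
  show "set_integrable lborel {x1..x2} (poisson_int f \<alpha> \<beta> e)"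
    using P.integrable_fst'[OF int] by (simp add: set_integrable_def 1)
  show "(LINT x:{x1..x2}|lborel. poisson_int f \<alpha> \<beta> e x) =
      (LINT u:{\<alpha><..\<beta>}|interval_measure f. arctan ((x2 - u) / e) - arctan ((x1 - u) / e))"
    using P.Fubini_integral[OF int] unfolding 1 2 by (simp add: set_lebesgue_integral_def)
qed

lemma arctan_scaled_tendsto:
  "c > 0 \<Longrightarrow> (\<lambda>n. arctan (c / inverse (real (Suc n)))) \<longlonglongrightarrow> pi / 2"
  "c < 0 \<Longrightarrow> (\<lambda>n. arctan (c / inverse (real (Suc n)))) \<longlonglongrightarrow> - (pi / 2)"
proof -
  have S: "filterlim (\<lambda>n. real (Suc n)) at_top sequentially"
    by (rule filterlim_compose[OF filterlim_real_sequentially filterlim_Suc])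
  show "(\<lambda>n. arctan (c / inverse (real (Suc n)))) \<longlonglongrightarrow> pi / 2" if "c > 0"
    using filterlim_tendsto_pos_mult_at_top[OF tendsto_const that S]
    by (intro filterlim_compose[OF tendsto_arctan_at_top]) (simp add: divide_inverse)
  show "(\<lambda>n. arctan (c / inverse (real (Suc n)))) \<longlonglongrightarrow> - (pi / 2)" if "c < 0"
    using filterlim_tendsto_neg_mult_at_bot[OF tendsto_const that S]
    by (intro filterlim_compose[OF tendsto_arctan_at_bot]) (simp add: divide_inverse)
qed

lemma poisson_integral_tendsto:
  assumes f: "profile f" and le: "\<alpha> \<le> x1" "x1 \<le> x2" "x2 \<le> \<beta>"
  shows "(\<lambda>n. LINT x:{x1..x2}|lborel. poisson_int f \<alpha> \<beta> (inverse (real (Suc n))) x)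
    \<longlonglongrightarrow> pi * (f x2 - f x1)"
proof -
  let ?M = "interval_measure f" and ?e = "\<lambda>n. inverse (real (Suc n))"
  \<comment> \<open>The arctangent difference tends to pi inside (x1, x2) and to 0 outside [x1, x2].
    A profile is continuous, so its measure has no atoms and the end points do not matter.\<close>
  have sing: "AE u in ?M. u \<noteq> x" for x
  proof (rule AE_I'[of "{x}"])
    have "emeasure ?M {x..x} = ennreal (f x - f x)"
      by (rule emeasure_interval_measure_Icc) (use profile_mono[OF f] profile_continuous[OF f] in auto)
    then show "{x} \<in> null_sets ?M" by (auto simp: null_sets_def)
  qed auto
  have "(\<lambda>n. LINT u:{\<alpha><..\<beta>}|?M. arctan ((x2 - u) / ?e n) - arctan ((x1 - u) / ?e n))
    \<longlonglongrightarrow> (LINT u|?M. pi * indicator {x1<..x2} u)"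
    unfolding set_lebesgue_integral_def
  proof (rule integral_dominated_convergence[where w="\<lambda>u. pi * indicator {\<alpha><..\<beta>} u"])
    show "integrable ?M (\<lambda>u. pi * indicator {\<alpha><..\<beta>} u)"
      using emeasure_stieltjes_Ioc[OF f, of \<alpha> \<beta>] le by auto
    show "AE u in ?M. (\<lambda>n. indicator {\<alpha><..\<beta>} u *\<^sub>R (arctan ((x2 - u) / ?e n) - arctan ((x1 - u) / ?e n)))
      \<longlonglongrightarrow> pi * indicator {x1<..x2} u"
      using sing[of x1] sing[of x2]
    proof eventually_elim
      case (elim u)
      have l: "(\<lambda>n. arctan ((y - u) / ?e n)) \<longlonglongrightarrow> (if y > u then pi / 2 else - (pi / 2))" if "u \<noteq> y" for y
        using arctan_scaled_tendsto[of "y - u"] that by auto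
      have "(\<lambda>n. indicator {\<alpha><..\<beta>} u *\<^sub>R (arctan ((x2 - u) / ?e n) - arctan ((x1 - u) / ?e n)))
        \<longlonglongrightarrow> indicator {\<alpha><..\<beta>} u *\<^sub>R ((if x2 > u then pi / 2 else - (pi / 2)) - (if x1 > u then pi / 2 else - (pi / 2)))"
        by (intro tendsto_intros l elim)
      also have "indicator {\<alpha><..\<beta>} u *\<^sub>R ((if x2 > u then pi / 2 else - (pi / 2)) - (if x1 > u then pi / 2 else - (pi / 2))) =
        pi * indicator {x1<..x2} u"
        using elim le by (auto simp: indicator_def)
      finally show ?case .
    qed
    fix n
    have "norm (arctan p - arctan q) \<le> pi" for p q
      using arctan_bounded[of p] arctan_bounded[of q] by (auto simp: abs_le_iff)
    then show "AE u in ?M. norm (indicator {\<alpha><..\<beta>} u *\<^sub>R (arctan ((x2 - u) / ?e n) - arctan ((x1 - u) / ?e n)))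
      \<le> pi * indicator {\<alpha><..\<beta>} u"
      by (intro AE_I2) (auto simp: indicator_def)
  qed measurable
  also have "(LINT u|?M. pi * indicator {x1<..x2} u) = pi * (f x2 - f x1)"
    using measure_stieltjes_Ioc[OF f le(2)] emeasure_stieltjes_Ioc[OF f le(2)] by simp
  finally show ?thesis
    using poisson_fubini(2)[OF f _ _ le(2)] le by simp
qed

text \<open>Over a short interval the integrated Poisson integrals tend to pi times the increment of
  \<open>f\<close>, and, being bounded by pi with pointwise limit \<open>\<theta>\<close>, also to
  the integral of \<open>\<theta>\<close>. So \<open>f\<close> is locally a primitive of the
  continuous function \<open>\<theta> / pi\<close>, differentiable at every point of
  \<open>U\<close>. The heights 1 / (n + 1) form a sequence for the sake of dominated
  convergence.\<close>

theorem profile_derivative: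
  assumes f: "profile f" and "\<alpha> \<le> \<beta>" and U: "open U" "U \<subseteq> {\<alpha>..\<beta>}"
    and lim: "\<And>x. x \<in> U \<Longrightarrow>
      (\<lambda>n. exp (- cauchy_int f (Complex x (inverse (real (Suc n)))) \<alpha> \<beta>)) \<longlonglongrightarrow> \<Psi> x"
    and Im: "\<And>x. x \<in> U \<Longrightarrow> Im (\<Psi> x) > 0"
    and \<theta>: "\<And>x. x \<in> U \<Longrightarrow> arccot (Re (\<Psi> x) / Im (\<Psi> x)) = \<theta> x" and cont: "continuous_on U \<theta>"
    and x: "x \<in> U"
  shows "(f has_real_derivative \<theta> x / pi) (at x)"
proof -
  let ?e = "\<lambda>n. inverse (real (Suc n))"
  have e: "?e n > 0" for n by simp
  have pl: "(\<lambda>n. poisson_int f \<alpha> \<beta> (?e n) y) \<longlonglongrightarrow> \<theta> y" if y: "y \<in> U" for y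
  proof -
    have "(\<lambda>n. Arg (exp (- cauchy_int f (Complex y (?e n)) \<alpha> \<beta>))) \<longlonglongrightarrow> Arg (\<Psi> y)"
      using Im[OF y] by (intro tendsto_Arg lim y) (auto simp: complex_nonpos_Reals_iff)
    then show ?thesis
      unfolding poisson_eq_Arg[OF f e \<open>\<alpha> \<le> \<beta>\<close>, symmetric] using Arg_eq_arccot[OF Im[OF y]] \<theta>[OF y] by simp
  qed
  obtain \<delta> where \<delta>: "\<delta> > 0" "cball x \<delta> \<subseteq> U" using U(1) x open_contains_cball by blast
  then have sub: "{x - \<delta>..x + \<delta>} \<subseteq> U" by (simp add: cball_eq_atLeastAtMost)
  have cont': "continuous_on {x - \<delta>..x + \<delta>} \<theta>" by (rule continuous_on_subset[OF cont sub])
  have eq: "f y = f (x - \<delta>) + integral {x - \<delta>..y} \<theta> / pi" if y: "y \<in> {x - \<delta>..x + \<delta>}" for y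
  proof -
    have suby: "{x - \<delta>..y} \<subseteq> U" using y sub by auto
    have "x - \<delta> \<in> {\<alpha>..\<beta>}" "y \<in> {\<alpha>..\<beta>}" using y suby U(2) by (auto simp: subset_iff)
    then have le: "\<alpha> \<le> x - \<delta>" "x - \<delta> \<le> y" "y \<le> \<beta>" using y by auto
    have cy: "continuous_on {x - \<delta>..y} \<theta>" by (rule continuous_on_subset[OF cont suby])
    have "(\<lambda>n. LINT t:{x - \<delta>..y}|lborel. poisson_int f \<alpha> \<beta> (?e n) t) \<longlonglongrightarrow> (LINT t:{x - \<delta>..y}|lborel. \<theta> t)"
      unfolding set_lebesgue_integral_def
    proof (rule integral_dominated_convergence[where w="\<lambda>t. pi * indicator {x - \<delta>..y} t"])
      show "(\<lambda>t. indicator {x - \<delta>..y} t *\<^sub>R \<theta> t) \<in> borel_measurable lborel"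
        using borel_measurable_continuous_on_indicator[OF _ cy] by simp
      show "(\<lambda>t. indicator {x - \<delta>..y} t *\<^sub>R poisson_int f \<alpha> \<beta> (?e n) t) \<in> borel_measurable lborel" for n
        using poisson_fubini(1)[OF f e \<open>\<alpha> \<le> \<beta>\<close> le(2)] by (simp add: set_integrable_def borel_measurable_integrable)
      show "integrable lborel (\<lambda>t. pi * indicator {x - \<delta>..y} t)" using le by simp
      show "AE t in lborel. (\<lambda>n. indicator {x - \<delta>..y} t *\<^sub>R poisson_int f \<alpha> \<beta> (?e n) t)
        \<longlonglongrightarrow> indicator {x - \<delta>..y} t *\<^sub>R \<theta> t"
        using pl suby by (intro AE_I2) (auto simp: indicator_def)
      show "AE t in lborel. norm (indicator {x - \<delta>..y} t *\<^sub>R poisson_int f \<alpha> \<beta> (?e n) t) \<le> pi * indicator {x - \<delta>..y} t" for n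
        using poisson_nonneg[OF e] poisson_less_pi[OF f e \<open>\<alpha> \<le> \<beta>\<close>, THEN less_imp_le]
        by (intro AE_I2) (auto simp: indicator_def)
    qed
    with poisson_integral_tendsto[OF f le]
    have "pi * (f y - f (x - \<delta>)) = (LINT t:{x - \<delta>..y}|lborel. \<theta> t)"
      by (rule LIMSEQ_unique)
    also have "\<dots> = integral {x - \<delta>..y} \<theta>"
      by (rule set_borel_integral_eq_integral(2)[OF borel_integrable_atLeastAtMost'[OF cy]])
    finally show ?thesis by (simp add: field_simps)
  qed
  have "((\<lambda>y. f (x - \<delta>) + integral {x - \<delta>..y} \<theta> / pi) has_real_derivative \<theta> x / pi) (at x within {x - \<delta>..x + \<delta>})"
    using DERIV_add[OF DERIV_const DERIV_cdivide[OF integral_has_real_derivative[OF cont', of x]]] \<delta>(1)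
    by simp
  then have "(f has_real_derivative \<theta> x / pi) (at x within {x - \<delta>..x + \<delta>})"
  proof (rule has_field_derivative_transform_within[OF _ \<delta>(1)])
    show "x \<in> {x - \<delta>..x + \<delta>}" using \<delta>(1) by simp
  qed (rule eq[symmetric])
  then show ?thesis using \<delta>(1) by (simp add: at_within_Icc_at)
qed

section \<open>The Plemelj formula\<close>

text \<open>At u = x the value is 0, by division by zero; a single point is invisible to the
  integrals.\<close>

definition diff_quot :: "(real \<Rightarrow> real) \<Rightarrow> real \<Rightarrow> real \<Rightarrow> real" where
  "diff_quot g x u = (g u - g x) / (u - x)"

text \<open>Lipschitz on a neighbourhood, not merely at x: continuity of the principal value term
  compares difference quotients based at all nearby points.\<close>

definition locally_lipschitz_at :: "(real \<Rightarrow> real) \<Rightarrow> real \<Rightarrow> bool" where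
  "locally_lipschitz_at g x \<longleftrightarrow>
    (\<exists>\<delta>>0. \<exists>C. \<forall>u\<in>{x - \<delta>..x + \<delta>}. \<forall>v\<in>{x - \<delta>..x + \<delta>}. \<bar>g u - g v\<bar> \<le> C * \<bar>u - v\<bar>)"

text \<open>For u near x the Lipschitz constant bounds the quotient; for u far from x its
  denominator is at least half the radius. Both bounds hold for all base points y near x at once,
  giving one dominating function.\<close>

lemma diff_quot_dominated:
  assumes "locally_lipschitz_at g x"
  obtains \<delta> C where "\<delta> > 0" "isCont g x"
    "\<And>y u. \<bar>y - x\<bar> \<le> \<delta> \<Longrightarrow> \<bar>diff_quot g y u\<bar> \<le> C * (1 + \<bar>g u\<bar>)"
proof -
  obtain \<delta> C where \<delta>: "\<delta> > 0" and
    C: "\<And>u v. u \<in> {x - \<delta>..x + \<delta>} \<Longrightarrow> v \<in> {x - \<delta>..x + \<delta>} \<Longrightarrow> \<bar>g u - g v\<bar> \<le> C * \<bar>u - v\<bar>"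
    using assms unfolding locally_lipschitz_at_def by blast
  have C0: "0 \<le> C"
  proof -
    have "0 \<le> C * \<delta>" using C[of "x + \<delta>" x] \<delta> by auto
    then show ?thesis using \<delta> by (simp add: zero_le_mult_iff)
  qed
  have "C-lipschitz_on {x - \<delta>..x + \<delta>} g"
    using C C0 by (intro lipschitz_onI) (auto simp: dist_real_def)
  then have "continuous_on {x - \<delta>..x + \<delta>} g" by (rule lipschitz_on_continuous_on)
  then have cont: "isCont g x" by (rule continuous_on_interior) (use \<delta> in auto)
  define G where "G = \<bar>g x\<bar> + C * \<delta>"
  have G0: "0 \<le> G" using C0 \<delta> by (simp add: G_def)
  define K where "K = C + 2 / \<delta> * (1 + G)"
  have K: "C \<le> K" "2 / \<delta> \<le> K" "2 / \<delta> * G \<le> K" "0 \<le> K"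
    using \<delta> C0 G0 by (auto simp: K_def distrib_left)
  have "\<bar>diff_quot g y u\<bar> \<le> K * (1 + \<bar>g u\<bar>)" if y: "\<bar>y - x\<bar> \<le> \<delta> / 2" for y u
  proof (cases "\<bar>u - x\<bar> \<le> \<delta>")
    case True
    have "u \<in> {x - \<delta>..x + \<delta>}" "y \<in> {x - \<delta>..x + \<delta>}"
      using True y \<delta> unfolding atLeastAtMost_iff by linarith+
    then have "\<bar>g u - g y\<bar> \<le> C * \<bar>u - y\<bar>" by (rule C)
    then have "\<bar>diff_quot g y u\<bar> \<le> C"
      unfolding diff_quot_def abs_divide using C0 by (cases "u = y") (auto simp: divide_le_eq)
    also have "\<dots> \<le> K * (1 + \<bar>g u\<bar>)"
      using K(1) mult_nonneg_nonneg[OF K(4) abs_ge_zero[of "g u"]] unfolding distrib_left by linarith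
    finally show ?thesis .
  next
    case False
    have "\<bar>g y\<bar> \<le> G"
    proof -
      have "y \<in> {x - \<delta>..x + \<delta>}" "x \<in> {x - \<delta>..x + \<delta>}"
        using y \<delta> unfolding atLeastAtMost_iff by linarith+
      then have "\<bar>g y - g x\<bar> \<le> C * \<bar>y - x\<bar>" by (rule C)
      also have "\<dots> \<le> C * \<delta>" using C0 y \<delta> by (intro mult_left_mono) auto
      finally show ?thesis unfolding G_def by linarith
    qed
    moreover have uy: "\<delta> / 2 \<le> \<bar>u - y\<bar>" using False y by linarith
    ultimately have "\<bar>diff_quot g y u\<bar> \<le> (\<bar>g u\<bar> + G) / (\<delta> / 2)"
      unfolding diff_quot_def abs_divide using \<delta> by (intro frac_le) auto
    also have "\<dots> = 2 / \<delta> * \<bar>g u\<bar> + 2 / \<delta> * G" using \<delta> by (simp add: field_simps)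
    also have "\<dots> \<le> K * \<bar>g u\<bar> + K" using K by (intro add_mono mult_right_mono) auto
    finally show ?thesis by (simp add: distrib_left)
  qed
  then show ?thesis using that[of "\<delta> / 2" K] \<delta> cont by auto
qed

context
  fixes a b :: real and g :: "real \<Rightarrow> real"
  assumes ab: "a < b" and g: "set_integrable lborel {a..b} g"
begin

text \<open>The absolutely convergent part of a principal value: for g Lipschitz near x inside (a,
  b), the principal value of the integral of g u / (u - x) is this plus g x * ln ((b - x) / (x -
  a)).\<close>

definition pv :: "real \<Rightarrow> real" where
  "pv x = (LINT u:{a..b}|lborel. diff_quot g x u)"

lemma diff_quot_measurable:
  "(\<lambda>u. indicator {a..b} u *\<^sub>R diff_quot g x u) \<in> borel_measurable lborel"
proof -
  have [measurable]: "(\<lambda>u. indicator {a..b} u *\<^sub>R g u) \<in> borel_measurable lborel"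
    using g by (simp add: set_integrable_def borel_measurable_integrable)
  have "(\<lambda>u. indicator {a..b} u *\<^sub>R diff_quot g x u) =
    (\<lambda>u. indicator {a..b} u *\<^sub>R ((indicator {a..b} u *\<^sub>R g u - g x) / (u - x)))"
    by (auto simp: diff_quot_def indicator_def)
  also have "\<dots> \<in> borel_measurable lborel" by measurable
  finally show ?thesis .
qed

lemma dominating_integrable:
  "integrable lborel (\<lambda>u. indicator {a..b} u *\<^sub>R (C * (1 + \<bar>g u\<bar>)))"
proof -
  have "set_integrable lborel {a..b} (\<lambda>u. \<bar>g u\<bar>)" using g by (rule set_integrable_abs)
  moreover have "set_integrable lborel {a..b} (\<lambda>u. 1 :: real)"
    using ab by (simp add: set_integrable_def)
  ultimately have "set_integrable lborel {a..b} (\<lambda>u. C * (1 + \<bar>g u\<bar>))"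
    by (cases "C = 0") (auto simp: set_integrable_def[of _ _ "\<lambda>_. 0"])
  then show ?thesis by (simp add: set_integrable_def)
qed

lemma pv_continuous:
  assumes "locally_lipschitz_at g x"
  shows "isCont pv x"
  unfolding continuous_at_sequentially
proof (intro allI impI)
  fix y assume y: "y \<longlonglongrightarrow> x"
  obtain \<delta> C where \<delta>: "\<delta> > 0" and cont: "isCont g x"
    and dom: "\<And>y u. \<bar>y - x\<bar> \<le> \<delta> \<Longrightarrow> \<bar>diff_quot g y u\<bar> \<le> C * (1 + \<bar>g u\<bar>)"
    using diff_quot_dominated[OF assms] by blast
  have "eventually (\<lambda>n. dist (y n) x < \<delta>) sequentially" using y \<delta> by (rule tendstoD)
  then obtain N where "\<forall>n\<ge>N. dist (y n) x < \<delta>" unfolding eventually_sequentially by blast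
  then have N: "\<bar>y n - x\<bar> \<le> \<delta>" if "n \<ge> N" for n
    using that by (force simp: dist_real_def)
  have yN: "(\<lambda>n. y (n + N)) \<longlonglongrightarrow> x" using y by (rule LIMSEQ_ignore_initial_segment)
  have "(\<lambda>n. pv (y (n + N))) \<longlonglongrightarrow> pv x"
    unfolding pv_def set_lebesgue_integral_def
  proof (rule integral_dominated_convergence[OF diff_quot_measurable diff_quot_measurable dominating_integrable])
    show "AE u in lborel. (\<lambda>n. indicator {a..b} u *\<^sub>R diff_quot g (y (n + N)) u)
      \<longlonglongrightarrow> indicator {a..b} u *\<^sub>R diff_quot g x u"
      using AE_lborel_singleton[of x]
    proof eventually_elim
      case (elim u)
      have "(\<lambda>n. g (y (n + N))) \<longlonglongrightarrow> g x" using isCont_tendsto_compose[OF cont yN] .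
      then show ?case unfolding diff_quot_def using elim yN by (intro tendsto_intros) auto
    qed
    show "AE u in lborel. norm (indicator {a..b} u *\<^sub>R diff_quot g (y (n + N)) u) \<le>
      indicator {a..b} u *\<^sub>R (C * (1 + \<bar>g u\<bar>))" for n
      using dom[OF N[of "n + N"]] by (intro AE_I2) (auto simp: indicator_def)
  qed
  then show "(pv \<circ> y) \<longlonglongrightarrow> pv x" unfolding o_def by (rule LIMSEQ_offset)
qed

lemma Ln_boundary:
  assumes x: "a < x" "x < b"
  shows "(\<lambda>n. Ln (Complex x (inverse (real (Suc n))) - of_real a) - Ln (Complex x (inverse (real (Suc n))) - of_real b))
    \<longlonglongrightarrow> of_real (- ln ((b - x) / (x - a))) - \<i> * of_real pi"
proof -
  let ?e = "\<lambda>n. inverse (real (Suc n))"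
  have e: "?e \<longlonglongrightarrow> 0" by (rule LIMSEQ_inverse_real_of_nat)
  have "(\<lambda>n. Complex x (?e n) - of_real a) \<longlonglongrightarrow> Complex x 0 - of_real a"
    by (intro tendsto_intros e)
  also have "Complex x 0 - of_real a = of_real (x - a)" by (simp add: complex_eq_iff)
  finally have "(\<lambda>n. Complex x (?e n) - of_real a) \<longlonglongrightarrow> of_real (x - a)" .
  then have 1: "(\<lambda>n. Ln (Complex x (?e n) - of_real a)) \<longlonglongrightarrow> Ln (of_real (x - a))"
    using x by (intro tendsto_Ln) (auto simp: complex_nonpos_Reals_iff)
  \<comment> \<open>The point tends to the negative axis from above, where \<open>Ln\<close> is
    discontinuous. Taking out the factor i moves the limit to the positive imaginary axis.\<close>
  have "Complex x (?e n) - of_real b = \<i> * Complex (?e n) (b - x)" for n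
    by (simp add: complex_eq_iff)
  moreover have "Ln (\<i> * Complex (?e n) (b - x)) = Ln (Complex (?e n) (b - x)) + \<i> * of_real pi / 2" for n
    by (subst Ln_times_ii) (auto simp: complex_eq_iff)
  moreover have "(\<lambda>n. Complex (?e n) (b - x)) \<longlonglongrightarrow> Complex 0 (b - x)"
    by (intro tendsto_intros e)
  then have "(\<lambda>n. Complex (?e n) (b - x)) \<longlonglongrightarrow> \<i> * of_real (b - x)"
    by (simp add: Complex_eq)
  then have "(\<lambda>n. Ln (Complex (?e n) (b - x)) + \<i> * of_real pi / 2) \<longlonglongrightarrow> Ln (\<i> * of_real (b - x)) + \<i> * of_real pi / 2"
    using x by (intro tendsto_intros) (auto simp: complex_nonpos_Reals_iff)
  ultimately have 2: "(\<lambda>n. Ln (Complex x (?e n) - of_real b)) \<longlonglongrightarrow> Ln (\<i> * of_real (b - x)) + \<i> * of_real pi / 2"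
    by simp
  have 3: "Ln (\<i> * of_real (b - x)) = of_real (ln (b - x)) + \<i> * of_real pi / 2"
    using x by (subst Ln_times_ii) (auto simp del: of_real_diff simp: Ln_of_real)
  have 4: "Ln (of_real (x - a)) = of_real (ln (x - a))" using x by (intro Ln_of_real) auto
  have "Ln (of_real (x - a)) - (Ln (\<i> * of_real (b - x)) + \<i> * of_real pi / 2) =
    of_real (- ln ((b - x) / (x - a))) - \<i> * of_real pi"
    unfolding 3 4 using x by (simp add: ln_div field_simps)
  then show ?thesis using tendsto_diff[OF 1 2] by simp
qed

text \<open>After subtracting g x from the density, the integrand is dominated by the difference
  quotient, because |w - u| \<ge> |u - x|, and tends to - \<open>diff_quot g x u\<close>. The
  subtracted constant contributes an explicit difference of logarithms, the source of the term - i
  pi g x.\<close>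

lemma plemelj:
  assumes x: "a < x" "x < b" and lip: "locally_lipschitz_at g x"
  shows "(\<lambda>n. LINT u:{a..b}|lborel. of_real (g u) / (Complex x (inverse (real (Suc n))) - of_real u))
    \<longlonglongrightarrow> - of_real (pv x + g x * ln ((b - x) / (x - a))) - \<i> * of_real (pi * g x)"
proof -
  let ?w = "\<lambda>n. Complex x (inverse (real (Suc n)))"
  have w: "Im (?w n) > 0" for n by simp
  have wx: "?w \<longlonglongrightarrow> of_real x"
    using tendsto_Complex[OF tendsto_const LIMSEQ_inverse_real_of_nat] by (simp add: complex_of_real_def)
  obtain \<delta> C where "\<delta> > 0" and "isCont g x" and dom': "\<And>y u. \<bar>y - x\<bar> \<le> \<delta> \<Longrightarrow> \<bar>diff_quot g y u\<bar> \<le> C * (1 + \<bar>g u\<bar>)"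
    using diff_quot_dominated[OF lip] by blast
  then have dom: "\<bar>diff_quot g x u\<bar> \<le> C * (1 + \<bar>g u\<bar>)" for u by simp
  have gm [measurable]: "(\<lambda>u. indicator {a..b} u *\<^sub>R g u) \<in> borel_measurable lborel"
    using g by (simp add: set_integrable_def borel_measurable_integrable)
  define k where "k n u = of_real (g u - g x) / (?w n - of_real u)" for n u
  have k_meas: "(\<lambda>u. indicator {a..b} u *\<^sub>R k n u) \<in> borel_measurable lborel" for n
  proof -
    have "(\<lambda>u. indicator {a..b} u *\<^sub>R k n u) =
      (\<lambda>u. indicator {a..b} u *\<^sub>R (of_real (indicator {a..b} u *\<^sub>R g u - g x) / (?w n - of_real u)))"
      by (auto simp: k_def indicator_def)
    also have "\<dots> \<in> borel_measurable lborel" by measurable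
    finally show ?thesis .
  qed
  have k_le: "norm (k n u) \<le> C * (1 + \<bar>g u\<bar>)" for n u
  proof (cases "u = x")
    case False
    have "\<bar>u - x\<bar> \<le> norm (?w n - of_real u)"
      using abs_Re_le_cmod[of "?w n - of_real u"] by simp
    then have "norm (k n u) \<le> \<bar>g u - g x\<bar> / \<bar>u - x\<bar>"
      unfolding k_def norm_divide norm_of_real real_norm_def using False by (intro frac_le) auto
    also have "\<dots> \<le> C * (1 + \<bar>g u\<bar>)" using dom[of u] by (simp add: diff_quot_def)
    finally show ?thesis .
  qed (use order_trans[OF abs_ge_zero dom[of u]] in \<open>simp add: k_def\<close>)
  have "(\<lambda>n. LINT u:{a..b}|lborel. k n u) \<longlonglongrightarrow> (LINT u:{a..b}|lborel. of_real (- diff_quot g x u) :: complex)"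
    unfolding set_lebesgue_integral_def
  proof (rule integral_dominated_convergence[OF _ k_meas dominating_integrable])
    show "(\<lambda>u. indicator {a..b} u *\<^sub>R complex_of_real (- diff_quot g x u)) \<in> borel_measurable lborel"
      using measurable_compose[OF diff_quot_measurable[of x] borel_measurable_of_real]
      by (simp add: scaleR_conv_of_real)
    show "AE u in lborel. (\<lambda>n. indicator {a..b} u *\<^sub>R k n u) \<longlonglongrightarrow> indicator {a..b} u *\<^sub>R of_real (- diff_quot g x u)"
      using AE_lborel_singleton[of x]
    proof eventually_elim
      case (elim u)
      have "(\<lambda>n. k n u) \<longlonglongrightarrow> of_real (g u - g x) / (of_real x - of_real u)"
        unfolding k_def using elim by (intro tendsto_intros wx) auto
      also have "of_real (g u - g x) / (of_real x - of_real u) = complex_of_real (- diff_quot g x u)"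
        using elim by (simp add: diff_quot_def field_simps flip: of_real_diff of_real_divide)
      finally show ?case by (intro tendsto_intros)
    qed
    show "AE u in lborel. norm (indicator {a..b} u *\<^sub>R k n u) \<le> indicator {a..b} u *\<^sub>R (C * (1 + \<bar>g u\<bar>))" for n
      using k_le by (intro AE_I2) (auto simp: indicator_def)
  qed
  also have "(LINT u:{a..b}|lborel. of_real (- diff_quot g x u) :: complex) = - of_real (pv x)"
    unfolding set_integral_complex_of_real pv_def by (simp add: set_lebesgue_integral_def)
  finally have k_lim: "(\<lambda>n. LINT u:{a..b}|lborel. k n u) \<longlonglongrightarrow> - of_real (pv x)" .
  have k_int: "set_integrable lborel {a..b} (k n)" for n
    unfolding set_integrable_def
    by (rule Bochner_Integration.integrable_bound[OF dominating_integrable[of C] k_meas])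
       (use k_le order_trans[OF norm_ge_zero k_le] in \<open>auto simp: indicator_def\<close>)
  have c_int: "set_integrable lborel {a..b} (\<lambda>u. 1 / (?w n - of_real u))" for n
    by (intro borel_integrable_atLeastAtMost' cauchy_kernel_continuous w)
  have eq: "(LINT u:{a..b}|lborel. of_real (g u) / (?w n - of_real u)) =
    (LINT u:{a..b}|lborel. k n u) + of_real (g x) * (Ln (?w n - of_real a) - Ln (?w n - of_real b))" for n
  proof -
    have "(LINT u:{a..b}|lborel. of_real (g u) / (?w n - of_real u)) =
      (LINT u:{a..b}|lborel. k n u + of_real (g x) * (1 / (?w n - of_real u)))"
      by (simp add: k_def add_divide_distrib[symmetric])
    also have "\<dots> = (LINT u:{a..b}|lborel. k n u) + (LINT u:{a..b}|lborel. of_real (g x) * (1 / (?w n - of_real u)))"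
    proof (rule set_integral_add(2)[OF k_int])
      show "set_integrable lborel {a..b} (\<lambda>u. of_real (g x) * (1 / (?w n - of_real u)))"
        by (rule set_integrable_mult_right) (rule c_int)
    qed
    also have "(LINT u:{a..b}|lborel. of_real (g x) * (1 / (?w n - of_real u))) =
      of_real (g x) * (LINT u:{a..b}|lborel. 1 / (?w n - of_real u))"
      by (rule set_integral_mult_right)
    finally show ?thesis using lborel_cauchy_kernel[OF w, of a b n] ab by simp
  qed
  have "(\<lambda>n. (LINT u:{a..b}|lborel. k n u) + of_real (g x) * (Ln (?w n - of_real a) - Ln (?w n - of_real b)))
    \<longlonglongrightarrow> - of_real (pv x) + of_real (g x) * (of_real (- ln ((b - x) / (x - a))) - \<i> * of_real pi)"
    by (intro tendsto_add tendsto_mult k_lim Ln_boundary x tendsto_const)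
  then show ?thesis unfolding eq by (simp add: algebra_simps)
qed

text \<open>
  Both transition measures satisfy an identity of this shape: \<open>m w = b - w\<close>, \<open>B = 0\<close> for the exterior
  walk, and \<open>m w = A / (2 * (w - a))\<close>, \<open>B = 2 / A\<close>, with \<open>A\<close> the area, for the interior walk.
\<close>

theorem density_inversion:
  fixes B z :: real and m :: "complex \<Rightarrow> complex" and m0 :: "real \<Rightarrow> real"
  assumes f: "profile f" and S: "finite S"
    and lip: "\<And>x. x \<in> {a<..<b} - S \<Longrightarrow> locally_lipschitz_at g x"
    and pos: "\<And>x. x \<in> {a<..<b} - S \<Longrightarrow> g x > 0"
    and transform: "\<And>w. Im w > 0 \<Longrightarrow> exp (- cauchy_int f w a b) =
      m w * (of_real B * (w - of_real z) - (LINT u:{a..b}|lborel. of_real (g u) / (w - of_real u)))"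
    and m: "\<And>x. a < x \<Longrightarrow> x < b \<Longrightarrow> isCont m (of_real x) \<and> m (of_real x) = of_real (m0 x) \<and> m0 x > 0"
    and x: "x \<in> {a<..<b} - S"
  shows "(f has_real_derivative
    arccot (1 / pi * (ln ((b - x) / (x - a)) + 1 / g x * (pv x + B * (x - z)))) / pi) (at x)"
proof -
  define \<theta> where "\<theta> x = arccot (1 / pi * (ln ((b - x) / (x - a)) + 1 / g x * (pv x + B * (x - z))))" for x
  \<comment> \<open>The boundary value of the exponential. The positive factor m0 cancels in the
    quotient of real and imaginary part, and the term with B is real.\<close>
  define \<Psi> where "\<Psi> x = of_real (m0 x) * (of_real (B * (x - z) + pv x + g x * ln ((b - x) / (x - a))) + \<i> * of_real (pi * g x))" for x
  have "(f has_real_derivative \<theta> x / pi) (at x)"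
  proof (rule profile_derivative[OF f, where U="{a<..<b} - S"])
    show "open ({a<..<b} - S)" using S by (intro open_Diff finite_imp_closed) auto
    fix y assume y: "y \<in> {a<..<b} - S"
    let ?w = "\<lambda>n. Complex y (inverse (real (Suc n)))"
    have wy: "?w \<longlonglongrightarrow> of_real y"
      using tendsto_Complex[OF tendsto_const LIMSEQ_inverse_real_of_nat] by (simp add: complex_of_real_def)
    have my: "isCont m (of_real y)" "m (of_real y) = of_real (m0 y)" "m0 y > 0" using m[of y] y by auto
    have "(\<lambda>n. m (?w n)) \<longlonglongrightarrow> of_real (m0 y)"
      using isCont_tendsto_compose[OF my(1) wy] my(2) by simp
    then have "(\<lambda>n. m (?w n) * (of_real B * (?w n - of_real z) - (LINT u:{a..b}|lborel. of_real (g u) / (?w n - of_real u))))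
      \<longlonglongrightarrow> of_real (m0 y) * (of_real B * (of_real y - of_real z) -
        (- of_real (pv y + g y * ln ((b - y) / (y - a))) - \<i> * of_real (pi * g y)))"
      using y lip by (intro tendsto_intros wy plemelj) auto
    then show "(\<lambda>n. exp (- cauchy_int f (?w n) a b)) \<longlonglongrightarrow> \<Psi> y"
      unfolding \<Psi>_def by (simp add: transform algebra_simps)
    show "Im (\<Psi> y) > 0" using my(3) pos[OF y] by (simp add: \<Psi>_def)
    have "Re (\<Psi> y) / Im (\<Psi> y) = (B * (y - z) + pv y + g y * ln ((b - y) / (y - a))) / (pi * g y)"
      using my(3) by (simp add: \<Psi>_def)
    also have "\<dots> = 1 / pi * (ln ((b - y) / (y - a)) + 1 / g y * (pv y + B * (y - z)))"
      using pos[OF y] by (simp add: field_simps)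
    finally show "arccot (Re (\<Psi> y) / Im (\<Psi> y)) = \<theta> y" unfolding \<theta>_def by (rule arg_cong)
  next
    have "isCont \<theta> y" if y: "y \<in> {a<..<b} - S" for y
    proof -
      have "isCont g y" using diff_quot_dominated[OF lip[OF y]] by blast
      then show ?thesis
        unfolding \<theta>_def arccot_eq using y pos[OF y] pv_continuous[OF lip[OF y]]
        by (intro continuous_intros) auto
    qed
    then show "continuous_on ({a<..<b} - S) \<theta>" by (simp add: continuous_at_imp_continuous_on)
  qed (use ab x in auto)
  then show ?thesis unfolding \<theta>_def .
qed

end

text \<open>The mean value inequality on an interval around x that avoids the finite exceptional
  set, with the bound on the derivative as constant.\<close>

lemma piecewise_C1_locally_lipschitz:
  assumes "piecewise_C1_bounded_deriv a b g"
  obtains S where "finite S" "\<And>x. x \<in> {a<..<b} - S \<Longrightarrow> locally_lipschitz_at g x"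
proof -
  obtain S where S: "finite S" "g C1_differentiable_on ({a..b} - S)" "bounded (deriv g ` ({a..b} - S))"
    using assms unfolding piecewise_C1_bounded_deriv_def by blast
  obtain D where D: "\<And>x. x \<in> {a..b} - S \<Longrightarrow> (g has_real_derivative D x) (at x)"
    using S(2) unfolding C1_differentiable_on_def has_real_derivative_iff_has_vector_derivative by blast
  obtain C where C: "\<And>x. x \<in> {a..b} - S \<Longrightarrow> \<bar>deriv g x\<bar> \<le> C"
    using S(3) unfolding bounded_iff real_norm_def by blast
  have "locally_lipschitz_at g x" if x: "x \<in> {a<..<b} - S" for x
  proof -
    have "open ({a<..<b} - S)" using S(1) by (intro open_Diff finite_imp_closed) auto
    then obtain \<delta> where \<delta>: "\<delta> > 0" "cball x \<delta> \<subseteq> {a<..<b} - S" using x open_contains_cball by blast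
    then have sub: "{x - \<delta>..x + \<delta>} \<subseteq> {a..b} - S" by (auto simp: cball_eq_atLeastAtMost subset_iff)
    have bd: "norm (g u - g v) \<le> C * norm (u - v)" if "u \<in> {x - \<delta>..x + \<delta>}" "v \<in> {x - \<delta>..x + \<delta>}" for u v
    proof (rule field_differentiable_bound[OF convex_closed_interval _ _ that])
      fix y assume "y \<in> {x - \<delta>..x + \<delta>}"
      then have y: "y \<in> {a..b} - S" using sub by blast
      show "(g has_field_derivative D y) (at y within {x - \<delta>..x + \<delta>})"
        using D[OF y] by (rule has_field_derivative_at_within)
      show "norm (D y) \<le> C" using C[OF y] DERIV_imp_deriv[OF D[OF y]] by simp
    qed
    then show ?thesis unfolding locally_lipschitz_at_def real_norm_def using \<delta>(1) by blast
  qed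
  then show ?thesis using that S(1) by blast
qed

section \<open>The kernel integrated over the domain\<close>

context profile_on
begin

text \<open>For fixed t the domain is an interval in v, all of whose points share the left foot
  \<open>lfoot t\<close>.\<close>

lemma dom_sheared_iff:
  "(t + v, v - t) \<in> dom \<longleftrightarrow> t \<in> {a - f a..b - f b} \<and> v \<in> {f (lfoot t)..f b}"
proof -
  note f' = profile_compl[OF f]
  have half: "(t + v + (v - t)) / 2 = v" "(t + v - (v - t)) / 2 = t" by simp_all
  show ?thesis
  proof
    assume p: "(t + v, v - t) \<in> dom"
    note d = p[unfolded dom_def mem_Collect_eq case_prod_conv half]
    have "t \<le> b - f b" using d profile_mono[OF f', of "t + v" b] by auto
    then have t: "t \<in> {a - f a..b - f b}" using d by auto
    have "lfoot t \<le> t + v" using d by (intro lfoot_lower) auto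
    then have "f (lfoot t) \<le> v" using f_lfoot[OF t] by simp
    then show "t \<in> {a - f a..b - f b} \<and> v \<in> {f (lfoot t)..f b}" using t d by auto
  next
    assume tv: "t \<in> {a - f a..b - f b} \<and> v \<in> {f (lfoot t)..f b}"
    then have l: "lfoot t - f (lfoot t) = t" by (intro f_lfoot) auto
    then have x: "lfoot t \<le> t + v" "t + v \<le> b" using tv by auto
    then have "t \<le> (t + v) - f (t + v)" using profile_mono[OF f' x(1)] l by simp
    then show "(t + v, v - t) \<in> dom"
      unfolding dom_def mem_Collect_eq case_prod_conv half using tv x lfoot_bounds[of t] by auto
  qed
qed

lemma dom_subset_box: "dom \<subseteq> {a..b} \<times> {f a - (b - f b)..f b - (a - f a)}"
proof
  fix p assume p: "p \<in> dom"
  obtain x y where xy: "p = (x, y)" by (cases p)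
  have "(x - y) / 2 + (x + y) / 2 = x" "(x + y) / 2 - (x - y) / 2 = y" by (simp_all add: field_simps)
  then obtain t v where tv: "x = t + v" "y = v - t" by metis
  have *: "t \<in> {a - f a..b - f b}" "v \<in> {f (lfoot t)..f b}"
    using p dom_sheared_iff[of t v] by (auto simp: xy tv)
  then have "f a \<le> v" using profile_mono[OF f lfoot_bounds(1)[of t]] by auto
  then show "p \<in> {a..b} \<times> {f a - (b - f b)..f b - (a - f a)}"
    using p * by (auto simp: xy tv dom_def)
qed

lemma emeasure_box_finite: "emeasure (lborel :: (real \<times> real) measure) ({p..q} \<times> {r..s}) < \<infinity>"
proof -
  have "emeasure (lborel \<Otimes>\<^sub>M lborel) ({p..q} \<times> {r..s}) = emeasure lborel {p..q} * emeasure lborel {r..s}"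
    by (rule lborel.emeasure_pair_measure_Times) auto
  then show ?thesis by (simp add: lborel_prod emeasure_lborel_Icc_eq ennreal_mult_less_top)
qed

lemma bounded_box_integrable:
  fixes k :: "real \<times> real \<Rightarrow> 'b :: {banach, second_countable_topology}"
  assumes k: "k \<in> borel_measurable borel" and "\<And>z. norm (k z) \<le> C"
    and "\<And>z. z \<notin> {p..q} \<times> {r..s} \<Longrightarrow> k z = 0"
  shows "integrable (lborel \<Otimes>\<^sub>M lborel) k"
  unfolding lborel_prod using assms emeasure_box_finite[of p q r s]
  by (intro integrableI_bounded_set[where A="{p..q} \<times> {r..s}" and B=C]) (auto intro: borel_Times)

text \<open>The factor 2 is the Jacobian of (t, v) -> (t + v, v - t). The change of variables is
  made one variable at a time, y = x - 2 t and then x = t + v, with Fubini in between.\<close>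

lemma shear_integral:
  fixes k :: "real \<times> real \<Rightarrow> 'b :: {banach, second_countable_topology}"
  assumes k [measurable]: "k \<in> borel_measurable borel" and C: "\<And>p. norm (k p) \<le> C"
    and dom: "\<And>p. p \<notin> dom \<Longrightarrow> k p = 0"
  shows "(LINT p|lborel. k p) = 2 *\<^sub>R (LINT t|lborel. (LINT v|lborel. k (t + v, v - t)))"
proof -
  have [measurable]: "k \<in> borel_measurable (borel \<Otimes>\<^sub>M borel)" using k by (simp add: borel_prod)
  have int: "integrable (lborel \<Otimes>\<^sub>M lborel) k"
    using dom dom_subset_box by (intro bounded_box_integrable[OF k C]) auto
  have int': "integrable (lborel \<Otimes>\<^sub>M lborel) (\<lambda>(x, t). k (x, x - 2 * t))"
  proof (rule bounded_box_integrable[where C=C and p=a and q=b and r="a - f a" and s="b - f b"])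
    show "(\<lambda>(x, t). k (x, x - 2 * t)) \<in> borel_measurable borel" unfolding borel_prod[symmetric] by measurable
    fix p :: "real \<times> real" assume p: "p \<notin> {a..b} \<times> {a - f a..b - f b}"
    obtain x t where xt: "p = (x, t)" by (cases p)
    have "(x, x - 2 * t) \<notin> dom"
      using p dom_sheared_iff[of t "x - t"] dom_subset_box by (auto simp: xt)
    then show "(case p of (x, t) \<Rightarrow> k (x, x - 2 * t)) = 0" by (simp add: xt dom)
  qed (auto simp: C split: prod.splits)
  have "(LINT p|lborel. k p) = (LINT x|lborel. (LINT y|lborel. k (x, y)))"
    using lborel_pair.integral_fst'[OF int] by (simp add: lborel_prod)
  also have "(\<lambda>x. LINT y|lborel. k (x, y)) = (\<lambda>x. 2 *\<^sub>R (LINT t|lborel. k (x, x - 2 * t)))"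
  proof
    fix x
    have "(LINT y|lborel. k (x, y)) = \<bar>-2\<bar> *\<^sub>R (LINT t|lborel. k (x, x + (-2) * t))"
      by (rule lborel_integral_real_affine) simp
    then show "(LINT y|lborel. k (x, y)) = 2 *\<^sub>R (LINT t|lborel. k (x, x - 2 * t))" by simp
  qed
  also have "(LINT x|lborel. 2 *\<^sub>R (LINT t|lborel. k (x, x - 2 * t))) =
    2 *\<^sub>R (LINT x|lborel. (LINT t|lborel. k (x, x - 2 * t)))"
    by (rule integral_scaleR_right)
  also have "(LINT x|lborel. (LINT t|lborel. k (x, x - 2 * t))) =
    (LINT t|lborel. (LINT x|lborel. k (x, x - 2 * t)))"
    using lborel_pair.Fubini_integral[OF int'] by simp
  also have "(\<lambda>t. LINT x|lborel. k (x, x - 2 * t)) = (\<lambda>t. LINT v|lborel. k (t + v, v - t))"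
  proof
    fix t
    have "(LINT x|lborel. k (x, x - 2 * t)) = \<bar>1\<bar> *\<^sub>R (LINT v|lborel. k (t + 1 * v, t + 1 * v - 2 * t))"
      by (rule lborel_integral_real_affine) simp
    then show "(LINT x|lborel. k (x, x - 2 * t)) = (LINT v|lborel. k (t + v, v - t))"
      by (simp add: algebra_simps)
  qed
  finally show ?thesis .
qed

text \<open>The integral over v is that of a leg with feet \<open>lfoot t\<close> and b, evaluated
  by \<open>harmonic_kernel_integral_right\<close>; the remaining integral over t is the other leg
  identity for the feet a and b.\<close>

lemma kern_dom_integral:
  assumes w: "Im w > 0"
  shows "(LINT p|lborel. indicator dom p *\<^sub>R kern w (feet p)) =
    2 * ((w - of_real (a - f a + f b)) - (w - of_real a) * exp (- cauchy_int f w a b))"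
proof -
  note [measurable] = kern_measurable[OF w]
  let ?k = "\<lambda>p. indicator dom p *\<^sub>R kern w (feet p)"
  let ?I = "{a - f a..b - f b}"
  have Ile: "a - f a \<le> b - f b" using profile_mono[OF profile_compl[OF f], of a b] ab by simp
  have C: "norm (?k p) \<le> exp ((b - a) / Im w) / Im w" for p
    using norm_kern_le[OF w, of "feet p"] w by (auto simp: indicator_def)
  have inner: "(LINT v|lborel. ?k (t + v, v - t)) =
    indicator ?I t *\<^sub>R (1 - (w - of_real b) * harmonic_kernel f w (lfoot t) b)" for t
  proof (cases "t \<in> ?I")
    case False
    then have "(t + v, v - t) \<notin> dom" for v by (auto simp: dom_sheared_iff)
    then show ?thesis using False by simp
  next
    case True
    have rf: "rfoot v \<in> {lfoot t..b} \<and> f (rfoot v) = v" if v: "v \<in> {f (lfoot t)..f b}" for v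
      using rfoot_upper[of "lfoot t" v] lfoot_bounds[of t] rfoot_bounds[of v] v
        profile_mono[OF f lfoot_bounds(1)[of t]] by (auto intro: f_rfoot)
    have "?k (t + v, v - t) = indicator {f (lfoot t)..f b} v *\<^sub>R harmonic_kernel f w (lfoot t) (rfoot v)" for v
    proof (cases "v \<in> {f (lfoot t)..f b}")
      case v: True
      then have "(t + v, v - t) \<in> dom" using True by (simp add: dom_sheared_iff)
      moreover have "feet (t + v, v - t) = (lfoot t, rfoot v)"
        by (simp add: feet_def lfoot_at_def rfoot_at_def)
      ultimately show ?thesis using v rf[OF v] lfoot_bounds[of t] by (simp add: kern_def)
    next
      case False
      then show ?thesis using True by (simp add: indicator_def dom_sheared_iff)
    qed
    then have "(LINT v|lborel. ?k (t + v, v - t)) =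
      (LINT v:{f (lfoot t)..f b}|lborel. harmonic_kernel f w (lfoot t) (rfoot v))"
      by (simp add: set_lebesgue_integral_def)
    also have "\<dots> = 1 - (w - of_real b) * harmonic_kernel f w (lfoot t) b"
      by (rule harmonic_kernel_integral_right[OF f w lfoot_bounds(2) rf])
    finally show ?thesis using True by simp
  qed
  have lf: "lfoot t \<in> {a..b} \<and> lfoot t - f (lfoot t) = t" if "t \<in> ?I" for t
    using that lfoot_bounds f_lfoot by auto
  have int: "set_integrable lborel ?I (\<lambda>t. harmonic_kernel f w (lfoot t) b)"
  proof -
    have "set_integrable lborel ?I (\<lambda>t. kern w (lfoot t, b))"
    proof (rule bounded_set_integrable(1))
      have "(\<lambda>t. (lfoot t, b)) \<in> borel \<rightarrow>\<^sub>M borel" unfolding borel_prod[symmetric] by measurable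
      then show "(\<lambda>t. kern w (lfoot t, b)) \<in> borel_measurable borel"
        by (rule measurable_compose) (rule kern_measurable[OF w])
    qed (rule norm_kern_le[OF w])
    moreover have "kern w (lfoot t, b) = harmonic_kernel f w (lfoot t) b" for t
      using lfoot_bounds[of t] by (simp add: kern_def)
    ultimately show ?thesis by simp
  qed
  have "(LINT p|lborel. ?k p) = 2 *\<^sub>R (LINT t|lborel. (LINT v|lborel. ?k (t + v, v - t)))"
    by (rule shear_integral[OF _ C]) auto
  also have "(LINT t|lborel. (LINT v|lborel. ?k (t + v, v - t))) =
    (LINT t:?I|lborel. 1 - (w - of_real b) * harmonic_kernel f w (lfoot t) b)"
    unfolding inner set_lebesgue_integral_def ..
  also have "\<dots> = (LINT t:?I|lborel. 1) - (LINT t:?I|lborel. (w - of_real b) * harmonic_kernel f w (lfoot t) b)"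
  proof (rule set_integral_diff(2))
    show "set_integrable lborel ?I (\<lambda>t. 1 :: complex)" by (intro borel_integrable_atLeastAtMost') auto
    show "set_integrable lborel ?I (\<lambda>t. (w - of_real b) * harmonic_kernel f w (lfoot t) b)"
      by (rule set_integrable_mult_right) (rule int)
  qed
  also have "(LINT t:?I|lborel. (1::complex)) = of_real ((b - f b) - (a - f a))"
    using Ile by (simp add: set_lebesgue_integral_def scaleR_conv_of_real)
  also have "(LINT t:?I|lborel. (w - of_real b) * harmonic_kernel f w (lfoot t) b) =
    (w - of_real b) * ((w - of_real a) * harmonic_kernel f w a b - 1)"
    unfolding set_integral_mult_right using harmonic_kernel_integral_left[OF f w _ lf] ab by simp
  also have "\<dots> = (w - of_real a) * exp (- cauchy_int f w a b) - (w - of_real b)"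
    using minus_of_real_nz[OF w, of b] by (simp add: harmonic_kernel_def right_diff_distrib)
  finally show ?thesis by (simp add: scaleR_conv_of_real algebra_simps)
qed

lemma feet_apex:
  assumes "(x - y) / 2 = a - f a" "(x + y) / 2 = f b"
  shows "(x, y) \<in> dom" "feet (x, y) = (a, b)"
proof -
  have "(x - y) / 2 + (x + y) / 2 = x" "(x + y) / 2 - (x - y) / 2 = y" by (simp_all add: field_simps)
  then have xy: "x = (a - f a) + f b" "y = f b - (a - f a)" using assms by simp_all
  have "lfoot (a - f a) = a" "rfoot (f b) = b"
    using lfoot_lower[of a "a - f a"] rfoot_upper[of b "f b"] lfoot_bounds[of "a - f a"] rfoot_bounds[of "f b"] ab
    by auto
  then show "feet (x, y) = (a, b)" by (simp add: feet_def lfoot_at_def rfoot_at_def assms)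
  show "(x, y) \<in> dom"
    unfolding xy dom_sheared_iff using \<open>lfoot (a - f a) = a\<close> ab
      profile_mono[OF profile_compl[OF f], of a b] profile_mono[OF f, of a b] by simp
qed

end

section \<open>Transition measures\<close>

text \<open>Clamping the argument extends \<open>\<omega>\<close> by constants, so that the profile
  is monotone on the whole line, as the Stieltjes measure requires.\<close>

definition half_profile :: "real \<Rightarrow> real \<Rightarrow> (real \<Rightarrow> real) \<Rightarrow> real \<Rightarrow> real" where
  "half_profile a b \<omega> x = (x + \<omega> (max a (min b x))) / 2"

lemma half_profile_eq: "x \<in> {a..b} \<Longrightarrow> half_profile a b \<omega> x = (x + \<omega> x) / 2"
  by (simp add: half_profile_def max_absorb2 min_absorb2)

lemma profile_half_profile:
  assumes "a \<le> b" and lip: "1-lipschitz_on {a..b} \<omega>"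
  shows "profile (half_profile a b \<omega>)"
proof -
  have "\<bar>\<omega> (max a (min b y)) - \<omega> (max a (min b x))\<bar> \<le> y - x" if "x \<le> y" for x y
  proof -
    have "\<bar>\<omega> (max a (min b y)) - \<omega> (max a (min b x))\<bar> \<le> \<bar>max a (min b y) - max a (min b x)\<bar>"
      using lipschitz_onD[OF lip, of "max a (min b y)" "max a (min b x)"] \<open>a \<le> b\<close> by (simp add: dist_real_def)
    also have "\<dots> \<le> y - x" using that by (simp add: max_def min_def)
    finally show ?thesis .
  qed
  note * = this
  show ?thesis
    unfolding profile_def half_profile_def
  proof (intro conjI monoI)
    fix x y :: real assume "x \<le> y"
    from *[OF this] show "(x + \<omega> (max a (min b x))) / 2 \<le> (y + \<omega> (max a (min b y))) / 2"
      "x - (x + \<omega> (max a (min b x))) / 2 \<le> y - (y + \<omega> (max a (min b y))) / 2"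
      by (simp_all add: abs_le_iff field_simps)
  qed
qed

lemma dom_half_profile:
  assumes "profile_on a b (half_profile a b \<omega>)"
  shows "profile_on.dom a b (half_profile a b \<omega>) = dual_domain a b \<omega>"
proof -
  interpret profile_on a b "half_profile a b \<omega>" by fact
  show ?thesis
    using ab by (auto simp: dom_def dual_domain_def half_profile_eq field_simps)
qed

lemma markov_chain_two_step:
  assumes "markov_chain M \<mu> K X" and A: "A \<in> sets borel" and B: "B \<in> sets borel"
  shows "emeasure M {s \<in> space M. X n s \<in> A \<and> X (Suc n) s \<in> B} =
    (\<integral>\<^sup>+ s. indicator A (X n s) * emeasure (K (X n s)) B \<partial>M)"
proof -
  \<comment> \<open>The cylinder over \<open>A\<close> that looks at the last position only.\<close>
  define A' where "A' = {h \<in> space (\<Pi>\<^sub>M i\<in>{..n}. borel). h n \<in> A}"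
  have "A' \<in> sets (\<Pi>\<^sub>M i\<in>{..n}. borel)"
    using measurable_sets[OF measurable_component_singleton[of n "{..n}" "\<lambda>_. borel"] A]
    by (simp add: A'_def vimage_def Int_def conj_commute)
  then have "emeasure M {s \<in> space M. (\<lambda>i\<in>{..n}. X i s) \<in> A' \<and> X (Suc n) s \<in> B} =
    (\<integral>\<^sup>+ s. indicator A' (\<lambda>i\<in>{..n}. X i s) * emeasure (K (X n s)) B \<partial>M)"
    using assms unfolding markov_chain_def by blast
  moreover have "(\<lambda>i\<in>{..n}. X i s) \<in> A' \<longleftrightarrow> X n s \<in> A" for s
    by (simp add: A'_def space_PiM)
  ultimately show ?thesis by (simp add: indicator_def)
qed

lemma sets_arc_uniform [simp]: "sets (arc_uniform \<gamma> H) = sets borel"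
  by (simp add: arc_uniform_def)

lemma density_on_integral:
  assumes \<mu>: "has_density_on \<mu> a b g" and "prob_space \<mu>"
  shows "set_integrable lborel {a..b} g"
    and "Im w > 0 \<Longrightarrow> (LINT x|\<mu>. 1 / (w - of_real x)) = (LINT u:{a..b}|lborel. of_real (g u) / (w - of_real u))"
proof -
  interpret prob_space \<mu> by fact
  let ?G = "\<lambda>x. indicator {a..b} x *\<^sub>R g x"
  have nn: "0 \<le> ?G x" for x using \<mu> by (auto simp: has_density_on_def indicator_def)
  have eq: "ennreal (g x) * indicator {a..b} x = ennreal (?G x)" for x by (auto simp: indicator_def)
  have \<mu>': "\<mu> = density lborel (\<lambda>x. ennreal (?G x))"
    and "(\<lambda>x. ennreal (?G x)) \<in> borel_measurable lborel"
    using \<mu> unfolding has_density_on_def eq by auto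
  \<comment> \<open>Measurability is given for the \<open>ennreal\<close> density only;
    nonnegativity allows passing back to the real one. Integrability then follows from total mass
    1.\<close>
  then have "(\<lambda>x. enn2real (ennreal (?G x))) \<in> borel_measurable lborel" by measurable
  then have G: "?G \<in> borel_measurable lborel" using nn by simp
  have "(\<integral>\<^sup>+x. ennreal (?G x) \<partial>lborel) = emeasure \<mu> (space \<mu>)"
    using G by (simp add: \<mu>' emeasure_density)
  then have "integrable lborel ?G"
    using G nn by (intro integrableI_nonneg) (auto simp: emeasure_space_1)
  then show "set_integrable lborel {a..b} g" by (simp add: set_integrable_def)
  have [measurable]: "(\<lambda>x. 1 / (w - complex_of_real x)) \<in> borel_measurable lborel" by measurable
  show "(LINT x|\<mu>. 1 / (w - of_real x)) = (LINT u:{a..b}|lborel. of_real (g u) / (w - of_real u))"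
    unfolding \<mu>' set_lebesgue_integral_def using G nn
    by (subst integral_density) (auto simp: scaleR_conv_of_real)
qed

lemma measurable_fst_lim:
  fixes X :: "nat \<Rightarrow> 's \<Rightarrow> real \<times> real"
  assumes [measurable]: "\<And>n. X n \<in> borel_measurable M"
  shows "(\<lambda>s. fst (lim (\<lambda>n. X n s))) \<in> borel_measurable M"
proof -
  have "(\<lambda>s. lim (\<lambda>n. X n s)) \<in> borel_measurable M" by measurable
  then have "(\<lambda>s. lim (\<lambda>n. X n s)) \<in> M \<rightarrow>\<^sub>M borel \<Otimes>\<^sub>M borel" by (simp add: borel_prod)
  then show ?thesis by measurable
qed

lemma exterior_transform:
  assumes "a < b" and \<omega>: "\<omega> \<in> diagrams a b" and \<mu>: "is_exterior_transition_measure a b \<omega> \<mu>"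
    and w: "Im w > 0"
  shows "prob_space \<mu>"
    and "(LINT x|\<mu>. 1 / (w - of_real x)) = exp (- cauchy_int (half_profile a b \<omega>) w a b) / (w - of_real b)"
proof -
  let ?f = "half_profile a b \<omega>" and ?apex = "(b - \<omega> a, \<omega> a + \<omega> b)"
  obtain M :: "(nat \<Rightarrow> real \<times> real) measure" and X where
    walk: "markov_chain M (return borel ?apex) (exterior_step a b \<omega>) X"
    and \<mu>: "\<mu> = distr M borel (\<lambda>s. fst (lim (\<lambda>n. X n s)))"
    using \<mu> unfolding is_exterior_transition_measure_def exterior_walk_def by blast
  interpret prob_space M using walk by (simp add: markov_chain_def)
  have X [measurable]: "X n \<in> borel_measurable M" for n using walk by (simp add: markov_chain_def)
  interpret profile_on a b ?f
    using assms profile_half_profile[of a b \<omega>] by unfold_locales (auto simp: diagrams_def)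
  have dom: "dom = dual_domain a b \<omega>" by (rule dom_half_profile) unfold_locales
  have c: "a + \<omega> a = b - \<omega> b" using \<omega> by (simp add: diagrams_def)
  have apex: "?apex \<in> dom" "feet ?apex = (a, b)"
    using c ab by (intro feet_apex; simp add: half_profile_eq field_simps)+
  have X0: "AE s in M. X 0 s = ?apex"
  proof -
    have law: "distr M borel (X 0) = return borel ?apex" using walk by (simp add: markov_chain_def)
    have "AE p in distr M borel (X 0). p = ?apex" unfolding law by (subst AE_return) auto
    then show ?thesis by (subst (asm) AE_distr_iff) auto
  qed
  interpret hook_walk a b ?f M X "exterior_step a b \<omega>"
  proof unfold_locales
    show "AE s in M. X 0 s \<in> dom" using X0 by eventually_elim (simp add: apex)
    show "exterior_step a b \<omega> p = distr unit_uniform borel (hook_point p)" if p: "p \<in> dom" for p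
    proof -
      obtain x y where xy: "p = (x, y)" by (cases p)
      have "exterior_step a b \<omega> (x, y) = distr unit_uniform borel
        (\<lambda>\<theta>. leg_point p (lfoot_at p + \<theta> * (rfoot_at p - lfoot_at p)))"
        unfolding exterior_step_def case_prod_conv
      proof (rule arc_uniform_eq_distr)
        show "(x + t / sqrt 2, y - \<bar>t\<bar> / sqrt 2) = leg_point p (x + t / sqrt 2)" for t
          by (simp add: leg_point_def xy)
        \<comment> \<open>A point of this curve automatically satisfies the equations of the hook,
          so only membership in the domain remains.\<close>
        have "leg_point p u \<in> exterior_hook a b \<omega> (x, y) \<longleftrightarrow> leg_point p u \<in> dual_domain a b \<omega>" for u
          by (auto simp: exterior_hook_def leg_point_def xy)
        then show "leg_point p u \<in> exterior_hook a b \<omega> (x, y) \<longleftrightarrow> lfoot_at p \<le> u \<and> u \<le> rfoot_at p" for u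
          using leg_point_in_dom_iff[OF p] dom by simp
        show "leg_point p \<in> borel \<rightarrow>\<^sub>M borel" unfolding leg_point_def borel_prod[symmetric] by measurable
      qed (use dom_feet[OF p] xy in auto)
      then show ?thesis by (simp add: xy hook_point_def[abs_def])
    qed
  qed (use X markov_chain_two_step[OF walk] in auto)
  note lim = measurable_fst_lim[OF X]
  show "prob_space \<mu>" unfolding \<mu> by (rule prob_space_distr[OF lim])
  have "(LINT x|\<mu>. 1 / (w - of_real x)) = (LINT s|M. 1 / (w - of_real (fst (lim (\<lambda>n. X n s)))))"
    unfolding \<mu> using lim by (subst integral_distr) auto
  also have "\<dots> = (LINT s|M. kern w (feet (X 0 s)))" by (rule cauchy_transform_limit[OF w])
  also have "\<dots> = (LINT s|M. kern w (feet ?apex))"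
    using kern_measurable[OF w] X0 by (intro integral_cong_AE) (auto elim: eventually_mono)
  also have "\<dots> = harmonic_kernel ?f w a b" using ab by (simp add: apex kern_def prob_space)
  finally show "(LINT x|\<mu>. 1 / (w - of_real x)) = exp (- cauchy_int ?f w a b) / (w - of_real b)"
    by (simp add: harmonic_kernel_def)
qed

lemma emeasure_diagram_domain:
  assumes "a < b" and \<omega>: "\<omega> \<in> diagrams a b" and D: "diagram_domain a b \<omega> \<in> sets borel"
  shows "emeasure lborel (diagram_domain a b \<omega>) = ennreal (area a b \<omega>)" "0 \<le> area a b \<omega>"
proof -
  let ?z = "center a \<omega>"
  have lip: "1-lipschitz_on {a..b} \<omega>" and c: "a + \<omega> a = b - \<omega> b" using \<omega> by (auto simp: diagrams_def)
  \<comment> \<open>The Lipschitz bounds from a and from b give \<omega> x \<ge> z - x and \<omega>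
    x \<ge> x - z, where z is the center.\<close>
  have nn: "\<bar>x - ?z\<bar> \<le> \<omega> x" if "x \<in> {a..b}" for x
    using lipschitz_onD[OF lip, of x a] lipschitz_onD[OF lip, of x b] that c \<open>a < b\<close>
    by (auto simp: dist_real_def center_def abs_le_iff)
  have int: "set_integrable lborel {a..b} (\<lambda>x. \<omega> x - \<bar>x - ?z\<bar>)"
    by (intro borel_integrable_atLeastAtMost' continuous_intros lipschitz_on_continuous_on[OF lip])
  show "0 \<le> area a b \<omega>"
    unfolding area_def set_lebesgue_integral_def
    using nn by (intro Bochner_Integration.integral_nonneg) (auto simp: indicator_def)
  have "emeasure lborel (diagram_domain a b \<omega>) = emeasure (lborel \<Otimes>\<^sub>M lborel) (diagram_domain a b \<omega>)"
    by (simp add: lborel_prod)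
  also have "\<dots> = (\<integral>\<^sup>+x. emeasure lborel (Pair x -` diagram_domain a b \<omega>) \<partial>lborel)"
    using D by (intro lborel.emeasure_pair_measure_alt) (simp only: lborel_prod sets_lborel)
  also have "\<dots> = (\<integral>\<^sup>+x. ennreal (indicator {a..b} x *\<^sub>R (\<omega> x - \<bar>x - ?z\<bar>)) \<partial>lborel)"
  proof (rule nn_integral_cong)
    fix x
    show "emeasure lborel (Pair x -` diagram_domain a b \<omega>) = ennreal (indicator {a..b} x *\<^sub>R (\<omega> x - \<bar>x - ?z\<bar>))"
    proof (cases "x \<in> {a..b}")
      case True
      then have "Pair x -` diagram_domain a b \<omega> = {\<bar>x - ?z\<bar>..\<omega> x}" by (auto simp: diagram_domain_def)
      then show ?thesis using nn[OF True] True by simp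
    next
      case False
      then have "Pair x -` diagram_domain a b \<omega> = {}" by (auto simp: diagram_domain_def)
      then show ?thesis using False by simp
    qed
  qed
  also have "\<dots> = ennreal (area a b \<omega>)"
    using int nn unfolding area_def set_lebesgue_integral_def set_integrable_def
    by (intro nn_integral_eq_integral) (auto simp: indicator_def)
  finally show "emeasure lborel (diagram_domain a b \<omega>) = ennreal (area a b \<omega>)" .
qed

text \<open>
  Reflection in the \<open>x\<close>-axis turns the interior walk of \<open>\<omega>\<close> into an exterior walk for \<open>- \<omega>\<close>,
  since for the center \<open>z\<close> of \<open>\<omega>\<close> we have
  \<open>- \<bar>x - z\<bar> = min (- \<omega> a + x - a) (- \<omega> b + b - x)\<close>.
\<close>

lemma interior_transform:
  assumes "a < b" and \<omega>: "\<omega> \<in> diagrams a b" and \<mu>: "is_interior_transition_measure a b \<omega> \<mu>"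
    and w: "Im w > 0"
  defines "f \<equiv> half_profile a b (\<lambda>x. - \<omega> x)"
  shows "prob_space \<mu>" "area a b \<omega> > 0"
    and "(LINT x|\<mu>. 1 / (w - of_real x)) = of_real (2 / area a b \<omega>) *
      ((w - of_real (center a \<omega>)) - (w - of_real a) * exp (- cauchy_int f w a b))"
proof -
  let ?D = "diagram_domain a b \<omega>" and ?A = "area a b \<omega>"
  define R :: "real \<times> real \<Rightarrow> real \<times> real" where "R p = (fst p, - snd p)" for p
  have RR [simp]: "R (R p) = p" for p by (simp add: R_def)
  have R [measurable]: "R \<in> borel \<rightarrow>\<^sub>M borel" unfolding R_def[abs_def] borel_prod[symmetric] by measurable
  obtain M :: "(nat \<Rightarrow> real \<times> real) measure" and X where
    walk: "markov_chain M (uniform_measure lborel ?D) (interior_step a b \<omega>) X"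
    and \<mu>: "\<mu> = distr M borel (\<lambda>s. fst (lim (\<lambda>n. X n s)))"
    using \<mu> unfolding is_interior_transition_measure_def interior_walk_def by blast
  interpret prob_space M using walk by (simp add: markov_chain_def)
  have X [measurable]: "X n \<in> borel_measurable M" for n using walk by (simp add: markov_chain_def)
  have lip: "1-lipschitz_on {a..b} \<omega>" and c: "a + \<omega> a = b - \<omega> b" using \<omega> by (auto simp: diagrams_def)
  interpret profile_on a b f
    unfolding f_def using \<open>a < b\<close> profile_half_profile[of a b "\<lambda>x. - \<omega> x"] lip
    by unfold_locales (auto intro: lipschitz_on_minus)
  have "dom = dual_domain a b (\<lambda>x. - \<omega> x)"
    unfolding f_def by (rule dom_half_profile) (use profile_on_axioms f_def in simp)
  then have dom: "p \<in> dom \<longleftrightarrow> R p \<in> ?D" for p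
    using c by (cases p) (simp add: dual_domain_def diagram_domain_def R_def center_def abs_le_iff, linarith)
  have D_eq: "?D = R -` dom" by (intro set_eqI) (simp add: dom)
  then have D [measurable]: "?D \<in> sets borel" using measurable_sets_borel[OF R dom_measurable] by simp
  note area = emeasure_diagram_domain[OF \<open>a < b\<close> \<omega> D]
  have law0: "distr M borel (X 0) = uniform_measure lborel ?D" using walk by (simp add: markov_chain_def)
  \<comment> \<open>Zero area would make the starting law the null measure, whereas
    \<open>X 0\<close> has a law of mass 1.\<close>
  show A: "?A > 0"
  proof (rule ccontr)
    assume "\<not> 0 < ?A"
    then have "emeasure lborel ?D = 0" using area by simp
    then have "emeasure (uniform_measure lborel ?D) UNIV = 0" by simp
    moreover have "emeasure (distr M borel (X 0)) UNIV = 1"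
      using emeasure_space_1 by (simp add: emeasure_distr)
    ultimately show False unfolding law0 by simp
  qed
  have X0: "AE s in M. X 0 s \<in> ?D"
  proof -
    have "AE p in distr M borel (X 0). p \<in> ?D" unfolding law0 by (intro AE_uniform_measureI) auto
    then show ?thesis by (subst (asm) AE_distr_iff) auto
  qed
  have step: "sets (interior_step a b \<omega> p) = sets borel" for p by (cases p) (simp add: interior_step_def)
  \<comment> \<open>The walk and its kernel are both conjugated by the reflection
    \<open>R\<close>.\<close>
  interpret hook_walk a b f M "\<lambda>n s. R (X n s)" "\<lambda>p. distr (interior_step a b \<omega> (R p)) borel R"
  proof unfold_locales
    show "(\<lambda>s. R (X n s)) \<in> borel_measurable M" for n by measurable
    show "AE s in M. R (X 0 s) \<in> dom" using X0 by eventually_elim (simp add: dom)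
    fix n and A B :: "(real \<times> real) set" assume A: "A \<in> sets borel" and B: "B \<in> sets borel"
    have "emeasure (distr (interior_step a b \<omega> p) borel R) B = emeasure (interior_step a b \<omega> p) (R -` B)" for p
      using B R step[of p] by (subst emeasure_distr) (auto cong: measurable_cong_sets dest: sets_eq_imp_space_eq)
    moreover have "{s \<in> space M. R (X n s) \<in> A \<and> R (X (Suc n) s) \<in> B} =
      {s \<in> space M. X n s \<in> R -` A \<and> X (Suc n) s \<in> R -` B}" by auto
    moreover have "indicator A (R (X n s)) = (indicator (R -` A) (X n s) :: ennreal)" for s by (simp add: indicator_def)
    ultimately show "emeasure M {s \<in> space M. R (X n s) \<in> A \<and> R (X (Suc n) s) \<in> B} =
      (\<integral>\<^sup>+ s. indicator A (R (X n s)) * emeasure (distr (interior_step a b \<omega> (R (R (X n s)))) borel R) B \<partial>M)"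
      using markov_chain_two_step[OF walk measurable_sets_borel[OF R A] measurable_sets_borel[OF R B]] by simp
  next
    fix p assume p: "p \<in> dom"
    obtain x y where xy: "p = (x, y)" by (cases p)
    have Rm: "(\<lambda>u. R (leg_point p u)) \<in> borel \<rightarrow>\<^sub>M borel"
      unfolding R_def leg_point_def borel_prod[symmetric] by measurable
    have "interior_step a b \<omega> (R p) = distr unit_uniform borel
        (\<lambda>\<theta>. R (leg_point p (lfoot_at p + \<theta> * (rfoot_at p - lfoot_at p))))"
      unfolding interior_step_def xy R_def[of "(x, y)"] case_prod_conv fst_conv snd_conv
    proof (rule arc_uniform_eq_distr)
      show "(x + t / sqrt 2, - y + \<bar>t\<bar> / sqrt 2) = R (leg_point (x, y) (x + t / sqrt 2))" for t
        by (simp add: leg_point_def R_def)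
      have "R (leg_point p u) \<in> interior_hook a b \<omega> (x, - y) \<longleftrightarrow> R (leg_point p u) \<in> ?D" for u
        by (auto simp: interior_hook_def leg_point_def R_def xy)
      then show "R (leg_point (x, y) u) \<in> interior_hook a b \<omega> (x, - y) \<longleftrightarrow> lfoot_at (x, y) \<le> u \<and> u \<le> rfoot_at (x, y)" for u
        using leg_point_in_dom_iff[OF p] dom xy by simp
    qed (use dom_feet[OF p] xy Rm in auto)
    then have "distr (interior_step a b \<omega> (R p)) borel R =
      distr (distr unit_uniform borel (\<lambda>\<theta>. R (hook_point p \<theta>))) borel R"
      by (simp add: hook_point_def)
    also have "\<dots> = distr unit_uniform borel (hook_point p)"
      using hook_point_measurable(2)[of p] R
      by (subst distr_distr) (auto simp: o_def cong: measurable_cong_sets intro: measurable_compose)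
    finally show "distr (interior_step a b \<omega> (R p)) borel R = distr unit_uniform borel (hook_point p)" .
  qed
  note lim = measurable_fst_lim[OF X]
  show "prob_space \<mu>" unfolding \<mu> by (rule prob_space_distr[OF lim])
  \<comment> \<open>Reflection keeps the first coordinate of a limit, but \<open>lim\<close> is
    unspecified on divergent paths, hence the detour through almost sure convergence.\<close>
  have conv: "AE s in M. fst (lim (\<lambda>n. X n s)) = fst (lim (\<lambda>n. R (X n s)))"
    using X_converges
  proof eventually_elim
    case (elim s)
    then obtain p where p: "(\<lambda>n. R (X n s)) \<longlonglongrightarrow> p" by blast
    then have "(\<lambda>n. R (R (X n s))) \<longlonglongrightarrow> R p"
      unfolding R_def[of "R _"] R_def[of p] by (intro tendsto_intros)
    then show ?case using limI[OF p] limI[of "\<lambda>n. X n s"] by (simp add: R_def)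
  qed
  note kern_measurable[OF w, measurable]
  have "(LINT x|\<mu>. 1 / (w - of_real x)) = (LINT s|M. 1 / (w - of_real (fst (lim (\<lambda>n. X n s)))))"
    unfolding \<mu> using lim by (subst integral_distr) auto
  also have "\<dots> = (LINT s|M. 1 / (w - of_real (fst (lim (\<lambda>n. R (X n s))))))"
    using conv lim measurable_fst_lim[of "\<lambda>n s. R (X n s)" M]
    by (intro integral_cong_AE) (auto elim: eventually_mono)
  also have "\<dots> = (LINT s|M. kern w (feet (R (X 0 s))))" by (rule cauchy_transform_limit[OF w])
  also have "\<dots> = (LINT p|uniform_measure lborel ?D. kern w (feet (R p)))"
    unfolding law0[symmetric] by (subst integral_distr) auto
  also have "\<dots> = (LINT p|lborel. (indicator ?D p / ?A) *\<^sub>R kern w (feet (R p)))"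
  proof -
    have "indicator ?D p / emeasure lborel ?D = ennreal (indicator ?D p / ?A)" for p
      using A by (simp add: area(1) indicator_def divide_ennreal[symmetric])
    then show ?thesis
      unfolding uniform_measure_def using A by (simp, subst integral_density) auto
  qed
  also have "\<dots> = (1 / ?A) *\<^sub>R (LINT p|lborel. indicator ?D p *\<^sub>R kern w (feet (R p)))"
    by (subst integral_scaleR_right[symmetric]) simp
  also have "(LINT p|lborel. indicator ?D p *\<^sub>R kern w (feet (R p))) = (LINT p|lborel. indicator dom p *\<^sub>R kern w (feet p))"
  proof -
    let ?k = "\<lambda>p. indicator dom p *\<^sub>R kern w (feet p)"
    have C: "norm (?k p) \<le> exp ((b - a) / Im w) / Im w" for p
      using norm_kern_le[OF w, of "feet p"] w by (auto simp: indicator_def)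
    have km: "?k \<in> borel_measurable borel" by measurable
    have int: "integrable (lborel \<Otimes>\<^sub>M lborel) ?k"
    proof (rule bounded_box_integrable[OF km C])
      fix p assume "p \<notin> {a..b} \<times> {f a - (b - f b)..f b - (a - f a)}"
      then have "p \<notin> dom" using dom_subset_box by blast
      then show "?k p = 0" by simp
    qed
    have int': "integrable (lborel \<Otimes>\<^sub>M lborel) (\<lambda>p. ?k (R p))"
    proof (rule bounded_box_integrable[OF _ C])
      show "(\<lambda>p. ?k (R p)) \<in> borel_measurable borel" by measurable
      fix p assume "p \<notin> {a..b} \<times> {- (f b - (a - f a))..- (f a - (b - f b))}"
      then have "R p \<notin> dom" using dom_subset_box by (cases p) (force simp: R_def)
      then show "?k (R p) = 0" by simp
    qed
    have "(LINT p|lborel. indicator ?D p *\<^sub>R kern w (feet (R p))) = (LINT p|lborel. ?k (R p))"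
      by (simp add: dom indicator_def)
    also have "\<dots> = (LINT x|lborel. (LINT y|lborel. ?k (x, - y)))"
      using lborel_pair.integral_fst'[OF int'] by (simp add: lborel_prod R_def)
    also have "\<dots> = (LINT x|lborel. (LINT y|lborel. ?k (x, y)))"
    proof -
      have "(LINT y|lborel. ?k (x, y)) = \<bar>-1\<bar> *\<^sub>R (LINT y|lborel. ?k (x, 0 + (-1) * y))" for x
        by (rule lborel_integral_real_affine) simp
      then show ?thesis by simp
    qed
    also have "\<dots> = (LINT p|lborel. ?k p)"
      using lborel_pair.integral_fst'[OF int] by (simp add: lborel_prod)
    finally show ?thesis .
  qed
  also have "\<dots> = 2 * ((w - of_real (a - f a + f b)) - (w - of_real a) * exp (- cauchy_int f w a b))"
    by (rule kern_dom_integral[OF w])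
  \<comment> \<open>As \<open>f\<close> belongs to -\<omega>, both \<open>a - f a\<close> = (a +
    \<omega> a) / 2 and \<open>f b\<close> = (b - \<omega> b) / 2 are half the center.\<close>
  also have "a - f a + f b = center a \<omega>"
    using c ab by (simp add: f_def half_profile_eq center_def field_simps)
  finally show "(LINT x|\<mu>. 1 / (w - of_real x)) = of_real (2 / ?A) *
      ((w - of_real (center a \<omega>)) - (w - of_real a) * exp (- cauchy_int f w a b))"
    by (simp add: scaleR_conv_of_real)
qed

section \<open>From the derivative of the profile to that of the diagram\<close>

lemma half_profile_derivative:
  assumes D: "(half_profile a b \<omega> has_real_derivative D) (at x)" and x: "a < x" "x < b"
  shows "(\<omega> has_real_derivative 2 * D - 1) (at x)"
proof -
  have "((\<lambda>y. 2 * half_profile a b \<omega> y - y) has_real_derivative 2 * D - 1) (at x)"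
    by (intro DERIV_diff DERIV_cmult D DERIV_ident)
  then show ?thesis
  proof (rule has_field_derivative_transform_within_open)
    show "open {a<..<b}" by simp
  qed (use x in \<open>auto simp: half_profile_eq add_divide_distrib\<close>)
qed

lemma AE_interval_minus_finite:
  assumes "finite S" and "\<And>x. x \<in> {a<..<b} - S \<Longrightarrow> P x"
  shows "AE x in lborel. x \<in> {a..b::real} \<longrightarrow> P x"
proof -
  have "S \<union> {a, b} \<in> null_sets lborel" using assms(1) by (intro finite_imp_null_set_lborel) auto
  then have "AE x in lborel. x \<notin> S \<union> {a, b}" by (rule AE_not_in)
  then show ?thesis by eventually_elim (use assms(2) in auto)
qed

theorem theorem3:
  fixes a b :: real and \<omega> :: "real \<Rightarrow> real"
  assumes "a < b"
    and "\<omega> \<in> diagrams a b"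
  shows
    "(\<forall>(\<mu> :: real measure) (g :: real \<Rightarrow> real).
        is_exterior_transition_measure a b \<omega> \<mu> \<longrightarrow>
        has_density_on \<mu> a b g \<longrightarrow>
        piecewise_C1_bounded_deriv a b g \<longrightarrow>
        bounded_away_from_0 a b g \<longrightarrow>
        (AE x in lborel. x \<in> {a..b} \<longrightarrow>
           (\<omega> has_real_derivative
              (- 1 + 2 / pi * arccot (1 / pi *
                 (ln ((b - x) / (x - a)) +
                  1 / g x * (LINT u:{a..b}|lborel. (g u - g x) / (u - x)))))) (at x)))
     \<and>
     (\<forall>(\<mu> :: real measure) (h :: real \<Rightarrow> real).
        is_interior_transition_measure a b \<omega> \<mu> \<longrightarrow>
        has_density_on \<mu> a b h \<longrightarrow>
        piecewise_C1_bounded_deriv a b h \<longrightarrow>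
        bounded_away_from_0 a b h \<longrightarrow>
        (AE x in lborel. x \<in> {a..b} \<longrightarrow>
           (\<omega> has_real_derivative
              (1 - 2 / pi * arccot (1 / pi *
                 (ln ((b - x) / (x - a)) +
                  1 / h x * ((LINT u:{a..b}|lborel. (h u - h x) / (u - x)) +
                             2 * (x - center a \<omega>) / area a b \<omega>))))) (at x)))"
proof (intro conjI allI impI)
  fix \<mu> and g
  assume \<mu>: "is_exterior_transition_measure a b \<omega> \<mu>" and g: "has_density_on \<mu> a b g"
    and C1: "piecewise_C1_bounded_deriv a b g" and pos: "bounded_away_from_0 a b g"
  let ?f = "half_profile a b \<omega>"
  have lip: "1-lipschitz_on {a..b} \<omega>" using \<open>\<omega> \<in> diagrams a b\<close> by (simp add: diagrams_def)
  have f: "profile ?f" using \<open>a < b\<close> lip by (intro profile_half_profile) auto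
  note tr = exterior_transform[OF \<open>a < b\<close> \<open>\<omega> \<in> diagrams a b\<close> \<mu>]
  \<comment> \<open>All conclusions of \<open>tr\<close> carry the assumption Im w > 0; the
    imaginary unit discharges it where w does not occur.\<close>
  have "prob_space \<mu>" by (rule tr(1)[of \<i>]) simp
  note dens = density_on_integral[OF g this]
  obtain S where S: "finite S" and loc: "\<And>x. x \<in> {a<..<b} - S \<Longrightarrow> locally_lipschitz_at g x"
    using piecewise_C1_locally_lipschitz[OF C1] by blast
  have g_pos: "g x > 0" if "x \<in> {a<..<b} - S" for x
    using pos that unfolding bounded_away_from_0_def by (meson DiffD1 atLeastAtMost_iff greaterThanLessThan_iff less_imp_le less_trans)
  \<comment> \<open>The factor is b - w and not w - b because \<open>density_inversion\<close> takes
    it positive on (a, b) and subtracts the Cauchy transform.\<close>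
  have transform: "exp (- cauchy_int ?f w a b) = (of_real b - w) *
    (of_real 0 * (w - of_real 0) - (LINT u:{a..b}|lborel. of_real (g u) / (w - of_real u)))"
    if w: "Im w > 0" for w
    using minus_of_real_nz[OF w, of b] unfolding dens(2)[OF w, symmetric] tr(2)[OF w]
    by (simp add: field_simps)
  have m: "isCont (\<lambda>w. complex_of_real b - w) (of_real x) \<and> of_real b - of_real x = complex_of_real (b - x) \<and> b - x > 0"
    if "a < x" "x < b" for x
    using that by (intro conjI continuous_intros) auto
  show "AE x in lborel. x \<in> {a..b} \<longrightarrow>
         (\<omega> has_real_derivative
            (- 1 + 2 / pi * arccot (1 / pi *
               (ln ((b - x) / (x - a)) +
                1 / g x * (LINT u:{a..b}|lborel. (g u - g x) / (u - x)))))) (at x)"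
  proof (rule AE_interval_minus_finite[OF S])
    fix x assume x: "x \<in> {a<..<b} - S"
    from density_inversion[OF \<open>a < b\<close> dens(1) f S loc g_pos transform m x]
    have "(\<omega> has_real_derivative 2 * (arccot (1 / pi * (ln ((b - x) / (x - a)) +
      1 / g x * (pv a b g x + 0 * (x - 0)))) / pi) - 1) (at x)"
      using x by (intro half_profile_derivative) auto
    then show "(\<omega> has_real_derivative
            (- 1 + 2 / pi * arccot (1 / pi *
               (ln ((b - x) / (x - a)) +
                1 / g x * (LINT u:{a..b}|lborel. (g u - g x) / (u - x)))))) (at x)"
      by (simp add: pv_def[OF \<open>a < b\<close> dens(1)] diff_quot_def)
  qed
next
  fix \<mu> and h
  assume \<mu>: "is_interior_transition_measure a b \<omega> \<mu>" and h: "has_density_on \<mu> a b h"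
    and C1: "piecewise_C1_bounded_deriv a b h" and pos: "bounded_away_from_0 a b h"
  let ?f = "half_profile a b (\<lambda>x. - \<omega> x)" and ?A = "area a b \<omega>" and ?z = "center a \<omega>"
  have lip: "1-lipschitz_on {a..b} \<omega>" using \<open>\<omega> \<in> diagrams a b\<close> by (simp add: diagrams_def)
  have f: "profile ?f" using \<open>a < b\<close> lip by (intro profile_half_profile lipschitz_on_minus) auto
  note tr = interior_transform[OF \<open>a < b\<close> \<open>\<omega> \<in> diagrams a b\<close> \<mu>]
  have "prob_space \<mu>" by (rule tr(1)[of \<i>]) simp
  note dens = density_on_integral[OF h this]
  have A: "?A > 0" by (rule tr(2)[of \<i>]) simp
  obtain S where S: "finite S" and loc: "\<And>x. x \<in> {a<..<b} - S \<Longrightarrow> locally_lipschitz_at h x"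
    using piecewise_C1_locally_lipschitz[OF C1] by blast
  have h_pos: "h x > 0" if "x \<in> {a<..<b} - S" for x
    using pos that unfolding bounded_away_from_0_def by (meson DiffD1 atLeastAtMost_iff greaterThanLessThan_iff less_imp_le less_trans)
  have transform: "exp (- cauchy_int ?f w a b) = of_real ?A / (2 * (w - of_real a)) *
    (of_real (2 / ?A) * (w - of_real ?z) - (LINT u:{a..b}|lborel. of_real (h u) / (w - of_real u)))"
    if w: "Im w > 0" for w
    using minus_of_real_nz[OF w, of a] A unfolding dens(2)[OF w, symmetric] tr(3)[OF w]
    by (simp add: field_simps)
  have m: "isCont (\<lambda>w. complex_of_real ?A / (2 * (w - of_real a))) (of_real x) \<and>
    of_real ?A / (2 * (of_real x - of_real a)) = complex_of_real (?A / (2 * (x - a))) \<and> ?A / (2 * (x - a)) > 0"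
    if "a < x" "x < b" for x
    using that A by (auto intro!: continuous_intros)
  show "AE x in lborel. x \<in> {a..b} \<longrightarrow>
         (\<omega> has_real_derivative
            (1 - 2 / pi * arccot (1 / pi *
               (ln ((b - x) / (x - a)) +
                1 / h x * ((LINT u:{a..b}|lborel. (h u - h x) / (u - x)) +
                           2 * (x - center a \<omega>) / area a b \<omega>))))) (at x)"
  proof (rule AE_interval_minus_finite[OF S])
    fix x assume x: "x \<in> {a<..<b} - S"
    from density_inversion[OF \<open>a < b\<close> dens(1) f S loc h_pos transform m x]
    have "((\<lambda>x. - \<omega> x) has_real_derivative 2 * (arccot (1 / pi * (ln ((b - x) / (x - a)) +
      1 / h x * (pv a b h x + 2 / ?A * (x - ?z)))) / pi) - 1) (at x)"
      using x by (intro half_profile_derivative) auto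
    \<comment> \<open>The profile was that of -\<omega>; undoing the reflection flips the sign of
      the whole formula.\<close>
    from DERIV_minus[OF this]
    show "(\<omega> has_real_derivative
            (1 - 2 / pi * arccot (1 / pi *
               (ln ((b - x) / (x - a)) +
                1 / h x * ((LINT u:{a..b}|lborel. (h u - h x) / (u - x)) +
                           2 * (x - center a \<omega>) / area a b \<omega>))))) (at x)"
      by (simp add: pv_def[OF \<open>a < b\<close> dens(1)] diff_quot_def)
  qed
qed

end
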